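(* Let $p>2$ be a prime, $\mathbf{F}$ a field of characteristic $p$, and $M\in\mathbf{F}^{2\times4}$. If $\gamma_{1234}(M)\neq0$, $\gamma_{1235}(M)\neq0$ and $\gamma_{1357}(M)\neq0$, then, with $\bar f_1,\bar f_2,\bar f_3$ and $N_M(z)$ as defined in the context, the set $\mathcal B:=\{x,\bar f_1,\bar f_2,\bar f_3,N_M(z)\}$ is a SAGBI basis, and hence a generating set, for $\mathbf{F}[V_M]^E$. Furthermore, $\mathbf{F}[V_M]^E$ is a complete intersection with generating relations coming from the subduction of the têtes-à-têtes $(\bar f_2^{\,p},\bar f_1^{\,p+2})$ and $(\bar f_3^{\,p},\bar f_2\bar f_1^{\,p^2-1})$.
   Context: For $M=(c_{ij})\in\mathbf{F}^{2\times4}$, $E=\langle e_1,e_2,e_3,e_4\rangle\cong(\mathbf{Z}/p)^4$ acts on $\mathbf{F}[V_M]=\mathbf{F}[x,y,z]$ (on the right, by algebra automorphisms) by $x\cdot e_j=x$, $y\cdot e_j=y+c_{1j}x$, $z\cdot e_j=z+2c_{1j}y+(c_{1j}^2+c_{2j})x$; $\mathbf{F}[V_M]^E$ is the ring of invariants. $N_M(z)$ is the product of the distinct elements of the $E$-orbit of $z$. Conventions: graded reverse lexicographic order with $x<y<z$; $\mathrm{LM}$, $\mathrm{LT}$ denote lead monomial and lead term (with coefficient). A finite subset $\mathcal B=\{b_1,\dots,b_m\}$ of a subalgebra $A$ of a polynomial ring is a SAGBI basis for $A$ if the monomials $\mathrm{LM}(b_i)$ generate the algebra spanned by the lead monomials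 of the elements of $A$. A tête-à-tête for $\mathcal B$ is a pair $(b^I,b^J)$ of products of elements of $\mathcal B$ with $\mathrm{LM}(b^I)=\mathrm{LM}(b^J)$. Its subduction: choose a scalar $c$ with $\mathrm{LT}(b^I)=\mathrm{LT}(cb^J)$ and, starting from $b^I-cb^J$, repeatedly cancel the lead term by subtracting scalar multiples of products of elements of $\mathcal B$, for as long as the lead monomial is that of such a product; if this ends at zero, it expresses $b^I-cb^J$ as a polynomial in $\mathcal B$, giving a relation. "Generating relations coming from the subduction of" given têtes-à-têtes means that the kernel of the surjection from the polynomial ring on $m$ variables sending the variables to $b_1,\dots,b_m$ is generated by the relations so obtained. A complete intersection is an algebra having a presentation whose ideal of relations is generated by a regular sequence. Minors: $\Gamma(M)$ is the $10\times4$ matrix whose row $2k+1$ is $(c_{11}^{p^k},\dots,c_{14}^{p^k})$ and whose row $2k+2$ is $(c_{21}^{p^k},\dots,c_{24}^{p^k})$, $k=0,\dots,4$; $\gamma_{ijk\ell}(M)$ is its $4\times4$ minor with rows $i,j,k,\ell$, written $\gamma_{ijk\ell}$ below. Put $\delta:=y^2-xz$ and $$\bar f_1:=\gamma_{1234}y^{p^2}+\gamma_{1235}\delta^px^{p^2-2p}+\gamma_{1245}x^{p^2-p}y^p+\gamma_{1345}\delta x^{p^2-2}+\gamma_{2345}x^{p^2-1}y,$$ $$\bar f_{12346}:=-\gamma_{1234}\delta^{p^2}+\gamma_{1236}\delta^px^{2p^2-2p}+\gamma_{1246}x^{2p^2-p}y^p+\gamma_{1346}\delta x^{2p^2-2}+\gamma_{2346}x^{2p^2-1}y,$$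 $$\bar f_2:=\frac{\bar f_1^{\,2}+\gamma_{1234}\bar f_{12346}}{2x^{p^2-2p}}.$$ The invariant $\bar f_3$ is obtained by subducting the tête-à-tête $(\bar f_1^{\,p+2},\bar f_2^{\,p})$ using $\{x,\bar f_1,\bar f_2\}$, dividing the result by the highest possible power of $x$, and scaling so that $\mathrm{LT}(\bar f_3)=\gamma_{1357}y^{p^3+2}$. For $p\geq5$ this is given explicitly by $$\widetilde{f_3}:=\gamma_{1235}^p\bar f_1^{\,p+2}-\gamma_{1234}^2\bar f_2^{\,p}+\alpha_1x^{p^2-2p}\bar f_1^{\,p}\bar f_2+\alpha_2x^{p^2}\bar f_1^{\,p+1}+\alpha_3x^{2p^2-2p}\bar f_1^{\,p-1}\bar f_2+\alpha_4x^{2p^2-p}\bar f_1^{\,\frac{p-3}{2}}\bar f_2^{\,\frac{p+1}{2}},$$ with $\alpha_1=-2\gamma_{1235}^p$, $\alpha_2=\gamma_{1234}\gamma_{1245}^p$, $\alpha_3=\gamma_{1234}^{p+1}\gamma_{1237}/\gamma_{1235}$, $\alpha_4=\gamma_{1234}^{p+3}\gamma_{1257}/\gamma_{1235}^{(p+3)/2}$, and $$\bar f_3:=-\widetilde{f_3}\,\frac{\gamma_{1235}}{\gamma_{1234}^{2p+2}x^{2p^2-2}}.$$ Under the hypotheses of the claim, $\bar f_1,\bar f_2,\bar f_3$ are elements of $\mathbf{F}[V_M]^E$ with lead monomials $y^{p^2}$, $y^{p^2+2p}$, $y^{p^3+2}$ respectively. *)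

theory Defs
  imports
    "HOL-Library.Poly_Mapping"
    "HOL-Computational_Algebra.Primes"
    "HOL-Algebra.Generated_Rings"
    "HOL-Algebra.Ideal"
    "HOL-Algebra.Product_Groups"
    "HOL-Algebra.Elementary_Groups"
    "Jordan_Normal_Form.Determinant"
begin

section \<open>Multivariate polynomials\<close>

type_synonym 'v mono = "'v \<Rightarrow>\<^sub>0 nat"
type_synonym ('v, 'a) mpoly = "('v \<Rightarrow>\<^sub>0 nat) \<Rightarrow>\<^sub>0 'a"

definition mconst :: "'a::comm_ring_1 \<Rightarrow> ('v, 'a) mpoly"
  where "mconst c = Poly_Mapping.single 0 c"

definition mvar :: "'v \<Rightarrow> ('v, 'a::comm_ring_1) mpoly"
  where "mvar v = Poly_Mapping.single (Poly_Mapping.single v 1) 1"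

definition mscale :: "'a::comm_ring_1 \<Rightarrow> ('v, 'a) mpoly \<Rightarrow> ('v, 'a) mpoly"
  where "mscale c f = mconst c * f"

global_interpretation mpoly_vs:
  vector_space "mscale :: 'a::field \<Rightarrow> ('v, 'a) mpoly \<Rightarrow> ('v, 'a) mpoly"
  by unfold_locales
    (simp_all add: mscale_def mconst_def algebra_simps single_add mult_single
      flip: mult.assoc)

definition mpoly_eval ::
    "('v \<Rightarrow> ('w, 'a::comm_ring_1) mpoly) \<Rightarrow> ('v, 'a) mpoly \<Rightarrow> ('w, 'a) mpoly"
  where "mpoly_eval \<sigma> f =
    (\<Sum>t\<in>Poly_Mapping.keys f. mconst (Poly_Mapping.lookup f t) * (\<Prod>v\<in>Poly_Mapping.keys t. \<sigma> v ^ Poly_Mapping.lookup t v))"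

definition mpoly_ring :: "'v set \<Rightarrow> ('v, 'a::comm_ring_1) mpoly ring"
  where "mpoly_ring V =
    \<lparr>carrier = {f. \<forall>t\<in>Poly_Mapping.keys f. Poly_Mapping.keys t \<subseteq> V}, monoid.mult = (*), one = 1, zero = 0, add = (+)\<rparr>"

definition generated_algebra :: "('v, 'a::comm_ring_1) mpoly set \<Rightarrow> ('v, 'a) mpoly set"
  where "generated_algebra S = generate_ring (mpoly_ring UNIV) (range mconst \<union> S)"

text \<open>The division is exact wherever this is used.\<close>

definition exact_quot :: "('v, 'a::comm_ring_1) mpoly \<Rightarrow> ('v, 'a) mpoly \<Rightarrow> ('v, 'a) mpoly"
  where "exact_quot f g = (THE h. h * g = f)"


section \<open>Graded reverse lexicographic order and lead terms\<close>

definition total_degree :: "'v mono \<Rightarrow> nat"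
  where "total_degree t = (\<Sum>v\<in>Poly_Mapping.keys t. Poly_Mapping.lookup t v)"

text \<open>Among monomials of equal degree the larger one has the smaller exponent at the
  smallest variable at which the two differ.\<close>

definition grevlex_less :: "'v::linorder mono \<Rightarrow> 'v mono \<Rightarrow> bool"
  where "grevlex_less s t \<longleftrightarrow> total_degree s < total_degree t \<or>
    (total_degree s = total_degree t \<and>
      (\<exists>v. Poly_Mapping.lookup t v < Poly_Mapping.lookup s v \<and> (\<forall>w<v. Poly_Mapping.lookup s w = Poly_Mapping.lookup t w)))"

text \<open>Meaningful for nonzero polynomials only; the lead term of 0 is 0.\<close>

definition lead_mono :: "('v::linorder, 'a::comm_ring_1) mpoly \<Rightarrow> 'v mono"
  where "lead_mono f = (THE t. t \<in> Poly_Mapping.keys f \<and> (\<forall>s\<in>Poly_Mapping.keys f - {t}. grevlex_less s t))"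

definition lead_term :: "('v::linorder, 'a::comm_ring_1) mpoly \<Rightarrow> ('v, 'a) mpoly"
  where "lead_term f = Poly_Mapping.single (lead_mono f) (Poly_Mapping.lookup f (lead_mono f))"

definition lead_mono_poly :: "('v::linorder, 'a::comm_ring_1) mpoly \<Rightarrow> ('v, 'a) mpoly"
  where "lead_mono_poly f = Poly_Mapping.single (lead_mono f) 1"


section \<open>SAGBI bases and subduction\<close>

definition is_sagbi_basis ::
    "('v::linorder, 'a::field) mpoly set \<Rightarrow> ('v, 'a) mpoly set \<Rightarrow> bool"
  where "is_sagbi_basis B A \<longleftrightarrow> finite B \<and> B \<subseteq> A \<and> 0 \<notin> B \<and>
    generated_algebra (lead_mono_poly ` B) = mpoly_vs.span (lead_mono_poly ` (A - {0}))"

text \<open>A list \<open>bs\<close> of length \<open>m\<close> is presented by the polynomial ring on the variables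
  \<open>0, \<dots>, m - 1\<close>.  Exponent vectors of products of elements of \<open>bs\<close> are the monomials of
  that ring.\<close>

definition pres_ring :: "('v, 'a::comm_ring_1) mpoly list \<Rightarrow> (nat, 'a) mpoly ring"
  where "pres_ring bs = mpoly_ring {..<length bs}"

definition pres_map :: "('v, 'a::comm_ring_1) mpoly list \<Rightarrow> (nat, 'a) mpoly \<Rightarrow> ('v, 'a) mpoly"
  where "pres_map bs = mpoly_eval (\<lambda>i. bs ! i)"

definition pres_kernel :: "('v, 'a::comm_ring_1) mpoly list \<Rightarrow> (nat, 'a) mpoly set"
  where "pres_kernel bs = a_kernel (pres_ring bs) (mpoly_ring UNIV) (pres_map bs)"

definition pres_mono :: "('v, 'a::comm_ring_1) mpoly list \<Rightarrow> nat mono set"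
  where "pres_mono bs = {I. Poly_Mapping.keys I \<subseteq> {..<length bs}}"

definition bprod :: "('v, 'a::comm_ring_1) mpoly list \<Rightarrow> nat mono \<Rightarrow> ('v, 'a) mpoly"
  where "bprod bs I = (\<Prod>i<length bs. (bs ! i) ^ Poly_Mapping.lookup I i)"

definition tete_a_tete ::
    "('v::linorder, 'a::comm_ring_1) mpoly list \<Rightarrow> nat mono \<Rightarrow> nat mono \<Rightarrow> bool"
  where "tete_a_tete bs I J \<longleftrightarrow> I \<in> pres_mono bs \<and> J \<in> pres_mono bs \<and>
    lead_mono (bprod bs I) = lead_mono (bprod bs J)"

text \<open>The states of the subduction of the pair \<open>(I, J)\<close>, for all possible choices of the
  products used.  A state is recorded as a formal polynomial \<open>Q\<close> in the variables of
  \<open>pres_ring bs\<close>; the polynomial being subducted is \<open>pres_map bs Q\<close>.\<close>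

inductive subduction_state ::
    "('v::linorder, 'a::comm_ring_1) mpoly list \<Rightarrow> nat mono \<Rightarrow> nat mono \<Rightarrow> (nat, 'a) mpoly \<Rightarrow> bool"
  for bs :: "('v, 'a) mpoly list" and I J :: "nat mono"
  where
    start: "tete_a_tete bs I J \<Longrightarrow>
      lead_term (bprod bs I) = lead_term (mconst c * bprod bs J) \<Longrightarrow>
      subduction_state bs I J (Poly_Mapping.single I 1 - Poly_Mapping.single J c)"
  | step: "subduction_state bs I J Q \<Longrightarrow> pres_map bs Q \<noteq> 0 \<Longrightarrow>
      K \<in> pres_mono bs \<Longrightarrow>
      lead_term (pres_map bs Q) = lead_term (mconst d * bprod bs K) \<Longrightarrow>
      subduction_state bs I J (Q - Poly_Mapping.single K d)"

definition subduction_result ::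
    "('v::linorder, 'a::comm_ring_1) mpoly list \<Rightarrow> nat mono \<Rightarrow> nat mono \<Rightarrow> ('v, 'a) mpoly \<Rightarrow> bool"
  where "subduction_result bs I J h \<longleftrightarrow>
    (\<exists>Q. subduction_state bs I J Q \<and> h = pres_map bs Q) \<and>
    (h = 0 \<or> (\<forall>K\<in>pres_mono bs. lead_mono h \<noteq> lead_mono (bprod bs K)))"

definition subduction_relation ::
    "('v::linorder, 'a::comm_ring_1) mpoly list \<Rightarrow> nat mono \<Rightarrow> nat mono \<Rightarrow> (nat, 'a) mpoly \<Rightarrow> bool"
  where "subduction_relation bs I J Q \<longleftrightarrow> subduction_state bs I J Q \<and> pres_map bs Q = 0"


section \<open>Complete intersections\<close>

text \<open>The middle condition says that \<open>rs ! i\<close> is a nonzerodivisor on \<open>R\<close> modulo the ideal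
  generated by its predecessors.\<close>

definition regular_sequence :: "('r, 'm) ring_scheme \<Rightarrow> 'r list \<Rightarrow> bool"
  where "regular_sequence R rs \<longleftrightarrow> set rs \<subseteq> carrier R \<and>
    (\<forall>i<length rs. \<forall>g\<in>carrier R.
      rs ! i \<otimes>\<^bsub>R\<^esub> g \<in> genideal R (set (take i rs)) \<longrightarrow> g \<in> genideal R (set (take i rs))) \<and>
    genideal R (set rs) \<noteq> carrier R"

definition complete_intersection :: "('v, 'a::comm_ring_1) mpoly set \<Rightarrow> bool"
  where "complete_intersection A \<longleftrightarrow>
    (\<exists>bs rs. pres_map bs ` carrier (pres_ring bs) = A \<and>
      regular_sequence (pres_ring bs) rs \<and>
      pres_kernel bs = genideal (pres_ring bs) (set rs))"

text \<open>The presentation given by \<open>bs\<close> is one of a complete intersection, with generating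
  relations the ones coming from the subduction of the pairs in \<open>ts\<close>: each of them
  subducts to zero, and whichever way this is done, the relations obtained form a regular
  sequence generating the ideal of relations.\<close>

definition ci_by_subduction ::
    "('v::linorder, 'a::comm_ring_1) mpoly list \<Rightarrow> (nat mono \<times> nat mono) list \<Rightarrow> bool"
  where "ci_by_subduction bs ts \<longleftrightarrow>
    (\<forall>(I, J)\<in>set ts. tete_a_tete bs I J \<and> (\<exists>r. subduction_relation bs I J r)) \<and>
    (\<forall>rs. list_all2 (\<lambda>(I, J) r. subduction_relation bs I J r) ts rs \<longrightarrow>
      regular_sequence (pres_ring bs) rs \<and>
      pres_kernel bs = genideal (pres_ring bs) (set rs))"


section \<open>The representation and its invariants\<close>

datatype xyz = X | Y | Z

instantiation xyz :: linorder
begin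

fun xyz_rank :: "xyz \<Rightarrow> nat"
  where "xyz_rank X = 0" | "xyz_rank Y = 1" | "xyz_rank Z = 2"

definition less_eq_xyz :: "xyz \<Rightarrow> xyz \<Rightarrow> bool"
  where "less_eq_xyz v w \<longleftrightarrow> xyz_rank v \<le> xyz_rank w"

definition less_xyz :: "xyz \<Rightarrow> xyz \<Rightarrow> bool"
  where "less_xyz v w \<longleftrightarrow> xyz_rank v < xyz_rank w"

instance
proof
  fix v w :: xyz
  assume "v \<le> w" "w \<le> v"
  then show "v = w" by (cases v; cases w) (auto simp: less_eq_xyz_def)
qed (auto simp: less_eq_xyz_def less_xyz_def)

end

text \<open>Entries of \<open>M\<close> are indexed from 1 in \<open>entry\<close>, as are the rows of \<open>gamma_mat\<close> in \<open>gam\<close>.\<close>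

definition entry :: "'a mat \<Rightarrow> nat \<Rightarrow> nat \<Rightarrow> 'a"
  where "entry M i j = M $$ (i - 1, j - 1)"

definition act_gen :: "'a::comm_ring_1 mat \<Rightarrow> nat \<Rightarrow> (xyz, 'a) mpoly \<Rightarrow> (xyz, 'a) mpoly"
  where "act_gen M j = mpoly_eval (\<lambda>v. case v of
      X \<Rightarrow> mvar X
    | Y \<Rightarrow> mvar Y + mconst (entry M 1 j) * mvar X
    | Z \<Rightarrow> mvar Z + mconst (2 * entry M 1 j) * mvar Y
          + mconst (entry M 1 j ^ 2 + entry M 2 j) * mvar X)"

text \<open>\<open>(Z/p)\<^sup>4\<close>, written additively, with coordinates represented in \<open>{0..<p}\<close>; \<open>a\<close> stands for
  the product of the \<open>e\<^sub>j\<close> to the power \<open>a j\<close>.\<close>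

definition E_group :: "nat \<Rightarrow> (nat \<Rightarrow> int) monoid"
  where "E_group p = product_group {1..4} (\<lambda>_. integer_mod_group p)"

definition act :: "'a::comm_ring_1 mat \<Rightarrow> (xyz, 'a) mpoly \<Rightarrow> (nat \<Rightarrow> int) \<Rightarrow> (xyz, 'a) mpoly"
  where "act M f a = fold (\<lambda>j. act_gen M j ^^ nat (a j)) [1, 2, 3, 4] f"

definition invariants :: "nat \<Rightarrow> 'a::comm_ring_1 mat \<Rightarrow> (xyz, 'a) mpoly set"
  where "invariants p M = {f. \<forall>a\<in>carrier (E_group p). act M f a = f}"

definition norm_z :: "nat \<Rightarrow> 'a::comm_ring_1 mat \<Rightarrow> (xyz, 'a) mpoly"
  where "norm_z p M = \<Prod>(act M (mvar Z) ` carrier (E_group p))"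


section \<open>The generators\<close>

definition gamma_mat :: "nat \<Rightarrow> 'a::comm_ring_1 mat \<Rightarrow> 'a mat"
  where "gamma_mat p M = mat 10 4 (\<lambda>(r, j). (M $$ (r mod 2, j)) ^ (p ^ (r div 2)))"

definition gam :: "nat \<Rightarrow> 'a::comm_ring_1 mat \<Rightarrow> nat \<Rightarrow> nat \<Rightarrow> nat \<Rightarrow> nat \<Rightarrow> 'a"
  where "gam p M i j k l =
    det (mat_of_rows 4 (map (\<lambda>r. row (gamma_mat p M) (r - 1)) [i, j, k, l]))"

definition delta :: "(xyz, 'a::comm_ring_1) mpoly"
  where "delta = mvar Y ^ 2 - mvar X * mvar Z"

definition fbar1 :: "nat \<Rightarrow> 'a::comm_ring_1 mat \<Rightarrow> (xyz, 'a) mpoly"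
  where "fbar1 p M =
      mconst (gam p M 1 2 3 4) * mvar Y ^ (p^2)
    + mconst (gam p M 1 2 3 5) * delta ^ p * mvar X ^ (p^2 - 2*p)
    + mconst (gam p M 1 2 4 5) * mvar X ^ (p^2 - p) * mvar Y ^ p
    + mconst (gam p M 1 3 4 5) * delta * mvar X ^ (p^2 - 2)
    + mconst (gam p M 2 3 4 5) * mvar X ^ (p^2 - 1) * mvar Y"

definition fbar12346 :: "nat \<Rightarrow> 'a::comm_ring_1 mat \<Rightarrow> (xyz, 'a) mpoly"
  where "fbar12346 p M =
    - mconst (gam p M 1 2 3 4) * delta ^ (p^2)
    + mconst (gam p M 1 2 3 6) * delta ^ p * mvar X ^ (2*p^2 - 2*p)
    + mconst (gam p M 1 2 4 6) * mvar X ^ (2*p^2 - p) * mvar Y ^ p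
    + mconst (gam p M 1 3 4 6) * delta * mvar X ^ (2*p^2 - 2)
    + mconst (gam p M 2 3 4 6) * mvar X ^ (2*p^2 - 1) * mvar Y"

definition fbar2 :: "nat \<Rightarrow> 'a::comm_ring_1 mat \<Rightarrow> (xyz, 'a) mpoly"
  where "fbar2 p M = exact_quot (fbar1 p M ^ 2 + mconst (gam p M 1 2 3 4) * fbar12346 p M)
                                (2 * mvar X ^ (p^2 - 2*p))"

text \<open>For \<open>gam p M 1 2 3 4\<close>, \<open>gam p M 1 2 3 5\<close>, \<open>gam p M 1 3 5 7\<close> nonzero there is exactly one
  such polynomial.  The subduction has only one possible outcome: everything is homogeneous, so
  after the initial cancellation each lead monomial below that of the pair is the lead monomial
  of at most one product of \<open>x\<close>, \<open>fbar1\<close>, \<open>fbar2\<close>.\<close>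

definition fbar3 :: "nat \<Rightarrow> 'a::comm_ring_1 mat \<Rightarrow> (xyz, 'a) mpoly"
  where "fbar3 p M = (THE f. \<exists>h n g s.
    subduction_result [mvar X, fbar1 p M, fbar2 p M]
      (Poly_Mapping.single 1 (p + 2)) (Poly_Mapping.single 2 p) h \<and>
    h = mvar X ^ n * g \<and> \<not> mvar X dvd g \<and>
    f = mconst s * g \<and>
    lead_term f = Poly_Mapping.single (Poly_Mapping.single Y (p^3 + 2)) (gam p M 1 3 5 7))"

end

(* Up to powers of x the invariants are the polynomials in x, fbar1 and fbar2. Indeed, expand an
   invariant in monomials y^j delta^k with j, k < p^2 over x, fbar1, fbar12346 (whose leading forms,
   y and delta having weights 1 and 2, are multiples of y^(p^2) and delta^(p^2)); the p^4 translations
   of the group separate these p^4 monomials, so only j = k = 0 survives.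

   As polynomials in fbar2, and up to powers of x, fbar3 and N(z) have lead terms fbar2^p and
   fbar2^(p^2). Writing exponents of fbar2 in base p, every invariant times a power of x is therefore
   a combination of products x^i fbar1^a fbar2^b fbar3^c N(z)^d with b, c < p. The lead monomials of
   these are distinct, so the power of x can be cancelled: in a combination divisible by x the
   products without x do not occur. Hence the products form a basis of the invariants and every lead
   monomial is that of a product.

   For a suitable weight the two relations have lead monomials b_2^p and b_3^p, coprime powers of
   variables. So they form a regular sequence, and the monomials with both exponents below p span the
   quotient; as these map to the above basis, the relations generate the kernel.

   The lead term of fbar3 is computed modulo x^(2p^2 - 1); its coefficient is made explicit by two
   Pluecker relations between the minors. *)

theory Submission
  imports Defs "HOL-Library.Product_Lexorder"
begin

subsection \<open>Polynomials\<close>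

text \<open>The pair \<open>y\<close>, \<open>delta\<close> is chosen because a translation acts
  additively on it: \<open>y\<close> goes to y + c x and \<open>delta\<close> to delta + v x^2. On
  the p^4 points (c, v) the powers c^(p^2) and v^(p^2) are combinations of lower ones, with the very
  minors as coefficients that define \<open>fbar1\<close> and \<open>fbar12346\<close>. So the
  monomials with both exponents below p^2 serve twice: they interpolate every function on the group,
  and they are the remainders modulo \<open>fbar1\<close> and \<open>fbar12346\<close>. The latter
  is traded for \<open>fbar2\<close> through the equation that defines \<open>fbar2\<close>. The
  obstacle is \<open>fbar3\<close>, specified by a subduction with choices. Homogeneity makes its
  outcome unique; its coefficients come from a triangular linear system, since p = 3 contributes
  terms (\<open>eps\<close>, \<open>tt\<close>) that are absent for p >= 5. The modulus x^(2p^2 - 1)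
  is one above the power of x that accompanies the surviving y^(p^3 + 2). The two relations are
  never written out: since lead monomials of products exhaust all lead monomials, each pair subducts
  to zero, and whatever the steps add is lighter than both monomials of the pair.\<close>

abbreviation "lookup \<equiv> Poly_Mapping.lookup"
abbreviation "keys \<equiv> Poly_Mapping.keys"
abbreviation "single \<equiv> Poly_Mapping.single"

lemma mconst_0 [simp]: "mconst 0 = 0"
  by (simp add: mconst_def)

lemma mconst_1 [simp]: "mconst 1 = 1"
  by (simp add: mconst_def)

lemma mconst_add: "mconst (a + b) = mconst a + mconst b"
  by (simp add: mconst_def single_add)

lemma mconst_mult: "mconst (a * b) = mconst a * mconst b"
  by (simp add: mconst_def mult_single)

lemma mconst_uminus: "mconst (- a) = - mconst a"
  by (simp add: mconst_def single_uminus)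

lemma mconst_diff: "mconst (a - b) = mconst a - mconst b"
  by (simp add: mconst_def single_diff)

lemma mconst_power: "mconst (a ^ n) = mconst a ^ n"
  by (induction n) (simp_all add: mconst_mult)

lemma mconst_of_nat [simp]: "mconst (of_nat n) = of_nat n"
  by (simp add: mconst_def)

lemma mconst_numeral [simp]: "mconst (numeral n) = numeral n"
  by (simp add: mconst_def)

lemma mconst_sum: "mconst (sum f A) = (\<Sum>i\<in>A. mconst (f i))"
  by (induction A rule: infinite_finite_induct) (simp_all add: mconst_add)

lemma mconst_eq_0_iff [simp]: "mconst c = (0 :: ('v, 'a::comm_ring_1) mpoly) \<longleftrightarrow> c = 0"
proof
  assume "mconst c = (0 :: ('v, 'a) mpoly)"
  then have "lookup (mconst c :: ('v, 'a) mpoly) 0 = 0" by simp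
  then show "c = 0" by (simp add: mconst_def)
qed simp

lemma lookup_mconst_mult [simp]:
  "lookup (mconst c * f) t = c * lookup f t"
  by (simp add: mconst_def mult_map_scale_conv_mult[symmetric] Poly_Mapping.map.rep_eq when_def)

text \<open>Lets the Frobenius identities, stated for a commutative ring of characteristic
  \<open>p\<close>, be used in the polynomial ring itself.\<close>

lemma CHAR_mpoly: "CHAR(('v, 'a::comm_ring_1) mpoly) = CHAR('a)"
proof (rule CHAR_eqI)
  show "of_nat CHAR('a) = (0 :: ('v, 'a) mpoly)"
    by (metis mconst_0 mconst_of_nat of_nat_CHAR)
  fix n :: nat
  assume "of_nat n = (0 :: ('v, 'a) mpoly)"
  then have "mconst (of_nat n :: 'a) = (0 :: ('v, 'a) mpoly)" by simp
  then show "CHAR('a) dvd n" by (simp only: mconst_eq_0_iff of_nat_eq_0_iff_char_dvd)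
qed

section \<open>Evaluation of monomials and polynomials\<close>

definition mono_eval :: "('v \<Rightarrow> 'b::comm_monoid_mult) \<Rightarrow> 'v mono \<Rightarrow> 'b"
  where "mono_eval \<sigma> t = (\<Prod>v\<in>keys t. \<sigma> v ^ lookup t v)"

lemma mono_eval_superset:
  assumes "finite V" "keys t \<subseteq> V"
  shows "mono_eval \<sigma> t = (\<Prod>v\<in>V. \<sigma> v ^ lookup t v)"
  unfolding mono_eval_def using assms
  by (intro prod.mono_neutral_left) (auto simp: in_keys_iff)

lemma mono_eval_0 [simp]: "mono_eval \<sigma> 0 = 1"
  by (simp add: mono_eval_def)

lemma mono_eval_single [simp]: "mono_eval \<sigma> (single v n) = \<sigma> v ^ n"
  by (cases "n = 0") (simp_all add: mono_eval_def)

lemma mono_eval_add: "mono_eval \<sigma> (s + t) = mono_eval \<sigma> s * mono_eval \<sigma> t"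
proof -
  let ?V = "keys s \<union> keys t"
  have "keys (s + t) \<subseteq> ?V" by (rule keys_add)
  then show ?thesis
    by (simp add: mono_eval_superset[of ?V] lookup_add power_add prod.distrib)
qed

lemma single_eq_mconst_mult:
  "(single t c :: ('v, 'a::comm_ring_1) mpoly) = mconst c * mono_eval mvar t"
proof -
  have pow: "(mvar v :: ('v, 'a) mpoly) ^ n = single (single v n) 1" for v n
    by (induction n) (simp_all add: mvar_def mult_single flip: single_add)
  have "mono_eval mvar t = (single t 1 :: ('v, 'a) mpoly)"
  proof -
    have "(\<Prod>v\<in>V. mvar v ^ lookup t v) =
      (single (\<Sum>v\<in>V. single v (lookup t v)) 1 :: ('v, 'a) mpoly)"
      if "finite V" for V
      using that by (induction V rule: finite_induct) (simp_all add: pow mult_single)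
    moreover have "(\<Sum>v\<in>keys t. single v (lookup t v)) = t"
      by (rule poly_mapping_eqI)
        (simp add: lookup_sum lookup_single when_def in_keys_iff)
    ultimately show ?thesis
      by (simp add: mono_eval_def)
  qed
  then show ?thesis
    by (simp add: mconst_def mult_single)
qed

lemma mvar_power: "mvar v ^ n = single (single v n) 1"
  by (simp add: single_eq_mconst_mult)

lemma mvar_nz [simp]: "(mvar v :: ('v, 'a::comm_ring_1) mpoly) \<noteq> 0"
proof -
  have "lookup (mvar v :: ('v, 'a) mpoly) (single v 1) = 1" by (simp only: mvar_def lookup_single_eq)
  then show ?thesis by auto
qed

lemma mpoly_eval_superset:
  assumes "finite T" "keys f \<subseteq> T"
  shows "mpoly_eval \<sigma> f = (\<Sum>t\<in>T. mconst (lookup f t) * mono_eval \<sigma> t)"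
  unfolding mpoly_eval_def mono_eval_def[symmetric] using assms
  by (intro sum.mono_neutral_left) (auto simp: in_keys_iff)

lemma mpoly_eval_add: "mpoly_eval \<sigma> (f + g) = mpoly_eval \<sigma> f + mpoly_eval \<sigma> g"
proof -
  let ?T = "keys f \<union> keys g"
  have "keys (f + g) \<subseteq> ?T" by (rule keys_add)
  then show ?thesis
    by (simp add: mpoly_eval_superset[of ?T] lookup_add mconst_add distrib_right sum.distrib)
qed

lemma mpoly_eval_0 [simp]: "mpoly_eval \<sigma> 0 = 0"
  by (simp add: mpoly_eval_def)

lemma mpoly_eval_sum: "mpoly_eval \<sigma> (sum f A) = (\<Sum>i\<in>A. mpoly_eval \<sigma> (f i))"
  by (induction A rule: infinite_finite_induct) (simp_all add: mpoly_eval_add)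

lemma mpoly_eval_single: "mpoly_eval \<sigma> (single t c) = mconst c * mono_eval \<sigma> t"
  by (cases "c = 0") (simp_all add: mpoly_eval_def mono_eval_def)

lemma mpoly_expand: "f = (\<Sum>t\<in>keys f. single t (lookup f t))"
  by (rule poly_mapping_eqI) (simp add: lookup_sum lookup_single when_def in_keys_iff)

lemma mpoly_eval_mult: "mpoly_eval \<sigma> (f * g) = mpoly_eval \<sigma> f * mpoly_eval \<sigma> g"
proof -
  have "mpoly_eval \<sigma> (f * g) = (\<Sum>s\<in>keys f. \<Sum>t\<in>keys g.
      mpoly_eval \<sigma> (single s (lookup f s) * single t (lookup g t)))"
    by (subst mpoly_expand[of f], subst mpoly_expand[of g])
      (simp add: sum_product mpoly_eval_sum)
  also have "\<dots> = mpoly_eval \<sigma> f * mpoly_eval \<sigma> g"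
    unfolding mult_single mpoly_eval_single
    by (simp add: mpoly_eval_def mono_eval_def[symmetric] sum_product mono_eval_add mconst_mult mult_ac)
  finally show ?thesis .
qed

section \<open>Homomorphisms of polynomial algebras\<close>

definition alg_hom :: "(('v, 'a::comm_ring_1) mpoly \<Rightarrow> ('w, 'a) mpoly) \<Rightarrow> bool"
  where "alg_hom h \<longleftrightarrow> (\<forall>f g. h (f + g) = h f + h g) \<and> (\<forall>f g. h (f * g) = h f * h g) \<and>
    (\<forall>c. h (mconst c) = mconst c)"

lemma alg_hom_mpoly_eval: "alg_hom (mpoly_eval \<sigma>)"
  by (simp add: alg_hom_def mpoly_eval_add mpoly_eval_mult mpoly_eval_single[of _ 0, folded mconst_def])

lemma mpoly_eval_mvar [simp]: "mpoly_eval \<sigma> (mvar v) = \<sigma> v"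
  by (simp add: mvar_def mpoly_eval_single)

lemma alg_hom_id: "alg_hom (\<lambda>f. f)"
  by (simp add: alg_hom_def)

lemma alg_hom_comp: "alg_hom h \<Longrightarrow> alg_hom k \<Longrightarrow> alg_hom (\<lambda>f. h (k f))"
  by (simp add: alg_hom_def)

context
  fixes h :: "('v, 'a::comm_ring_1) mpoly \<Rightarrow> ('w, 'a) mpoly"
  assumes h: "alg_hom h"
begin

lemma alg_hom_add: "h (f + g) = h f + h g"
  using h by (simp add: alg_hom_def)

lemma alg_hom_mult: "h (f * g) = h f * h g"
  using h by (simp add: alg_hom_def)

lemma alg_hom_mconst: "h (mconst c) = mconst c"
  using h by (simp add: alg_hom_def)

lemma alg_hom_0: "h 0 = 0"
  using alg_hom_mconst[of 0] by simp

lemma alg_hom_1: "h 1 = 1"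
  using alg_hom_mconst[of 1] by simp

lemma alg_hom_uminus: "h (- f) = - h f"
  using alg_hom_add[of f "- f"] by (simp add: alg_hom_0 eq_neg_iff_add_eq_0 add.commute)

lemma alg_hom_diff: "h (f - g) = h f - h g"
  using alg_hom_add[of f "- g"] by (simp add: alg_hom_uminus)

lemma alg_hom_power: "h (f ^ n) = h f ^ n"
  by (induction n) (simp_all add: alg_hom_1 alg_hom_mult)

lemma alg_hom_sum: "h (sum f A) = (\<Sum>i\<in>A. h (f i))"
  by (induction A rule: infinite_finite_induct) (simp_all add: alg_hom_0 alg_hom_add)

lemma alg_hom_prod: "h (prod f A) = (\<Prod>i\<in>A. h (f i))"
  by (induction A rule: infinite_finite_induct) (simp_all add: alg_hom_1 alg_hom_mult)

lemma alg_hom_numeral: "h (numeral n) = numeral n"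
  using alg_hom_mconst[of "numeral n"] by simp

lemma alg_hom_mono_eval: "h (mono_eval \<sigma> t) = mono_eval (\<lambda>v. h (\<sigma> v)) t"
  by (simp add: mono_eval_def alg_hom_prod alg_hom_power)

text \<open>The universal property of the polynomial ring. Identities between translations are
  thereby checked on \<open>X\<close>, \<open>Y\<close>, \<open>Z\<close> only.\<close>

lemma alg_hom_eq_mpoly_eval: "h f = mpoly_eval (\<lambda>v. h (mvar v)) f"
proof -
  have "h f = (\<Sum>t\<in>keys f. h (single t (lookup f t)))"
    by (subst mpoly_expand[of f]) (simp add: alg_hom_sum)
  then show ?thesis
    by (simp add: mpoly_eval_def mono_eval_def[symmetric] single_eq_mconst_mult alg_hom_mult
        alg_hom_mconst alg_hom_mono_eval)
qed

end

lemmas alg_hom_simps = alg_hom_add alg_hom_mult alg_hom_mconst alg_hom_0 alg_hom_1 alg_hom_uminus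
  alg_hom_diff alg_hom_power alg_hom_sum alg_hom_prod alg_hom_numeral

lemma alg_hom_eqI:
  assumes "alg_hom h" "alg_hom k" "\<And>v. h (mvar v) = k (mvar v)"
  shows "h = k"
proof
  fix f
  show "h f = k f"
    by (subst (1 2) alg_hom_eq_mpoly_eval) (simp_all add: assms)
qed


section \<open>Lead monomials with respect to a key\<close>

definition compat_key :: "('v mono \<Rightarrow> 'o::linorder) \<Rightarrow> bool"
  where "compat_key \<kappa> \<longleftrightarrow> (\<forall>s t u. \<kappa> s < \<kappa> t \<longrightarrow> \<kappa> (s + u) < \<kappa> (t + u))"

text \<open>The order is given by a key so that one theory serves both \<open>key3\<close>, which is
  injective, and the weight \<open>wt\<close>, which takes equal values on some distinct monomials.
  Hence the strict inequality against every other monomial.\<close>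

definition leads :: "('v mono \<Rightarrow> 'o::linorder) \<Rightarrow> ('v, 'a::comm_ring_1) mpoly \<Rightarrow> 'v mono \<Rightarrow> bool"
  where "leads \<kappa> f t \<longleftrightarrow> t \<in> keys f \<and>
    (\<forall>s\<in>keys f. s \<noteq> t \<longrightarrow> \<kappa> s < \<kappa> t)"

text \<open>Split each factor into its lead term and a rest. Every product of monomials other than
  the two leading ones has a factor strictly below the leading one, and compatibility of the key
  carries this to the sum of the exponents. Over a domain the lead coefficient does not
  vanish.\<close>

lemma leads_mult:
  fixes f g :: "('v, 'a::idom) mpoly"
  assumes \<kappa>: "compat_key \<kappa>" and f: "leads \<kappa> f s" and g: "leads \<kappa> g t"
  shows "leads \<kappa> (f * g) (s + t)"
    and "lookup (f * g) (s + t) = lookup f s * lookup g t"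
proof -
  define f' where "f' = f - single s (lookup f s)"
  define g' where "g' = g - single t (lookup g t)"
  have f': "u \<in> keys f \<and> \<kappa> u < \<kappa> s" if "u \<in> keys f'" for u
    using that f by (auto simp: f'_def leads_def in_keys_iff lookup_minus lookup_single when_def split: if_splits)
  have g': "u \<in> keys g \<and> \<kappa> u < \<kappa> t" if "u \<in> keys g'" for u
    using that g by (auto simp: g'_def leads_def in_keys_iff lookup_minus lookup_single when_def split: if_splits)
  have le: "u = t \<or> \<kappa> u < \<kappa> t" if "u \<in> keys g" for u
    using that g by (auto simp: leads_def)
  define r where "r = single s (lookup f s) * g' + f' * g"
  have eq: "f * g = single (s + t) (lookup f s * lookup g t) + r"
    by (simp add: r_def f'_def g'_def algebra_simps mult_single)
  \<comment> \<open>The third assumption rules out that both summands are the leading ones, so at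
    least one of the two comparisons is strict.\<close>
  have lt: "\<kappa> (a + b) < \<kappa> (s + t)" if "a = s \<or> \<kappa> a < \<kappa> s" "b = t \<or> \<kappa> b < \<kappa> t" "a = s \<Longrightarrow> b \<noteq> t" for a b
  proof -
    have 1: "\<kappa> (x + u) < \<kappa> (y + u)" if "\<kappa> x < \<kappa> y" for x y u
      using \<kappa> that by (simp add: compat_key_def)
    show ?thesis
      using that 1[of a s b] 1[of b t s] by (auto simp: add.commute intro: less_trans)
  qed
  have r: "\<kappa> u < \<kappa> (s + t)" if "u \<in> keys r" for u
  proof -
    have "u \<in> keys (single s (lookup f s) * g') \<or> u \<in> keys (f' * g)"
      using that keys_add[of "single s (lookup f s) * g'" "f' * g"]
      unfolding r_def by blast
    then show ?thesis
    proof
      assume "u \<in> keys (single s (lookup f s) * g')"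
      then obtain b where "b \<in> keys g'" "u = s + b"
        using keys_mult[of "single s (lookup f s)" g'] by (auto split: if_splits)
      then show ?thesis using g'[of b] lt[of s b] by auto
    next
      assume "u \<in> keys (f' * g)"
      then obtain a b where "a \<in> keys f'" "b \<in> keys g" "u = a + b"
        using keys_mult[of f' g] by auto
      then show ?thesis using f'[of a] lt[of a b] le[of b] by auto
    qed
  qed
  have "lookup r (s + t) = 0"
    using r[of "s + t"] by (auto simp: in_keys_iff)
  then show l: "lookup (f * g) (s + t) = lookup f s * lookup g t"
    by (simp add: eq lookup_add)
  show "leads \<kappa> (f * g) (s + t)"
    unfolding leads_def
  proof (intro conjI ballI impI)
    show "s + t \<in> keys (f * g)"
      using f g by (simp add: in_keys_iff l leads_def)
    fix u assume "u \<in> keys (f * g)" "u \<noteq> s + t"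
    then have "u \<in> keys r"
      by (auto simp: eq in_keys_iff lookup_add lookup_single when_def)
    then show "\<kappa> u < \<kappa> (s + t)" by (rule r)
  qed
qed

lemma leads_single: "c \<noteq> 0 \<Longrightarrow> leads \<kappa> (single t c) t"
  by (simp add: leads_def)

lemma leads_one: "leads \<kappa> (1 :: ('v, 'a::idom) mpoly) 0"
  by (simp add: leads_def)

lemma leads_power:
  fixes f :: "('v, 'a::idom) mpoly"
  assumes "compat_key \<kappa>" "leads \<kappa> f (single v m)"
  shows "leads \<kappa> (f ^ n) (single v (n * m)) \<and>
    lookup (f ^ n) (single v (n * m)) = lookup f (single v m) ^ n"
proof (induction n)
  case (Suc n)
  then show ?case
    using leads_mult[OF assms(1) assms(2), of "f ^ n" "single v (n * m)"]
    by (simp flip: single_add)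
qed (simp add: leads_one)

text \<open>Take the index whose lead monomial has the largest key. Another summand containing this
  monomial would have a lead monomial with a still larger key, so nothing cancels it. In particular
  the sum is not zero, which is how linear independence is obtained later.\<close>

lemma leads_sum_key:
  fixes b :: "'i \<Rightarrow> ('v, 'a::idom) mpoly"
  assumes "finite I" "I \<noteq> {}" "inj_on \<phi> I" "\<And>i. i \<in> I \<Longrightarrow> leads \<kappa> (b i) (\<phi> i)" "\<And>i. i \<in> I \<Longrightarrow> c i \<noteq> 0"
  shows "\<exists>i\<in>I. \<phi> i \<in> keys (\<Sum>i\<in>I. mconst (c i) * b i) \<and> (\<forall>j\<in>I. \<kappa> (\<phi> j) \<le> \<kappa> (\<phi> i))"
proof -
  have "Max ((\<lambda>i. \<kappa> (\<phi> i)) ` I) \<in> (\<lambda>i. \<kappa> (\<phi> i)) ` I"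
    using assms by simp
  then obtain i where i: "i \<in> I" "\<kappa> (\<phi> i) = Max ((\<lambda>i. \<kappa> (\<phi> i)) ` I)" by auto
  then have max: "\<kappa> (\<phi> j) \<le> \<kappa> (\<phi> i)" if "j \<in> I" for j
    using that assms by simp
  have 0: "lookup (b j) (\<phi> i) = 0" if "j \<in> I - {i}" for j
  proof (rule ccontr)
    assume "lookup (b j) (\<phi> i) \<noteq> 0"
    then have "\<phi> i \<in> keys (b j)" by (simp add: in_keys_iff)
    moreover have "\<phi> i \<noteq> \<phi> j" using assms(3) i that by (auto simp: inj_on_def)
    ultimately have "\<kappa> (\<phi> i) < \<kappa> (\<phi> j)" using assms(4)[of j] that by (auto simp: leads_def)
    then show False using max[of j] that by auto
  qed
  have "lookup (\<Sum>i\<in>I. mconst (c i) * b i) (\<phi> i) = (\<Sum>j\<in>I. c j * lookup (b j) (\<phi> i))"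
    by (simp add: lookup_sum)
  also have "\<dots> = c i * lookup (b i) (\<phi> i)"
    using 0 i assms(1) by (subst sum.remove[of I i]) auto
  finally have "\<phi> i \<in> keys (\<Sum>i\<in>I. mconst (c i) * b i)"
    using i assms(4,5) by (auto simp: in_keys_iff leads_def)
  then show ?thesis using i max by blast
qed

text \<open>With an injective key distinct lead monomials cannot tie, so the monomial that survives
  is the lead monomial of the sum.\<close>

lemma leads_sum:
  fixes b :: "'i \<Rightarrow> ('v, 'a::idom) mpoly"
  assumes "finite I" "I \<noteq> {}" "inj_on \<phi> I" "\<And>i. i \<in> I \<Longrightarrow> leads \<kappa> (b i) (\<phi> i)" "\<And>i. i \<in> I \<Longrightarrow> c i \<noteq> 0"
    and "inj \<kappa>"
  shows "\<exists>i\<in>I. leads \<kappa> (\<Sum>i\<in>I. mconst (c i) * b i) (\<phi> i) \<and> (\<forall>j\<in>I. \<kappa> (\<phi> j) \<le> \<kappa> (\<phi> i))"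
proof -
  have "\<exists>i\<in>I. \<phi> i \<in> keys (\<Sum>i\<in>I. mconst (c i) * b i) \<and> (\<forall>j\<in>I. \<kappa> (\<phi> j) \<le> \<kappa> (\<phi> i))"
    by (rule leads_sum_key) (use assms in auto)
  then obtain i where i: "i \<in> I" "\<phi> i \<in> keys (\<Sum>i\<in>I. mconst (c i) * b i)" "\<forall>j\<in>I. \<kappa> (\<phi> j) \<le> \<kappa> (\<phi> i)"
    by blast
  moreover have "\<kappa> s < \<kappa> (\<phi> i)" if s: "s \<in> keys (\<Sum>i\<in>I. mconst (c i) * b i)" "s \<noteq> \<phi> i" for s
  proof -
    obtain j where j: "j \<in> I" "s \<in> keys (mconst (c j) * b j)"
      using s keys_sum[of "\<lambda>i. mconst (c i) * b i" I] by auto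
    then have "s \<in> keys (b j)" by (auto simp: in_keys_iff)
    then have "s = \<phi> j \<or> \<kappa> s < \<kappa> (\<phi> j)" using assms(4)[OF j(1)] by (auto simp: leads_def)
    then show ?thesis using i(3) j(1) s(2) assms(6)
      by (metis injD le_less_trans less_le)
  qed
  ultimately show ?thesis by (auto simp: leads_def)
qed

section \<open>Total degree and homogeneous polynomials\<close>

lemma total_degree_superset:
  assumes "finite V" "keys t \<subseteq> V"
  shows "total_degree t = (\<Sum>v\<in>V. lookup t v)"
  unfolding total_degree_def using assms
  by (intro sum.mono_neutral_left) (auto simp: in_keys_iff)

lemma total_degree_add: "total_degree (s + t) = total_degree s + total_degree t"
proof -
  let ?V = "keys s \<union> keys t"
  have "keys (s + t) \<subseteq> ?V" by (rule keys_add)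
  then show ?thesis
    by (simp add: total_degree_superset[of ?V] lookup_add sum.distrib)
qed

lemma total_degree_single [simp]: "total_degree (single v n) = n"
  by (cases "n = 0") (simp_all add: total_degree_def)

lemma total_degree_0 [simp]: "total_degree 0 = 0"
  by (simp add: total_degree_def)

definition homog :: "nat \<Rightarrow> ('v, 'a::comm_ring_1) mpoly \<Rightarrow> bool"
  where "homog d f \<longleftrightarrow> (\<forall>t\<in>keys f. total_degree t = d)"

lemma homog_0 [simp]: "homog d 0"
  by (simp add: homog_def)

lemma homog_1: "homog 0 1"
  by (simp add: homog_def)

lemma homog_mconst: "homog 0 (mconst c)"
  by (simp add: homog_def mconst_def)

lemma homog_mvar: "homog 1 (mvar v)"
  by (simp add: homog_def mvar_def)

lemma homog_add: "homog d f \<Longrightarrow> homog d g \<Longrightarrow> homog d (f + g)"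
  unfolding homog_def using keys_add[of f g] by blast

lemma homog_uminus: "homog d f \<Longrightarrow> homog d (- f)"
  by (auto simp: homog_def in_keys_iff)

lemma homog_diff: "homog d f \<Longrightarrow> homog d g \<Longrightarrow> homog d (f - g)"
  using homog_add[of d f "- g"] by (simp add: homog_uminus)

lemma homog_mult: "homog d f \<Longrightarrow> homog e g \<Longrightarrow> homog (d + e) (f * g)"
  unfolding homog_def using keys_mult[of f g] by (fastforce simp: total_degree_add)

lemma homog_mconst_mult: "homog d f \<Longrightarrow> homog d (mconst c * f)"
  using homog_mult[OF homog_mconst] by fastforce

lemma homog_power: "homog d f \<Longrightarrow> homog (n * d) (f ^ n)"
  by (induction n) (auto simp: homog_1 homog_mult)

lemma homog_prod: "(\<And>i. i \<in> A \<Longrightarrow> homog (d i) (f i)) \<Longrightarrow> homog (sum d A) (prod f A)"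
  by (induction A rule: infinite_finite_induct) (auto simp: homog_1 homog_mult)

subsection \<open>Lead monomials in three variables\<close>

lemma UNIV_xyz: "UNIV = {X, Y, Z}"
  using xyz.exhaust by auto

lemma finite_xyz [simp]: "finite (A :: xyz set)"
  by (rule finite_subset[OF subset_UNIV]) (simp add: UNIV_xyz)

lemma total_degree_xyz:
  "total_degree t = lookup t X + lookup t Y + lookup t Z"
proof -
  have "keys t \<subseteq> {X, Y, Z}" by (auto simp flip: UNIV_xyz)
  then show ?thesis by (simp add: total_degree_superset[of "{X, Y, Z}"])
qed

definition xm :: "nat \<Rightarrow> nat \<Rightarrow> nat \<Rightarrow> xyz mono"
  where "xm a b c = single X a + single Y b + single Z c"

lemma lookup_xm [simp]:
  "lookup (xm a b c) X = a"
  "lookup (xm a b c) Y = b"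
  "lookup (xm a b c) Z = c"
  by (simp_all add: xm_def lookup_add lookup_single)

lemma xyz_mono_eqI:
  assumes "lookup s X = lookup t X"
    "lookup s Y = lookup t Y"
    "lookup s Z = lookup t Z"
  shows "s = t"
  using assms by (intro poly_mapping_eqI) (metis xyz.exhaust)

lemma xm_inject [simp]: "xm a b c = xm a' b' c' \<longleftrightarrow> a = a' \<and> b = b' \<and> c = c'"
  by (metis lookup_xm)

lemma xm_add: "xm a b c + xm a' b' c' = xm (a + a') (b + b') (c + c')"
  by (rule xyz_mono_eqI) (simp_all add: lookup_add)

lemma xm_simps [simp]:
  "single X n = xm n 0 0" "single Y n = xm 0 n 0"
  "single Z n = xm 0 0 n"
  by (simp_all add: xm_def)

lemma xm_0: "xm 0 0 0 = 0"
  by (rule xyz_mono_eqI) simp_all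

lemma total_degree_xm [simp]: "total_degree (xm a b c) = a + b + c"
  by (simp add: total_degree_xyz)

text \<open>The graded reverse lexicographic order with \<open>x < y < z\<close> as a lexicographic one.\<close>

definition key3 :: "xyz mono \<Rightarrow> nat \<times> nat \<times> nat"
  where "key3 t = (total_degree t, lookup t Y + lookup t Z, lookup t Z)"

lemma compat_key3: "compat_key key3"
  by (auto simp: compat_key_def key3_def less_prod_def' total_degree_add lookup_add)

lemma inj_key3: "inj key3"
  by (rule injI) (auto simp: key3_def total_degree_xyz intro!: xyz_mono_eqI)

text \<open>In equal degree a smaller exponent of \<open>X\<close> is a larger sum of the exponents
  of \<open>Y\<close> and \<open>Z\<close>; if these sums agree too, a smaller exponent of
  \<open>Y\<close> is a larger one of \<open>Z\<close>.\<close>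

lemma grevlex_less_iff: "grevlex_less s t \<longleftrightarrow> key3 s < key3 t"
proof -
  have "(\<exists>v. lookup t v < lookup s v \<and>
        (\<forall>w<v. lookup s w = lookup t w)) \<longleftrightarrow>
      lookup t X < lookup s X \<or>
      lookup s X = lookup t X \<and> lookup t Y < lookup s Y \<or>
      lookup s X = lookup t X \<and> lookup s Y = lookup t Y \<and>
        lookup t Z < lookup s Z"
    (is "?L \<longleftrightarrow> ?R")
  proof -
    have lt: "w < X \<longleftrightarrow> False" "w < Y \<longleftrightarrow> w = X" "w < Z \<longleftrightarrow> w = X \<or> w = Y" for w
      by (cases w; simp add: less_xyz_def)+
    have "?L \<longleftrightarrow> (\<exists>v\<in>{X, Y, Z}. lookup t v < lookup s v \<and>
        (\<forall>w<v. lookup s w = lookup t w))"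
      by (simp add: UNIV_xyz[symmetric])
    then show ?thesis by (auto simp: lt)
  qed
  then show ?thesis
    by (auto simp: grevlex_less_def key3_def less_prod_def' total_degree_xyz)
qed

abbreviation leads3 :: "(xyz, 'a::comm_ring_1) mpoly \<Rightarrow> xyz mono \<Rightarrow> bool"
  where "leads3 \<equiv> leads key3"

lemma leads3_lead_mono: "leads3 f t \<Longrightarrow> lead_mono f = t"
  unfolding lead_mono_def
  by (rule the_equality) (auto simp: leads_def grevlex_less_iff dest: less_asym)

lemma leads3_ex:
  assumes "f \<noteq> 0"
  shows "leads3 f (lead_mono f)"
proof -
  have ne: "finite (key3 ` keys f)" "key3 ` keys f \<noteq> {}"
    using assms by auto
  then have "Max (key3 ` keys f) \<in> key3 ` keys f" by (rule Max_in)
  then obtain t where t: "t \<in> keys f" "key3 t = Max (key3 ` keys f)" by auto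
  have "leads3 f t"
    unfolding leads_def
  proof (intro conjI ballI impI)
    fix s assume "s \<in> keys f" "s \<noteq> t"
    then have "key3 s \<le> key3 t" "key3 s \<noteq> key3 t"
      using t Max_ge[OF ne(1)] inj_eq[OF inj_key3] by (simp, metis)
    then show "key3 s < key3 t" by simp
  qed (rule t)
  then show ?thesis using leads3_lead_mono by metis
qed

lemma leads3_iff: "leads3 f t \<longleftrightarrow> f \<noteq> 0 \<and> lead_mono f = t"
  using leads3_ex leads3_lead_mono by (auto simp: leads_def)

lemma lookup_lead_mono: "(f :: (xyz, 'a::comm_ring_1) mpoly) \<noteq> 0 \<Longrightarrow> lookup f (lead_mono f) \<noteq> 0"
  using leads3_ex[of f] by (auto simp: leads_def in_keys_iff)

lemma lead_mono_mult:
  fixes f g :: "(xyz, 'a::idom) mpoly"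
  assumes "f \<noteq> 0" "g \<noteq> 0"
  shows "lead_mono (f * g) = lead_mono f + lead_mono g"
  using leads_mult(1)[OF compat_key3 leads3_ex[OF assms(1)] leads3_ex[OF assms(2)]]
  by (simp add: leads3_iff)

lemma lead_mono_one: "lead_mono (1 :: (xyz, 'a::idom) mpoly) = 0"
  using leads_one[of key3] by (simp add: leads3_iff)

lemma lead_mono_mconst_mult:
  fixes f :: "(xyz, 'a::idom) mpoly"
  shows "c \<noteq> 0 \<Longrightarrow> lead_mono (mconst c * f) = lead_mono f"
  by (cases "f = 0", simp) (rule leads3_lead_mono,
    use leads3_ex[of f] in \<open>auto simp: leads_def in_keys_iff\<close>)

lemma lead_mono_power:
  fixes f :: "(xyz, 'a::idom) mpoly"
  assumes "lead_mono f = xm a b c" "f \<noteq> 0"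
  shows "lead_mono (f ^ n) = xm (n * a) (n * b) (n * c)"
  using assms by (induction n) (simp_all add: lead_mono_one xm_0 lead_mono_mult xm_add)

lemma lead_mono_homog: "homog d (f :: (xyz, 'a::comm_ring_1) mpoly) \<Longrightarrow> f \<noteq> 0 \<Longrightarrow> total_degree (lead_mono f) = d"
  using leads3_ex[of f] by (auto simp: homog_def leads_def)

lemma lead_term_eq_iff:
  fixes f g :: "(xyz, 'a::comm_ring_1) mpoly"
  assumes "f \<noteq> 0" "g \<noteq> 0"
  shows "lead_term f = lead_term g \<longleftrightarrow> lead_mono f = lead_mono g \<and>
    lookup f (lead_mono f) = lookup g (lead_mono g)"
proof
  assume "lead_term f = lead_term g"
  then have eq: "single (lead_mono f) (lookup f (lead_mono f)) =
    single (lead_mono g) (lookup g (lead_mono g))"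
    by (simp add: lead_term_def)
  then have "keys (single (lead_mono f) (lookup f (lead_mono f))) =
    keys (single (lead_mono g) (lookup g (lead_mono g)))"
    by simp
  then have 1: "lead_mono f = lead_mono g" using lookup_lead_mono[OF assms(1)] lookup_lead_mono[OF assms(2)] by auto
  from eq have "lookup f (lead_mono f) = lookup g (lead_mono g)"
    unfolding 1 by (metis lookup_single_eq)
  with 1 show "lead_mono f = lead_mono g \<and>
    lookup f (lead_mono f) = lookup g (lead_mono g)" by blast
qed (auto simp: lead_term_def)

lemma lead_term_eq_0_iff: "lead_term (f :: (xyz, 'a::comm_ring_1) mpoly) = 0 \<longleftrightarrow> f = 0"
proof (cases "f = 0")
  case False
  then show ?thesis
    unfolding lead_term_def using lookup_lead_mono[of f]
    by (metis lookup_single_eq lookup_zero)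
qed (simp add: lead_term_def)

text \<open>The decrease that makes subduction terminate, keys being triples of natural numbers in
  lexicographic order: the common lead term cancels, and every other monomial of either polynomial
  is smaller.\<close>

lemma lead_mono_diff_less:
  fixes f g :: "(xyz, 'a::comm_ring_1) mpoly"
  assumes "f \<noteq> 0" "lead_term f = lead_term g" "f \<noteq> g"
  shows "key3 (lead_mono (f - g)) < key3 (lead_mono f)"
proof -
  have g: "g \<noteq> 0" using assms lead_term_eq_0_iff by metis
  have eq: "lead_mono f = lead_mono g"
    "lookup f (lead_mono f) = lookup g (lead_mono f)"
    using assms(2) lead_term_eq_iff[OF assms(1) g] by auto
  have k: "lead_mono (f - g) \<in> keys (f - g)"
    using leads3_ex[of "f - g"] assms(3) by (simp add: leads_def)
  then have "lead_mono (f - g) \<noteq> lead_mono f" using eq by (auto simp: in_keys_iff lookup_minus)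
  moreover have "lead_mono (f - g) \<in> keys f \<or> lead_mono (f - g) \<in> keys g"
    using k by (auto simp: in_keys_iff lookup_minus)
  ultimately show ?thesis
    using leads3_ex[OF assms(1)] leads3_ex[OF g] eq by (auto simp: leads_def)
qed

lemma leads_add_small:
  assumes "leads \<kappa> f t" "\<And>s. s \<in> keys g \<Longrightarrow> \<kappa> s < \<kappa> t"
  shows "leads \<kappa> (f + g) t" "lookup (f + g) t = lookup f t"
proof -
  have "lookup g t = 0" using assms(2)[of t] by (auto simp: in_keys_iff)
  then show 1: "lookup (f + g) t = lookup f t" by (simp add: lookup_add)
  then show "leads \<kappa> (f + g) t"
    using assms subsetD[OF keys_add[of f g]] by (auto simp: leads_def in_keys_iff)
qed


subsection \<open>Presentations\<close>

lemma alg_hom_pres_map: "alg_hom (pres_map bs)"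
  unfolding pres_map_def by (rule alg_hom_mpoly_eval)

lemma carrier_pres_ring: "carrier (pres_ring bs) = {f. keys f \<subseteq> pres_mono bs}"
  by (auto simp: pres_ring_def mpoly_ring_def pres_mono_def)

lemma pres_map_single:
  assumes "K \<in> pres_mono bs"
  shows "pres_map bs (single K c) = mconst c * bprod bs K"
  using assms by (simp add: pres_map_def mpoly_eval_single bprod_def pres_mono_def
      mono_eval_superset[of "{..<length bs}"])

lemma pres_map_expand:
  assumes "f \<in> carrier (pres_ring bs)"
  shows "pres_map bs f = (\<Sum>K\<in>keys f. mconst (lookup f K) * bprod bs K)"
proof -
  have "pres_map bs f = (\<Sum>K\<in>keys f. pres_map bs (single K (lookup f K)))"
    by (subst mpoly_expand[of f]) (simp add: alg_hom_sum[OF alg_hom_pres_map])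
  also have "\<dots> = (\<Sum>K\<in>keys f. mconst (lookup f K) * bprod bs K)"
    using assms by (intro sum.cong) (auto simp: pres_map_single carrier_pres_ring)
  finally show ?thesis .
qed

lemma bprod_nz:
  fixes bs :: "('v::linorder, 'a::idom) mpoly list"
  shows "0 \<notin> set bs \<Longrightarrow> bprod bs K \<noteq> 0"
  by (force simp: bprod_def in_set_conv_nth)

lemma mpoly_ring_simps:
  "carrier (mpoly_ring V) = {f. \<forall>t\<in>keys f. keys t \<subseteq> V}"
  "f \<otimes>\<^bsub>mpoly_ring V\<^esub> g = f * g" "f \<oplus>\<^bsub>mpoly_ring V\<^esub> g = f + g"
  "\<one>\<^bsub>mpoly_ring V\<^esub> = 1" "\<zero>\<^bsub>mpoly_ring V\<^esub> = 0"
  by (simp_all add: mpoly_ring_def)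

lemma mpoly_carrier_add: "f \<in> carrier (mpoly_ring V) \<Longrightarrow> g \<in> carrier (mpoly_ring V) \<Longrightarrow> f + g \<in> carrier (mpoly_ring V)"
  using keys_add[of f g] by (auto simp: mpoly_ring_simps)

lemma mpoly_carrier_mult:
  assumes "f \<in> carrier (mpoly_ring V)" "g \<in> carrier (mpoly_ring V)"
  shows "f * g \<in> carrier (mpoly_ring V)"
  unfolding mpoly_ring_simps
proof (intro CollectI ballI)
  fix t assume "t \<in> keys (f * g)"
  then obtain a b where "a \<in> keys f" "b \<in> keys g" "t = a + b"
    using keys_mult[of f g] by blast
  then show "keys t \<subseteq> V"
    using assms keys_add[of a b] unfolding mpoly_ring_simps by blast
qed

lemma mpoly_carrier_uminus: "f \<in> carrier (mpoly_ring V) \<Longrightarrow> - f \<in> carrier (mpoly_ring V)"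
  by (auto simp: mpoly_ring_simps in_keys_iff)

lemma cring_mpoly_ring: "cring (mpoly_ring V)"
proof (rule cringI)
  show "abelian_group (mpoly_ring V)"
  proof (rule abelian_groupI)
    fix f assume "f \<in> carrier (mpoly_ring V)"
    then show "\<exists>g\<in>carrier (mpoly_ring V). g \<oplus>\<^bsub>mpoly_ring V\<^esub> f = \<zero>\<^bsub>mpoly_ring V\<^esub>"
      by (intro bexI[of _ "- f"]) (simp_all add: mpoly_carrier_uminus mpoly_ring_simps(2-))
  qed (auto simp: mpoly_carrier_add mpoly_ring_simps(2-) add_ac, simp add: mpoly_ring_simps)
  show "Group.comm_monoid (mpoly_ring V)"
    by (rule comm_monoidI) (auto simp: mpoly_carrier_mult mpoly_ring_simps(2-) mult_ac, simp add: mpoly_ring_simps)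
qed (simp add: mpoly_ring_simps distrib_right)

lemma mpoly_ring_a_inv:
  assumes "f \<in> carrier (mpoly_ring V)"
  shows "\<ominus>\<^bsub>mpoly_ring V\<^esub> f = - f"
proof -
  interpret cring "mpoly_ring V" by (rule cring_mpoly_ring)
  have "f + \<ominus>\<^bsub>mpoly_ring V\<^esub> f = 0"
    using r_neg[OF assms] by (simp add: mpoly_ring_simps)
  then show ?thesis by (simp add: eq_neg_iff_add_eq_0 add.commute)
qed

text \<open>Moves between linear combinations of products and formal polynomials supported on a set
  of exponents. It is used with all exponents, for the generated algebra, and with the exponents of
  the normal products, for the basis of the invariants.\<close>

lemma pres_span:
  assumes "S \<subseteq> pres_mono bs"
  shows "mpoly_vs.span (bprod bs ` S) = pres_map bs ` {f. keys f \<subseteq> S}"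
proof (intro equalityI subsetI)
  fix g assume "g \<in> pres_map bs ` {f. keys f \<subseteq> S}"
  then obtain f where f: "keys f \<subseteq> S" "g = pres_map bs f" by auto
  have fc: "f \<in> carrier (pres_ring bs)" using f(1) assms by (auto simp: carrier_pres_ring)
  show "g \<in> mpoly_vs.span (bprod bs ` S)"
    unfolding f(2) pres_map_expand[OF fc] mscale_def[symmetric] using f(1)
    by (intro mpoly_vs.span_sum mpoly_vs.span_scale mpoly_vs.span_base) auto
next
  fix g assume "g \<in> mpoly_vs.span (bprod bs ` S)"
  then show "g \<in> pres_map bs ` {f. keys f \<subseteq> S}"
  proof (induction rule: mpoly_vs.span_induct_alt)
    case base
    show ?case by (rule image_eqI[of _ _ 0]) (simp_all add: alg_hom_0[OF alg_hom_pres_map])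
  next
    case (step c x y)
    then obtain f K where f: "keys f \<subseteq> S" "y = pres_map bs f" and K: "K \<in> S" "x = bprod bs K"
      by auto
    have "keys (single K c + f) \<subseteq> S"
      using f(1) K(1) keys_add[of "single K c" f] by (auto split: if_splits)
    moreover have "K \<in> pres_mono bs" using K(1) assms by blast
    ultimately show ?case
      by (intro image_eqI[of _ _ "single K c + f"])
        (simp_all add: alg_hom_add[OF alg_hom_pres_map] f K pres_map_single mscale_def)
  qed
qed

lemma pres_image_span:
  "pres_map bs ` carrier (pres_ring bs) = mpoly_vs.span (bprod bs ` pres_mono bs)"
  unfolding pres_span[OF subset_refl] carrier_pres_ring ..

text \<open>Since the constants are among the ring generators, the generated ring consists of all
  linear combinations of products.\<close>

lemma generated_algebra_eq:
  fixes bs :: "('v, 'a::field) mpoly list"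
  shows "generated_algebra (set bs) = pres_map bs ` carrier (pres_ring bs)"
proof (intro equalityI subsetI)
  fix f assume "f \<in> generated_algebra (set bs)"
  then have "f \<in> generate_ring (mpoly_ring UNIV) (range mconst \<union> set bs)"
    by (simp add: generated_algebra_def)
  then show "f \<in> pres_map bs ` carrier (pres_ring bs)"
  proof (induction rule: generate_ring.induct)
    case one
    show ?case
      by (rule image_eqI[of _ _ 1])
        (simp_all add: alg_hom_1[OF alg_hom_pres_map] mpoly_ring_simps pres_ring_def)
  next
    case (incl h)
    then consider c where "h = mconst c" | i where "i < length bs" "h = bs ! i"
      by (auto simp: in_set_conv_nth)
    then show ?case
    proof cases
      case 1
      moreover have "mconst c \<in> carrier (pres_ring bs)"
        by (simp add: mpoly_ring_simps pres_ring_def mconst_def)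
      ultimately show ?thesis
        by (metis alg_hom_mconst[OF alg_hom_pres_map] imageI)
    next
      case 2
      then have "mvar i \<in> carrier (pres_ring bs)"
        by (simp add: mpoly_ring_simps pres_ring_def mvar_def)
      moreover have "pres_map bs (mvar i) = h" using 2 by (simp add: pres_map_def)
      ultimately show ?thesis by blast
    qed
  next
    case (a_inv h)
    then obtain f where f: "f \<in> carrier (pres_ring bs)" "h = pres_map bs f" by auto
    have "\<ominus>\<^bsub>mpoly_ring UNIV\<^esub> h = - h" by (rule mpoly_ring_a_inv) (simp add: mpoly_ring_simps)
    moreover have "- f \<in> carrier (pres_ring bs)"
      using f(1) mpoly_carrier_uminus unfolding pres_ring_def by blast
    ultimately show ?case
      using alg_hom_uminus[OF alg_hom_pres_map, of bs f] f(2) by (metis imageI)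
  next
    case (eng_add h1 h2)
    then obtain f1 f2 where f: "f1 \<in> carrier (pres_ring bs)" "h1 = pres_map bs f1"
      "f2 \<in> carrier (pres_ring bs)" "h2 = pres_map bs f2" by auto
    have "f1 + f2 \<in> carrier (pres_ring bs)"
      using f mpoly_carrier_add unfolding pres_ring_def by blast
    then show ?case
      using alg_hom_add[OF alg_hom_pres_map, of bs f1 f2] f unfolding mpoly_ring_simps(3) by (metis imageI)
  next
    case (eng_mult h1 h2)
    then obtain f1 f2 where f: "f1 \<in> carrier (pres_ring bs)" "h1 = pres_map bs f1"
      "f2 \<in> carrier (pres_ring bs)" "h2 = pres_map bs f2" by auto
    have "f1 * f2 \<in> carrier (pres_ring bs)"
      using f mpoly_carrier_mult unfolding pres_ring_def by blast
    then show ?case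
      using alg_hom_mult[OF alg_hom_pres_map, of bs f1 f2] f unfolding mpoly_ring_simps(2) by (metis imageI)
  qed
next
  let ?A = "generated_algebra (set bs)"
  have one: "1 \<in> ?A"
    using generate_ring.one[of "mpoly_ring UNIV"] by (simp add: generated_algebra_def mpoly_ring_simps)
  have add: "f + g \<in> ?A" and mult: "f * g \<in> ?A" if "f \<in> ?A" "g \<in> ?A" for f g
    using that generate_ring.eng_add[of f "mpoly_ring UNIV" _ g] generate_ring.eng_mult[of f "mpoly_ring UNIV" _ g]
    by (simp_all add: generated_algebra_def mpoly_ring_simps)
  have const: "mconst c \<in> ?A" for c
    by (auto simp: generated_algebra_def intro: generate_ring.incl)
  have gen: "b \<in> ?A" if "b \<in> set bs" for b
    using that by (auto simp: generated_algebra_def intro: generate_ring.incl)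
  have pow: "b ^ n \<in> ?A" if "b \<in> ?A" for b n
    by (induction n) (simp_all add: one mult that)
  have prod: "bprod bs K \<in> ?A" for K
  proof -
    have "(\<Prod>i\<in>I. (bs ! i) ^ lookup K i) \<in> ?A" if "finite I" "I \<subseteq> {..<length bs}" for I
      using that by (induction I rule: finite_induct) (simp_all add: one mult pow gen)
    then show ?thesis by (simp add: bprod_def)
  qed
  fix f assume "f \<in> pres_map bs ` carrier (pres_ring bs)"
  then have "f \<in> mpoly_vs.span (bprod bs ` pres_mono bs)" by (simp add: pres_image_span)
  then show "f \<in> ?A"
  proof (induction rule: mpoly_vs.span_induct_alt)
    case base
    show ?case using const[of 0] by simp
  next
    case (step c x y)
    then show ?case using prod by (auto simp: mscale_def intro!: add mult const)
  qed
qed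

lemma lead_mono_bprod:
  fixes bs :: "(xyz, 'a::idom) mpoly list"
  assumes "0 \<notin> set bs"
  shows "lead_mono_poly (bprod bs K) = bprod (map lead_mono_poly bs) K"
proof -
  have mult: "lead_mono_poly (f * g) = lead_mono_poly f * lead_mono_poly g" if "f \<noteq> 0" "g \<noteq> 0" for f g :: "(xyz, 'a) mpoly"
    using that by (simp add: lead_mono_poly_def lead_mono_mult mult_single)
  have one: "lead_mono_poly 1 = (1 :: (xyz, 'a) mpoly)"
    by (simp add: lead_mono_poly_def lead_mono_one)
  have pow: "lead_mono_poly (f ^ n) = lead_mono_poly f ^ n" if "f \<noteq> 0" for f :: "(xyz, 'a) mpoly" and n
    using that by (induction n) (simp_all add: one mult)
  have "lead_mono_poly (\<Prod>i\<in>I. (bs ! i) ^ lookup K i) =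
      (\<Prod>i\<in>I. (map lead_mono_poly bs ! i) ^ lookup K i)"
    if "finite I" "I \<subseteq> {..<length bs}" for I
    using that
  proof (induction I rule: finite_induct)
    case (insert i I)
    then have "bs ! i \<noteq> 0" "(\<Prod>i\<in>I. (bs ! i) ^ lookup K i) \<noteq> 0"
      using assms by (fastforce simp: in_set_conv_nth)+
    then show ?case using insert by (simp add: mult pow)
  qed (simp add: one)
  then show ?thesis by (simp add: bprod_def)
qed

text \<open>The property that subduction never gets stuck on \<open>F[bs]\<close>.\<close>

definition lm_complete :: "(xyz, 'a::comm_ring_1) mpoly list \<Rightarrow> bool"
  where "lm_complete bs \<longleftrightarrow> 0 \<notin> set bs \<and>
    (\<forall>f\<in>pres_map bs ` carrier (pres_ring bs). f \<noteq> 0 \<longrightarrow>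
      (\<exists>K\<in>pres_mono bs. lead_mono f = lead_mono (bprod bs K)))"

text \<open>\<open>generated_algebra_eq\<close>, applied to the list of lead monomials, describes
  the algebra they generate as the span of their products. By multiplicativity these are the lead
  monomials of the products of \<open>bs\<close>, and completeness says that there are no
  others.\<close>

lemma lm_complete_sagbi:
  fixes bs :: "(xyz, 'a::field) mpoly list"
  assumes "lm_complete bs"
  shows "is_sagbi_basis (set bs) (pres_map bs ` carrier (pres_ring bs))"
proof -
  let ?A = "pres_map bs ` carrier (pres_ring bs)"
  have nz: "0 \<notin> set bs" using assms by (simp add: lm_complete_def)
  have "set bs \<subseteq> ?A"
    unfolding generated_algebra_eq[symmetric] by (auto simp: generated_algebra_def intro: generate_ring.incl)
  moreover have "generated_algebra (lead_mono_poly ` set bs) = mpoly_vs.span (lead_mono_poly ` (?A - {0}))"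
  proof -
    have "generated_algebra (lead_mono_poly ` set bs) = mpoly_vs.span (bprod (map lead_mono_poly bs) ` pres_mono (map lead_mono_poly bs))"
      using generated_algebra_eq[of "map lead_mono_poly bs"] by (simp add: pres_image_span)
    also have "bprod (map lead_mono_poly bs) ` pres_mono (map lead_mono_poly bs) = lead_mono_poly ` bprod bs ` pres_mono bs"
      by (simp add: pres_mono_def image_image lead_mono_bprod[OF nz])
    also have "\<dots> = lead_mono_poly ` (?A - {0})"
    proof (intro equalityI subsetI)
      fix f assume "f \<in> lead_mono_poly ` bprod bs ` pres_mono bs"
      then obtain K where "K \<in> pres_mono bs" "f = lead_mono_poly (bprod bs K)" by auto
      then show "f \<in> lead_mono_poly ` (?A - {0})"
        unfolding pres_image_span using bprod_nz[OF nz, of K] by (auto intro: mpoly_vs.span_base)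
    next
      fix f assume "f \<in> lead_mono_poly ` (?A - {0})"
      then obtain g where g: "g \<in> ?A" "g \<noteq> 0" "f = lead_mono_poly g" by auto
      then obtain K where "K \<in> pres_mono bs" "lead_mono g = lead_mono (bprod bs K)"
        using assms unfolding lm_complete_def by blast
      then show "f \<in> lead_mono_poly ` bprod bs ` pres_mono bs"
        using g by (auto simp: lead_mono_poly_def)
    qed
    finally show ?thesis .
  qed
  ultimately show ?thesis using nz by (simp add: is_sagbi_basis_def)
qed

subsection \<open>Subduction\<close>

lemma subduction_state_pres:
  assumes "subduction_state bs I J Q"
  shows "Q \<in> carrier (pres_ring bs)"
  using assms
proof induction
  case (start c)
  then show ?case
    unfolding tete_a_tete_def carrier_pres_ring using keys_diff[of "single I (1::'b)" "single J c"]
    by (auto split: if_splits)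
next
  case (step Q K d)
  then show ?case
    unfolding carrier_pres_ring using keys_diff[of Q "single K d"]
    by (auto split: if_splits)
qed

lemma pres_map_diff_single:
  "K \<in> pres_mono bs \<Longrightarrow> pres_map bs (Q - single K d) = pres_map bs Q - mconst d * bprod bs K"
  by (simp add: alg_hom_diff[OF alg_hom_pres_map] pres_map_single)

lemma lead_term_match:
  fixes f g :: "(xyz, 'a::field) mpoly"
  assumes "f \<noteq> 0" "g \<noteq> 0" "lead_mono f = lead_mono g"
  obtains d where "lead_term f = lead_term (mconst d * g)" "d \<noteq> 0"
proof -
  define d where "d = lookup f (lead_mono f) / lookup g (lead_mono g)"
  have d: "d \<noteq> 0" "lookup f (lead_mono f) = d * lookup g (lead_mono g)"
    using lookup_lead_mono[OF assms(1)] lookup_lead_mono[OF assms(2)] by (simp_all add: d_def)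
  have "mconst d * g \<noteq> 0" using d(1) assms(2) by simp
  then have "lead_term f = lead_term (mconst d * g)"
    using lead_term_eq_iff[OF assms(1), of "mconst d * g"] d assms(3) by (simp add: lead_mono_mconst_mult)
  then show thesis using d(1) that by blast
qed

lemma lead_term_mconst_unique:
  fixes f g :: "(xyz, 'a::field) mpoly"
  assumes "f \<noteq> 0" "lead_term f = lead_term (mconst d * g)"
  shows "d \<noteq> 0" "g \<noteq> 0" "lead_mono f = lead_mono g"
    "d = lookup f (lead_mono f) / lookup g (lead_mono g)"
proof -
  have nz: "mconst d * g \<noteq> 0" using assms lead_term_eq_0_iff by metis
  then show 1: "d \<noteq> 0" "g \<noteq> 0" by auto
  have "lead_mono f = lead_mono (mconst d * g) \<and> lookup f (lead_mono f) =
      lookup (mconst d * g) (lead_mono (mconst d * g))"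
    using lead_term_eq_iff[OF assms(1) nz] assms(2) by blast
  then show "lead_mono f = lead_mono g"
    "d = lookup f (lead_mono f) / lookup g (lead_mono g)"
    using 1 lookup_lead_mono[OF 1(2)] by (auto simp: lead_mono_mconst_mult)
qed

lemma subduction_start_ex:
  fixes bs :: "(xyz, 'a::field) mpoly list"
  assumes "0 \<notin> set bs" "tete_a_tete bs I J"
  obtains c where "subduction_state bs I J (single I 1 - single J c)"
proof -
  have "lead_mono (bprod bs I) = lead_mono (bprod bs J)"
    using assms(2) by (simp add: tete_a_tete_def)
  then obtain c where "lead_term (bprod bs I) = lead_term (mconst c * bprod bs J)"
    using lead_term_match[OF bprod_nz[OF assms(1)] bprod_nz[OF assms(1)]] by metis
  then show thesis using that subduction_state.start[OF assms(2)] by blast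
qed

text \<open>Induction on the key of the lead monomial: at every nonzero state completeness supplies
  a product to cancel with.\<close>

lemma subduction_relation_ex:
  fixes bs :: "(xyz, 'a::field) mpoly list"
  assumes "lm_complete bs" "tete_a_tete bs I J"
  shows "\<exists>r. subduction_relation bs I J r"
proof -
  have nz: "0 \<notin> set bs" using assms(1) by (simp add: lm_complete_def)
  have step: "\<exists>r. subduction_relation bs I J r" if "subduction_state bs I J Q" for Q
    using that
  proof (induction "key3 (lead_mono (pres_map bs Q))" arbitrary: Q rule: less_induct)
    case less
    show ?case
    proof (cases "pres_map bs Q = 0")
      case True
      then show ?thesis using less.prems by (auto simp: subduction_relation_def)
    next
      case False
      then obtain K where K: "K \<in> pres_mono bs" "lead_mono (pres_map bs Q) = lead_mono (bprod bs K)"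
        using assms(1) subduction_state_pres[OF less.prems] unfolding lm_complete_def by blast
      then obtain d where d: "lead_term (pres_map bs Q) = lead_term (mconst d * bprod bs K)"
        using lead_term_match[OF False bprod_nz[OF nz]] by metis
      let ?Q = "Q - single K d"
      have st: "subduction_state bs I J ?Q"
        by (rule subduction_state.step[OF less.prems False K(1) d])
      show ?thesis
      proof (cases "pres_map bs ?Q = 0")
        case True
        then show ?thesis using st by (auto simp: subduction_relation_def)
      next
        case F2: False
        have "key3 (lead_mono (pres_map bs ?Q)) < key3 (lead_mono (pres_map bs Q))"
          using F2 unfolding pres_map_diff_single[OF K(1)]
          by (intro lead_mono_diff_less[OF False d]) auto
        then show ?thesis using less.hyps st by blast
      qed
    qed
  qed
  obtain c where "subduction_state bs I J (single I 1 - single J c)"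
    using subduction_start_ex[OF nz assms(2)] .
  then show ?thesis by (rule step)
qed

text \<open>An invariant common to all choices of steps. \<open>R\<close> collects the products
  subtracted so far: homogeneity keeps them in the degree of the pair, and since lead monomials
  strictly decrease, theirs lie below that of the pair and above the current one.\<close>

lemma subduction_state_form:
  fixes bs :: "(xyz, 'a::field) mpoly list" and dg :: "nat mono \<Rightarrow> nat"
  assumes "subduction_state bs I J Q" "0 \<notin> set bs"
    and hom: "\<And>K. K \<in> pres_mono bs \<Longrightarrow> homog (dg K) (bprod bs K)"
    and IJ: "dg I = D" "dg J = D"
  defines "c0 \<equiv> lookup (bprod bs I) (lead_mono (bprod bs I)) /
    lookup (bprod bs J) (lead_mono (bprod bs J))"
  shows "\<exists>R. Q = single I 1 - single J c0 - R \<and>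
    (\<forall>K\<in>keys R. K \<in> pres_mono bs \<and> dg K = D \<and>
      key3 (lead_mono (bprod bs K)) < key3 (lead_mono (bprod bs I)) \<and>
      (pres_map bs Q \<noteq> 0 \<longrightarrow> key3 (lead_mono (pres_map bs Q)) < key3 (lead_mono (bprod bs K)))) \<and>
    homog D (pres_map bs Q) \<and>
    (pres_map bs Q \<noteq> 0 \<longrightarrow> key3 (lead_mono (pres_map bs Q)) < key3 (lead_mono (bprod bs I)))"
  using assms(1)
proof induction
  case (start c)
  have IJm: "I \<in> pres_mono bs" "J \<in> pres_mono bs" using start(1) by (simp_all add: tete_a_tete_def)
  have nz: "bprod bs I \<noteq> 0" by (rule bprod_nz[OF assms(2)])
  have c: "c = c0"
    using lead_term_mconst_unique(4)[OF nz start(2)] by (simp add: c0_def)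
  have eq: "pres_map bs (single I 1 - single J c) = bprod bs I - mconst c * bprod bs J"
    using IJm by (simp add: pres_map_diff_single pres_map_single)
  have "homog D (bprod bs I - mconst c * bprod bs J)"
    using hom[OF IJm(1)] hom[OF IJm(2)] IJ by (intro homog_diff homog_mconst_mult) simp_all
  moreover have "key3 (lead_mono (bprod bs I - mconst c * bprod bs J)) < key3 (lead_mono (bprod bs I))"
    if "bprod bs I - mconst c * bprod bs J \<noteq> 0"
    using that by (intro lead_mono_diff_less[OF nz start(2)]) auto
  ultimately show ?case
    by (intro exI[of _ 0]) (simp add: c eq[unfolded c])
next
  case (step Q K d)
  obtain R where R: "Q = single I 1 - single J c0 - R"
    "\<And>L. L\<in>keys R \<Longrightarrow> L \<in> pres_mono bs \<and> dg L = D \<and>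
      key3 (lead_mono (bprod bs L)) < key3 (lead_mono (bprod bs I)) \<and>
      key3 (lead_mono (pres_map bs Q)) < key3 (lead_mono (bprod bs L))"
    "homog D (pres_map bs Q)"
    "key3 (lead_mono (pres_map bs Q)) < key3 (lead_mono (bprod bs I))"
  proof -
    from step.IH obtain R where "Q = single I 1 - single J c0 - R \<and>
    (\<forall>K\<in>keys R. K \<in> pres_mono bs \<and> dg K = D \<and>
      key3 (lead_mono (bprod bs K)) < key3 (lead_mono (bprod bs I)) \<and>
      (pres_map bs Q \<noteq> 0 \<longrightarrow> key3 (lead_mono (pres_map bs Q)) < key3 (lead_mono (bprod bs K)))) \<and>
    homog D (pres_map bs Q) \<and>
    (pres_map bs Q \<noteq> 0 \<longrightarrow> key3 (lead_mono (pres_map bs Q)) < key3 (lead_mono (bprod bs I)))"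
      by (rule exE)
    with step.hyps(2) show ?thesis by (intro that[of R]) blast+
  qed
  let ?Q = "Q - single K d"
  have K: "lead_mono (pres_map bs Q) = lead_mono (bprod bs K)" "d \<noteq> 0"
    using lead_term_mconst_unique[OF step.hyps(2,4)] by simp_all
  \<comment> \<open>Both polynomials are homogeneous, so the degree of the product can be read off
    from the common lead monomial.\<close>
  have degK: "dg K = D"
    using lead_mono_homog[OF R(3) step.hyps(2)] lead_mono_homog[OF hom[OF step.hyps(3)] bprod_nz[OF assms(2)]] K(1)
    by simp
  have eq: "pres_map bs ?Q = pres_map bs Q - mconst d * bprod bs K"
    by (rule pres_map_diff_single[OF step.hyps(3)])
  have homQ: "homog D (pres_map bs ?Q)"
    unfolding eq using R(3) hom[OF step.hyps(3)] degK by (intro homog_diff homog_mconst_mult) simp_all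
  have less: "key3 (lead_mono (pres_map bs ?Q)) < key3 (lead_mono (pres_map bs Q))" if "pres_map bs ?Q \<noteq> 0"
    using that unfolding eq by (intro lead_mono_diff_less[OF step.hyps(2,4)]) auto
  show ?case
  proof (intro exI[of _ "R + single K d"] conjI ballI impI)
    show "?Q = single I 1 - single J c0 - (R + single K d)"
      by (simp add: R(1) algebra_simps)
    fix L assume "L \<in> keys (R + single K d)"
    then have L: "L \<in> keys R \<or> L = K"
      using keys_add[of R "single K d"] by (auto split: if_splits)
    show "L \<in> pres_mono bs" "dg L = D"
      "key3 (lead_mono (bprod bs L)) < key3 (lead_mono (bprod bs I))"
      using L R(2)[of L] step.hyps(3) degK K(1) R(4) by auto
    assume "pres_map bs ?Q \<noteq> 0"
    from less[OF this] show "key3 (lead_mono (pres_map bs ?Q)) < key3 (lead_mono (bprod bs L))"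
      using L R(2)[of L] K(1) by (auto intro: less_trans)
  next
    assume "pres_map bs ?Q \<noteq> 0"
    from less[OF this] show "key3 (lead_mono (pres_map bs ?Q)) < key3 (lead_mono (bprod bs I))"
      using R(4) by (rule less_trans)
  qed (rule homQ)
qed

text \<open>The difference of two results is a combination of products with distinct lead monomials,
  so its lead monomial is that of one of them. If the results have different lead monomials, or one
  is zero, it is also the lead monomial of a result, which is stuck. If they have the same one, it
  lies below that, whereas every subtracted product lies above.\<close>

lemma subduction_result_unique:
  fixes bs :: "(xyz, 'a::field) mpoly list" and dg :: "nat mono \<Rightarrow> nat"
  assumes h: "subduction_result bs I J h" and h': "subduction_result bs I J h'" and nz: "0 \<notin> set bs"
    and hom: "\<And>K. K \<in> pres_mono bs \<Longrightarrow> homog (dg K) (bprod bs K)"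
    and IJ: "dg I = D" "dg J = D"
    and inj: "inj_on (\<lambda>K. lead_mono (bprod bs K))
      {K \<in> pres_mono bs. dg K = D \<and> key3 (lead_mono (bprod bs K)) < key3 (lead_mono (bprod bs I))}"
  shows "h = h'"
proof (rule ccontr)
  assume ne: "h \<noteq> h'"
  let ?S = "{K \<in> pres_mono bs. dg K = D \<and> key3 (lead_mono (bprod bs K)) < key3 (lead_mono (bprod bs I))}"
  let ?c = "lookup (bprod bs I) (lead_mono (bprod bs I)) /
    lookup (bprod bs J) (lead_mono (bprod bs J))"
  obtain Q Q' where Q: "subduction_state bs I J Q" "h = pres_map bs Q"
    and Q': "subduction_state bs I J Q'" "h' = pres_map bs Q'"
    using h h' by (auto simp: subduction_result_def)
  obtain R where R: "Q = single I 1 - single J ?c - R"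
    "\<And>K. K \<in> keys R \<Longrightarrow> K \<in> ?S \<and> (h \<noteq> 0 \<longrightarrow> key3 (lead_mono h) < key3 (lead_mono (bprod bs K)))"
    using subduction_state_form[of bs I J Q dg D, OF Q(1) nz hom IJ] unfolding Q(2) by fast
  obtain R' where R': "Q' = single I 1 - single J ?c - R'"
    "\<And>K. K \<in> keys R' \<Longrightarrow> K \<in> ?S \<and> (h' \<noteq> 0 \<longrightarrow> key3 (lead_mono h') < key3 (lead_mono (bprod bs K)))"
    using subduction_state_form[of bs I J Q' dg D, OF Q'(1) nz hom IJ] unfolding Q'(2) by fast
  have keys: "K \<in> keys R \<or> K \<in> keys R'" if "K \<in> keys (R' - R)" for K
    using that by (auto simp: in_keys_iff lookup_minus)
  have E: "pres_map bs (R' - R) = h - h'"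
    unfolding Q(2) Q'(2) R(1) R'(1) by (simp add: alg_hom_diff[OF alg_hom_pres_map])
  have "R' - R \<in> carrier (pres_ring bs)"
    unfolding carrier_pres_ring using R(2) R'(2) keys by blast
  then have eq: "h - h' = (\<Sum>K\<in>keys (R' - R). mconst (lookup (R' - R) K) * bprod bs K)"
    unfolding E[symmetric] by (rule pres_map_expand)
  have ne': "R' - R \<noteq> 0"
  proof
    assume "R' - R = 0"
    then have "h - h' = 0" using eq by (simp only: keys_zero sum.empty)
    with ne show False by simp
  qed
  have "\<exists>K\<in>keys (R' - R). leads3 (h - h') (lead_mono (bprod bs K)) \<and>
      (\<forall>L\<in>keys (R' - R). key3 (lead_mono (bprod bs L)) \<le> key3 (lead_mono (bprod bs K)))"
    unfolding eq
  proof (rule leads_sum)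
    show "inj_on (\<lambda>K. lead_mono (bprod bs K)) (keys (R' - R))"
      by (rule inj_on_subset[OF inj]) (use R(2) R'(2) keys in blast)
    show "leads3 (bprod bs K) (lead_mono (bprod bs K))" for K
      using bprod_nz[OF nz] by (rule leads3_ex)
  qed (use ne' inj_key3 in \<open>auto simp: in_keys_iff\<close>)
  then obtain K where K: "K \<in> keys (R' - R)" "leads3 (h - h') (lead_mono (bprod bs K))" by blast
  have Km: "K \<in> pres_mono bs" using keys[OF K(1)] R(2) R'(2) by blast
  have notin: "h = 0 \<or> lead_mono h \<noteq> lead_mono (bprod bs K)" "h' = 0 \<or> lead_mono h' \<noteq> lead_mono (bprod bs K)"
    using h h' Km by (auto simp: subduction_result_def)
  have "lead_mono (bprod bs K) \<in> keys h \<or> lead_mono (bprod bs K) \<in> keys h'"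
    using K(2) by (auto simp: leads_def in_keys_iff lookup_minus)
  then have small: "(h \<noteq> 0 \<and> key3 (lead_mono (bprod bs K)) < key3 (lead_mono h)) \<or>
      (h' \<noteq> 0 \<and> key3 (lead_mono (bprod bs K)) < key3 (lead_mono h'))"
    using notin leads3_ex[of h] leads3_ex[of h'] by (fastforce simp: leads_def)
  have "h \<noteq> 0 \<and> h' \<noteq> 0 \<and> lead_mono h = lead_mono h' \<longrightarrow> False"
    using small keys[OF K(1)] R(2)[of K] R'(2)[of K] less_asym by metis
  then have D: "h = 0 \<or> h' = 0 \<or> lead_mono h \<noteq> lead_mono h'" by blast
  have "lead_mono (h - h') = lead_mono h \<and> h \<noteq> 0 \<or> lead_mono (h - h') = lead_mono h' \<and> h' \<noteq> 0"
  proof -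
    consider "h = 0" "h' \<noteq> 0" | "h' = 0" "h \<noteq> 0" | "h \<noteq> 0" "h' \<noteq> 0" "lead_mono h \<noteq> lead_mono h'"
      using D ne by auto
    then show ?thesis
    proof cases
      case 1
      then show ?thesis using lead_mono_mconst_mult[of "-1" h'] by (simp add: mconst_uminus)
    next
      case 3
      then have "key3 (lead_mono h) \<noteq> key3 (lead_mono h')" by (simp add: inj_eq[OF inj_key3])
      then consider "key3 (lead_mono h) < key3 (lead_mono h')" | "key3 (lead_mono h') < key3 (lead_mono h)"
        by (rule linorder_neqE) auto
      then show ?thesis
      proof cases
        case 1
        have "leads3 (- h' + h) (lead_mono h')"
        proof (rule leads_add_small)
          show "leads3 (- h') (lead_mono h')" using leads3_ex[OF 3(2)] by (auto simp: leads_def in_keys_iff)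
          show "key3 s < key3 (lead_mono h')" if "s \<in> keys h" for s
            using that leads3_ex[OF 3(1)] 1 by (cases "s = lead_mono h") (auto simp: leads_def intro: less_trans)
        qed
        then show ?thesis using 3 by (simp add: leads3_iff)
      next
        case 2
        have "leads3 (h + - h') (lead_mono h)"
        proof (rule leads_add_small)
          show "leads3 h (lead_mono h)" using leads3_ex[OF 3(1)] .
          show "key3 s < key3 (lead_mono h)" if "s \<in> keys (- h')" for s
            using that leads3_ex[OF 3(2)] 2 by (cases "s = lead_mono h'") (auto simp: leads_def in_keys_iff intro: less_trans)
        qed
        then show ?thesis using 3 by (simp add: leads3_iff)
      qed
    qed simp
  qed
  then show False using K(2) notin by (auto simp: leads3_iff)
qed

text \<open>Cancel the products in decreasing order of their lead monomials: the largest one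
  provides the lead term, because the others and all of \<open>H\<close> are smaller. Members of
  \<open>S\<close> with coefficient 0 are passed over, so unknown coefficients may vanish.\<close>

lemma subduction_reach:
  fixes bs :: "(xyz, 'a::field) mpoly list"
  assumes "finite S" "S \<subseteq> pres_mono bs" "inj_on (\<lambda>K. lead_mono (bprod bs K)) S" "0 \<notin> set bs"
    and "subduction_state bs I J Q"
    and "pres_map bs Q = H + (\<Sum>K\<in>S. mconst (d K) * bprod bs K)"
    and "\<And>K s. K \<in> S \<Longrightarrow> s \<in> keys H \<Longrightarrow> key3 s < key3 (lead_mono (bprod bs K))"
  shows "\<exists>Q. subduction_state bs I J Q \<and> pres_map bs Q = H"
  using assms
proof (induction "card S" arbitrary: S Q)
  case 0
  then show ?case by auto
next
  case (Suc n)
  then have ne: "S \<noteq> {}" by auto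
  have fin: "finite S" by (rule Suc.prems(1))
  have "Max ((\<lambda>K. key3 (lead_mono (bprod bs K))) ` S) \<in> (\<lambda>K. key3 (lead_mono (bprod bs K))) ` S"
    using ne fin by simp
  then obtain K where K: "K \<in> S" "key3 (lead_mono (bprod bs K)) = Max ((\<lambda>K. key3 (lead_mono (bprod bs K))) ` S)" by auto
  let ?S = "S - {K}"
  have card: "n = card ?S" using Suc.hyps(2) K(1) fin by simp
  have Km: "K \<in> pres_mono bs" using K(1) Suc.prems(2) by blast
  have max: "key3 (lead_mono (bprod bs L)) < key3 (lead_mono (bprod bs K))" if "L \<in> ?S" for L
  proof -
    have "key3 (lead_mono (bprod bs L)) \<le> key3 (lead_mono (bprod bs K))"
      using that fin by (simp add: K(2))
    moreover have "lead_mono (bprod bs L) \<noteq> lead_mono (bprod bs K)"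
      using that Suc.prems(3) K(1) by (auto dest: inj_onD)
    ultimately show ?thesis by (simp add: order.strict_iff_order inj_eq[OF inj_key3])
  qed
  let ?G = "H + (\<Sum>K\<in>?S. mconst (d K) * bprod bs K)"
  have eq: "pres_map bs Q = mconst (d K) * bprod bs K + ?G"
    using Suc.prems(6) by (simp add: sum.remove[OF fin K(1)] add_ac)
  have G: "key3 s < key3 (lead_mono (bprod bs K))" if s: "s \<in> keys ?G" for s
  proof -
    consider "s \<in> keys H" | "s \<in> keys (\<Sum>K\<in>?S. mconst (d K) * bprod bs K)"
      using subsetD[OF keys_add s] by blast
    then show ?thesis
    proof cases
      case 1
      then show ?thesis using Suc.prems(7) K(1) by blast
    next
      case 2
      then obtain L where L: "L \<in> ?S" "s \<in> keys (mconst (d L) * bprod bs L)"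
        using subsetD[OF keys_sum 2] by blast
      then have "s \<in> keys (bprod bs L)" by (auto simp: in_keys_iff)
      then have "s = lead_mono (bprod bs L) \<or> key3 s < key3 (lead_mono (bprod bs L))"
        using leads3_ex[OF bprod_nz[OF Suc.prems(4)], of L] by (auto simp: leads_def)
      then show ?thesis using max[OF L(1)] by (auto intro: less_trans)
    qed
  qed
  show ?case
  proof (cases "d K = 0")
    case True
    then have "pres_map bs Q = ?G" using eq by simp
    then show ?thesis
      using Suc.hyps(1)[OF card, of Q] Suc.prems by (auto intro: inj_on_subset)
  next
    case False
    have l: "leads3 (mconst (d K) * bprod bs K) (lead_mono (bprod bs K))"
      using False bprod_nz[OF Suc.prems(4), of K] by (simp add: leads3_iff lead_mono_mconst_mult)
    have L: "leads3 (pres_map bs Q) (lead_mono (bprod bs K))"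
      "lookup (pres_map bs Q) (lead_mono (bprod bs K)) =
        lookup (mconst (d K) * bprod bs K) (lead_mono (bprod bs K))"
      using leads_add_small[OF l G] unfolding eq by auto
    have nz: "pres_map bs Q \<noteq> 0" using L(1) by (auto simp: leads3_iff)
    have lt: "lead_term (pres_map bs Q) = lead_term (mconst (d K) * bprod bs K)"
      using L l by (simp add: lead_term_def leads3_iff)
    have "subduction_state bs I J (Q - single K (d K))"
      by (rule subduction_state.step[OF Suc.prems(5) nz Km lt])
    moreover have "pres_map bs (Q - single K (d K)) = ?G"
      by (simp add: pres_map_diff_single[OF Km] eq)
    ultimately show ?thesis
      using Suc.hyps(1)[OF card, of "Q - single K (d K)"] Suc.prems by (auto intro: inj_on_subset)
  qed
qed

subsection \<open>Two relations with coprime lead monomials\<close>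

lemma span_Int_disjoint:
  assumes "mpoly_vs.independent (P \<union> Q)" "P \<inter> Q = {}" "x \<in> mpoly_vs.span P" "x \<in> mpoly_vs.span Q"
  shows "x = 0"
proof -
  obtain S r where S: "finite S" "S \<subseteq> P" "x = (\<Sum>a\<in>S. mscale (r a) a)"
    using assms(3) unfolding mpoly_vs.span_explicit by blast
  obtain T r' where T: "finite T" "T \<subseteq> Q" "x = (\<Sum>a\<in>T. mscale (r' a) a)"
    using assms(4) unfolding mpoly_vs.span_explicit by blast
  have disj: "S \<inter> T = {}" using S T assms(2) by blast
  let ?u = "\<lambda>a. if a \<in> S then r a else - r' a"
  have "(\<Sum>a\<in>S \<union> T. mscale (?u a) a) = (\<Sum>a\<in>S. mscale (?u a) a) + (\<Sum>a\<in>T. mscale (?u a) a)"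
    using S(1) T(1) disj by (rule sum.union_disjoint)
  also have "(\<Sum>a\<in>S. mscale (?u a) a) = x" by (simp add: S(3))
  also have "(\<Sum>a\<in>T. mscale (?u a) a) = (\<Sum>a\<in>T. - mscale (r' a) a)"
    using disj by (intro sum.cong) auto
  also have "\<dots> = - x" by (simp add: T(3) sum_negf)
  finally have "(\<Sum>a\<in>S \<union> T. mscale (?u a) a) = 0" by simp
  then have u: "?u a = 0" if "a \<in> S \<union> T" for a
    using mpoly_vs.independentD[OF assms(1), of "S \<union> T" ?u a] S T that by blast
  have "r a = 0" if "a \<in> S" for a using u[of a] that by simp
  then show ?thesis by (simp add: S(3))
qed

lemma span_mult_subset:
  assumes "x \<in> mpoly_vs.span S" "\<And>b. b \<in> S \<Longrightarrow> f * b \<in> mpoly_vs.span T"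
  shows "f * x \<in> mpoly_vs.span T"
  using assms(1)
proof (induction rule: mpoly_vs.span_induct_alt)
  case (step c x y)
  have "f * (mscale c x + y) = mscale c (f * x) + f * y" by (simp add: mscale_def algebra_simps)
  then show ?case using step assms(2) by (auto intro: mpoly_vs.span_add mpoly_vs.span_scale)
qed (simp add: mpoly_vs.span_zero)

lemma mpoly_expand_mscale:
  "(\<Sum>t\<in>keys f. mscale (lookup f t) (single t 1)) = f"
proof -
  have "(\<Sum>t\<in>keys f. mscale (lookup f t) (single t 1)) =
      (\<Sum>t\<in>keys f. single t (lookup f t))"
    by (simp add: mscale_def mconst_def mult_single)
  also have "\<dots> = f" by (rule mpoly_expand[symmetric])
  finally show ?thesis .
qed

lemma add_mult_eq_cancel_nat:
  fixes a b s t p :: nat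
  assumes "a + s * p = b + t * p" "a < p" "b < p"
  shows "s = t"
proof -
  have "(a + s * p) div p = s" "(b + t * p) div p = t" using assms(2,3) by auto
  then show ?thesis using assms(1) by simp
qed

lemma mpoly_carrier_mconst: "mconst c \<in> carrier (mpoly_ring V)"
  by (simp add: mpoly_ring_simps mconst_def)

lemma mpoly_carrier_one: "1 \<in> carrier (mpoly_ring V)"
  by (simp add: mpoly_ring_simps)

lemma mpoly_carrier_zero: "0 \<in> carrier (mpoly_ring V)"
  by (simp add: mpoly_ring_simps)

lemma mpoly_carrier_power: "f \<in> carrier (mpoly_ring V) \<Longrightarrow> f ^ n \<in> carrier (mpoly_ring V)"
  by (induction n) (simp_all add: mpoly_carrier_one mpoly_carrier_mult)

lemma mpoly_carrier_span:
  assumes "S \<subseteq> carrier (mpoly_ring V)"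
  shows "mpoly_vs.span S \<subseteq> carrier (mpoly_ring V)"
proof
  fix x assume "x \<in> mpoly_vs.span S"
  then show "x \<in> carrier (mpoly_ring V)"
  proof (induction rule: mpoly_vs.span_induct_alt)
    case base
    show ?case by (rule mpoly_carrier_zero)
  next
    case (step c x y)
    then show ?case
      unfolding mscale_def using assms
      by (intro mpoly_carrier_add mpoly_carrier_mult mpoly_carrier_mconst) blast+
  qed
qed

text \<open>A weight in the natural numbers takes the place of a monomial order: being additive it
  is compatible with products, and it supports induction. It only has to single out the powers of
  \<open>u\<close> and \<open>v\<close> as lead monomials.\<close>

locale coprime_leads =
  fixes V :: "'v::linorder set" and \<kappa> :: "'v mono \<Rightarrow> nat" and u v :: 'v and p :: nat
    and r1 r2 :: "('v, 'a::field) mpoly"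
  assumes additive: "\<And>s t. \<kappa> (s + t) = \<kappa> s + \<kappa> t"
    and uv: "u \<noteq> v" "u \<in> V" "v \<in> V" and p: "p > 0"
    and r1: "r1 \<in> carrier (mpoly_ring V)" "leads \<kappa> r1 (single u p)"
      "lookup r1 (single u p) = 1"
    and r2: "r2 \<in> carrier (mpoly_ring V)" "leads \<kappa> r2 (single v p)"
      "lookup r2 (single v p) = 1"
begin

definition normal_monos :: "'v mono set"
  where "normal_monos = {m. keys m \<subseteq> V \<and> lookup m u < p \<and> lookup m v < p}"

text \<open>The ring is free over the subalgebra generated by \<open>r1\<close> and
  \<open>r2\<close>, with the normal monomials, those divisible by neither lead monomial, as a
  basis. These are the resulting basis vectors over the field.\<close>

definition basis_elt :: "'v mono \<times> nat \<times> nat \<Rightarrow> ('v, 'a) mpoly"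
  where "basis_elt = (\<lambda>(m, s, t). single m 1 * (r1 ^ s * r2 ^ t))"

definition basis_lead :: "'v mono \<times> nat \<times> nat \<Rightarrow> 'v mono"
  where "basis_lead = (\<lambda>(m, s, t). m + (single u (s * p) + single v (t * p)))"

lemma compat: "compat_key \<kappa>"
  by (simp add: compat_key_def additive)

lemma leads_basis: "leads \<kappa> (basis_elt i) (basis_lead i)" (is ?A)
  and lookup_basis: "lookup (basis_elt i) (basis_lead i) = 1" (is ?B)
proof -
  obtain m s t where i: "i = (m, s, t)" by (cases i)
  note a = leads_power[OF compat r1(2), of s] and b = leads_power[OF compat r2(2), of t]
  note c = leads_mult[OF compat conjunct1[OF a] conjunct1[OF b]]
  note d = leads_mult[OF compat leads_single[of 1] c(1)]
  show ?A ?B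
    using d(1)[of m] d(2)[of m] c(2) a b r1(3) r2(3) by (simp_all add: i basis_elt_def basis_lead_def)
qed

text \<open>Division by \<open>p\<close> of the exponents of \<open>u\<close> and \<open>v\<close>
  recovers \<open>s\<close> and \<open>t\<close> as quotients and the exponents in the normal
  monomial as remainders.\<close>

lemma inj_basis_lead: "inj_on basis_lead (normal_monos \<times> UNIV)"
proof (rule inj_onI)
  fix i j assume ij: "i \<in> normal_monos \<times> (UNIV :: (nat \<times> nat) set)" "j \<in> normal_monos \<times> (UNIV :: (nat \<times> nat) set)"
    "basis_lead i = basis_lead j"
  obtain m s t m' s' t' where i: "i = (m, s, t)" and j: "j = (m', s', t')" by (cases i, cases j)
  have m: "m \<in> normal_monos" "m' \<in> normal_monos" and eq: "basis_lead (m, s, t) = basis_lead (m', s', t')"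
    using ij by (simp_all add: i j)
  have l: "lookup m w + ((if w = u then s * p else 0) + (if w = v then t * p else 0)) =
      lookup m' w + ((if w = u then s' * p else 0) + (if w = v then t' * p else 0))" for w
    using arg_cong[OF eq, of "\<lambda>k. lookup k w"]
    by (simp add: basis_lead_def lookup_add lookup_single when_def eq_commute)
  have s: "s = s'"
    using l[of u] m uv by (intro add_mult_eq_cancel_nat[of "lookup m u" s p "lookup m' u" s'])
      (auto simp: normal_monos_def)
  have t: "t = t'"
    using l[of v] m uv by (intro add_mult_eq_cancel_nat[of "lookup m v" t p "lookup m' v" t'])
      (auto simp: normal_monos_def)
  have "m = m'"
    by (rule poly_mapping_eqI) (use l s t in auto)
  with s t show "i = j" by (simp add: i j)
qed

lemma basis_lead_surj:
  assumes "keys K \<subseteq> V"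
  obtains i where "i \<in> normal_monos \<times> UNIV" "basis_lead i = K"
proof -
  let ?k = "lookup K"
  define m where "m = Poly_Mapping.update u (?k u mod p) (Poly_Mapping.update v (?k v mod p) K)"
  have l: "lookup m w = (if w = u then ?k u mod p else if w = v then ?k v mod p else ?k w)" for w
    by (simp add: m_def lookup_update)
  have "keys m \<subseteq> V" using assms uv by (auto simp: in_keys_iff l subset_iff split: if_splits)
  then have "m \<in> normal_monos" using p uv by (simp add: normal_monos_def l)
  moreover have "basis_lead (m, ?k u div p, ?k v div p) = K"
    by (rule poly_mapping_eqI) (use uv in \<open>auto simp: basis_lead_def lookup_add lookup_single when_def l\<close>)
  ultimately show thesis using that by blast
qed

lemma basis_elt_carrier: "i \<in> normal_monos \<times> UNIV \<Longrightarrow> basis_elt i \<in> carrier (mpoly_ring V)"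
  by (auto simp: basis_elt_def normal_monos_def intro!: mpoly_carrier_mult mpoly_carrier_power r1 r2)
    (auto simp: mpoly_ring_simps)

text \<open>Triangularity: a monomial differs from the basis element that it leads by lighter
  monomials only, and weights in the natural numbers cannot decrease for ever.\<close>

lemma single_in_span:
  assumes "keys K \<subseteq> V"
  shows "single K 1 \<in> mpoly_vs.span (basis_elt ` (normal_monos \<times> UNIV))"
  using assms
proof (induction "\<kappa> K" arbitrary: K rule: less_induct)
  case less
  obtain i where i: "i \<in> normal_monos \<times> UNIV" "basis_lead i = K"
    using basis_lead_surj[OF less.prems] .
  define f where "f = basis_elt i - single K 1"
  have f: "L \<in> keys (basis_elt i) \<and> L \<noteq> K" if "L \<in> keys f" for L
    using that lookup_basis[of i] by (auto simp: f_def in_keys_iff lookup_minus lookup_single when_def i(2) split: if_splits)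
  have "single L 1 \<in> mpoly_vs.span (basis_elt ` (normal_monos \<times> UNIV))"
    if L: "L \<in> keys f" for L
  proof (rule less.hyps)
    show "\<kappa> L < \<kappa> K" using f[OF L] leads_basis[of i] by (simp add: leads_def i(2))
    show "keys L \<subseteq> V" using f[OF L] basis_elt_carrier[OF i(1)] by (simp add: mpoly_ring_simps)
  qed
  then have "(\<Sum>L\<in>keys f. mscale (lookup f L) (single L 1))
      \<in> mpoly_vs.span (basis_elt ` (normal_monos \<times> UNIV))"
    by (intro mpoly_vs.span_sum mpoly_vs.span_scale)
  moreover have "(\<Sum>L\<in>keys f. mscale (lookup f L) (single L 1)) = f"
    by (rule mpoly_expand_mscale)
  moreover have "single K 1 = basis_elt i - f" by (simp add: f_def)
  ultimately show ?case using i(1) by (auto intro: mpoly_vs.span_diff mpoly_vs.span_base)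
qed

lemma carrier_eq_span: "carrier (mpoly_ring V) = mpoly_vs.span (basis_elt ` (normal_monos \<times> UNIV))"
proof (intro equalityI subsetI)
  fix f :: "('v, 'a) mpoly" assume f: "f \<in> carrier (mpoly_ring V)"
  have "(\<Sum>L\<in>keys f. mscale (lookup f L) (single L 1))
      \<in> mpoly_vs.span (basis_elt ` (normal_monos \<times> UNIV))"
    using f by (intro mpoly_vs.span_sum mpoly_vs.span_scale single_in_span) (auto simp: mpoly_ring_simps)
  moreover have "(\<Sum>L\<in>keys f. mscale (lookup f L) (single L 1)) = f"
    by (rule mpoly_expand_mscale)
  ultimately show "f \<in> mpoly_vs.span (basis_elt ` (normal_monos \<times> UNIV))" by simp
next
  fix f assume "f \<in> mpoly_vs.span (basis_elt ` (normal_monos \<times> UNIV))"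
  then show "f \<in> carrier (mpoly_ring V)"
    using mpoly_carrier_span[of "basis_elt ` (normal_monos \<times> UNIV)" V] basis_elt_carrier by blast
qed

lemma inj_basis_elt: "inj_on basis_elt (normal_monos \<times> UNIV)"
proof (rule inj_onI)
  fix i j assume ij: "i \<in> normal_monos \<times> UNIV" "j \<in> normal_monos \<times> UNIV" "basis_elt i = basis_elt j"
  then have "basis_lead i = basis_lead j"
    using leads_basis[of i] leads_basis[of j] unfolding leads_def by (metis less_asym)
  then show "i = j" using inj_basis_lead ij by (auto dest: inj_onD)
qed

lemma independent_basis: "mpoly_vs.independent (basis_elt ` (normal_monos \<times> UNIV))"
  unfolding mpoly_vs.dependent_explicit
proof clarify
  fix S c w assume S: "finite S" "S \<subseteq> basis_elt ` (normal_monos \<times> UNIV)" "(\<Sum>v\<in>S. mscale (c v) v) = 0"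
    and w: "w \<in> S" "c w \<noteq> 0"
  obtain I where I: "I \<subseteq> normal_monos \<times> UNIV" "inj_on basis_elt I" "S = basis_elt ` I"
    using S(2) by (auto simp: subset_image_inj)
  define I' where "I' = {i \<in> I. c (basis_elt i) \<noteq> 0}"
  have fin: "finite I" using I S(1) finite_imageD by blast
  have "(\<Sum>i\<in>I'. mconst (c (basis_elt i)) * basis_elt i) = (\<Sum>i\<in>I. mconst (c (basis_elt i)) * basis_elt i)"
    using fin by (intro sum.mono_neutral_left) (auto simp: I'_def)
  also have "\<dots> = 0"
    using S(3) I by (simp add: sum.reindex mscale_def)
  finally have 0: "(\<Sum>i\<in>I'. mconst (c (basis_elt i)) * basis_elt i) = 0" .
  have "\<exists>i\<in>I'. basis_lead i \<in> keys (\<Sum>i\<in>I'. mconst (c (basis_elt i)) * basis_elt i) \<and>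
      (\<forall>j\<in>I'. \<kappa> (basis_lead j) \<le> \<kappa> (basis_lead i))"
  proof (rule leads_sum_key)
    show "finite I'" "I' \<noteq> {}" using fin w I by (auto simp: I'_def)
    show "inj_on basis_lead I'" using I(1) by (auto simp: I'_def intro: inj_on_subset[OF inj_basis_lead])
  qed (auto simp: I'_def leads_basis)
  then show False by (simp add: 0)
qed

text \<open>Sort the basis elements: those with s > 0 are multiples of \<open>r1\<close>, the
  remaining ones with t > 0 are multiples of \<open>r2\<close>, and the rest are normal
  monomials.\<close>

lemma carrier_decompose:
  assumes "f \<in> carrier (mpoly_ring V)"
  obtains g h k where "g \<in> mpoly_vs.span ((\<lambda>m. single m 1) ` normal_monos)"
    "h \<in> carrier (mpoly_ring V)" "k \<in> carrier (mpoly_ring V)" "f = g + r1 * h + r2 * k"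
proof -
  have "\<exists>g h k. g \<in> mpoly_vs.span ((\<lambda>m. single m 1) ` normal_monos) \<and>
    h \<in> carrier (mpoly_ring V) \<and> k \<in> carrier (mpoly_ring V) \<and> f = g + r1 * h + r2 * k"
    using assms unfolding carrier_eq_span
  proof (induction rule: mpoly_vs.span_induct_alt)
    case base
    show ?case by (intro exI[of _ 0]) (simp add: mpoly_vs.span_zero)
  next
    case (step c x y)
    then obtain m s t where x: "m \<in> normal_monos" "x = basis_elt (m, s, t)" by auto
    obtain g h k where ghk: "g \<in> mpoly_vs.span ((\<lambda>m. single m 1) ` normal_monos)"
      "h \<in> carrier (mpoly_ring V)" "k \<in> carrier (mpoly_ring V)" "y = g + r1 * h + r2 * k"
      using step unfolding carrier_eq_span by auto
    have car: "mconst c * basis_elt (m, s', t') \<in> carrier (mpoly_ring V)" for s' t'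
      using x(1) by (intro mpoly_carrier_mult mpoly_carrier_mconst basis_elt_carrier) auto
    consider "s = 0" "t = 0" | s' where "s = Suc s'" | t' where "s = 0" "t = Suc t'"
      by (metis not0_implies_Suc)
    then show ?case
    proof cases
      case 1
      have "mscale c x + y = (mscale c (single m 1) + g) + r1 * h + r2 * k"
        by (simp add: x 1 basis_elt_def ghk(4) add_ac)
      moreover have "mscale c (single m 1) + g \<in> mpoly_vs.span ((\<lambda>m. single m 1) ` normal_monos)"
        using x(1) by (intro mpoly_vs.span_add[OF mpoly_vs.span_scale[OF mpoly_vs.span_base] ghk(1)]) blast
      ultimately show ?thesis using ghk unfolding carrier_eq_span by blast
    next
      case 2
      have "mscale c x + y = g + r1 * (mconst c * basis_elt (m, s', t) + h) + r2 * k"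
        by (simp add: x 2 basis_elt_def ghk(4) mscale_def algebra_simps)
      moreover have "mconst c * basis_elt (m, s', t) + h \<in> carrier (mpoly_ring V)"
        using car ghk by (intro mpoly_carrier_add)
      ultimately show ?thesis using ghk unfolding carrier_eq_span by blast
    next
      case 3
      have "mscale c x + y = g + r1 * h + r2 * (mconst c * basis_elt (m, 0, t') + k)"
        by (simp add: x 3 basis_elt_def ghk(4) mscale_def algebra_simps)
      moreover have "mconst c * basis_elt (m, 0, t') + k \<in> carrier (mpoly_ring V)"
        using car ghk by (intro mpoly_carrier_add)
      ultimately show ?thesis using ghk unfolding carrier_eq_span by blast
    qed
  qed
  then show thesis using that by blast
qed

text \<open>Multiplication by \<open>r1\<close> raises the exponent \<open>s\<close> of a basis
  element, and multiplication by \<open>r2\<close> leaves it alone. So for the part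
  \<open>g0\<close> of \<open>g\<close> with s = 0, the product \<open>r2 * g0\<close> lies in the
  spans of two disjoint parts of the basis and vanishes.\<close>

lemma nonzerodivisor:
  assumes gh: "g \<in> carrier (mpoly_ring V)" "h \<in> carrier (mpoly_ring V)" "r2 * g = r1 * h"
  shows "\<exists>k\<in>carrier (mpoly_ring V). g = r1 * k"
proof -
  let ?I0 = "{(m, s, t). m \<in> normal_monos \<and> s = (0::nat)}" and ?I1 = "{(m, s, t). m \<in> normal_monos \<and> s > (0::nat)}"
  have I: "normal_monos \<times> UNIV = ?I0 \<union> ?I1" by auto
  have r1_span: "r1 * f \<in> mpoly_vs.span (basis_elt ` ?I1)" if "f \<in> carrier (mpoly_ring V)" for f
    using that unfolding carrier_eq_span
  proof (rule span_mult_subset)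
    fix b assume "b \<in> basis_elt ` (normal_monos \<times> UNIV)"
    then obtain m s t where "m \<in> normal_monos" "b = basis_elt (m, s, t)" by auto
    then show "r1 * b \<in> mpoly_vs.span (basis_elt ` ?I1)"
      by (intro mpoly_vs.span_base image_eqI[of _ _ "(m, Suc s, t)"]) (auto simp: basis_elt_def)
  qed
  have r2_span: "r2 * f \<in> mpoly_vs.span (basis_elt ` ?I0)" if "f \<in> mpoly_vs.span (basis_elt ` ?I0)" for f
    using that
  proof (rule span_mult_subset)
    fix b assume "b \<in> basis_elt ` ?I0"
    then obtain m t where "m \<in> normal_monos" "b = basis_elt (m, 0, t)" by auto
    then show "r2 * b \<in> mpoly_vs.span (basis_elt ` ?I0)"
      by (intro mpoly_vs.span_base image_eqI[of _ _ "(m, 0, Suc t)"]) (auto simp: basis_elt_def)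
  qed
  have div: "\<exists>k\<in>carrier (mpoly_ring V). f = r1 * k" if "f \<in> mpoly_vs.span (basis_elt ` ?I1)" for f
    using that
  proof (induction rule: mpoly_vs.span_induct_alt)
    case base
    show ?case by (intro bexI[of _ 0]) (simp_all add: mpoly_carrier_zero)
  next
    case (step c x y)
    then obtain m s t where x: "m \<in> normal_monos" "s > 0" "x = basis_elt (m, s, t)" by auto
    obtain k where k: "k \<in> carrier (mpoly_ring V)" "y = r1 * k" using step by blast
    have "r1 ^ s = r1 * r1 ^ (s - 1)" using x(2) by (simp add: power_eq_if)
    then have "mscale c x + y = r1 * (mconst c * basis_elt (m, s - 1, t) + k)"
      by (simp add: x(3) k(2) basis_elt_def mscale_def algebra_simps)
    moreover have "mconst c * basis_elt (m, s - 1, t) + k \<in> carrier (mpoly_ring V)"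
      using x(1) k(1) by (intro mpoly_carrier_add mpoly_carrier_mult mpoly_carrier_mconst basis_elt_carrier) auto
    ultimately show ?case by blast
  qed
  have "g \<in> mpoly_vs.span (basis_elt ` ?I0 \<union> basis_elt ` ?I1)"
    using gh(1) unfolding carrier_eq_span I image_Un .
  then obtain g0 g1 where g: "g0 \<in> mpoly_vs.span (basis_elt ` ?I0)" "g1 \<in> mpoly_vs.span (basis_elt ` ?I1)" "g = g0 + g1"
    unfolding mpoly_vs.span_Un by blast
  obtain k where k: "k \<in> carrier (mpoly_ring V)" "g1 = r1 * k" using div[OF g(2)] by blast
  have "r2 * g0 = r1 * (h - r2 * k)" using gh(3) by (simp add: g(3) k(2) algebra_simps)
  moreover have "h - r2 * k \<in> carrier (mpoly_ring V)"
    using mpoly_carrier_add[OF gh(2) mpoly_carrier_uminus[OF mpoly_carrier_mult[OF r2(1) k(1)]]] by simp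
  ultimately have "r2 * g0 \<in> mpoly_vs.span (basis_elt ` ?I1)" using r1_span by simp
  moreover have "r2 * g0 \<in> mpoly_vs.span (basis_elt ` ?I0)" using r2_span g(1) by blast
  moreover have "basis_elt ` ?I0 \<inter> basis_elt ` ?I1 = {}"
    using inj_on_image_Int[OF inj_basis_elt, of ?I0 ?I1] by auto
  ultimately have "r2 * g0 = 0"
    using independent_basis unfolding I image_Un by (metis span_Int_disjoint)
  moreover have "r2 \<noteq> 0" using r2(3) by auto
  ultimately have "g0 = 0" by simp
  then show ?thesis using g(3) k by auto
qed

lemma ideal_pair: "genideal (mpoly_ring V) {r1, r2} =
    {r1 * h + r2 * k | h k. h \<in> carrier (mpoly_ring V) \<and> k \<in> carrier (mpoly_ring V)}" (is "_ = ?J")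
  and ideal_single: "genideal (mpoly_ring V) {r1} = {r1 * h | h. h \<in> carrier (mpoly_ring V)}" (is "_ = ?K")
  and ideal_empty: "genideal (mpoly_ring V :: ('v, 'a) mpoly ring) {} = {0}"
proof -
  interpret R: cring "mpoly_ring V :: ('v, 'a) mpoly ring" by (rule cring_mpoly_ring)
  note car = mpoly_carrier_add mpoly_carrier_mult mpoly_carrier_uminus mpoly_carrier_zero mpoly_carrier_one r1(1) r2(1)
  have idl: "ideal I (mpoly_ring V)" if "I \<subseteq> carrier (mpoly_ring V)" "0 \<in> I"
    "\<And>a b. a \<in> I \<Longrightarrow> b \<in> I \<Longrightarrow> a + b \<in> I" "\<And>a f. a \<in> I \<Longrightarrow> f \<in> carrier (mpoly_ring V) \<Longrightarrow> f * a \<in> I" for I :: "('v, 'a) mpoly set"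
  proof (rule idealI)
    show "ring (mpoly_ring V :: ('v, 'a) mpoly ring)" by (rule R.ring_axioms)
    show "subgroup I (add_monoid (mpoly_ring V))"
    proof
      fix a :: "('v, 'a) mpoly" assume a: "a \<in> I"
      then have "\<ominus>\<^bsub>mpoly_ring V\<^esub> a = (- 1) * a" using that(1) mpoly_ring_a_inv by auto
      then show "inv\<^bsub>add_monoid (mpoly_ring V)\<^esub> a \<in> I"
        using that(4)[OF a mpoly_carrier_uminus[OF mpoly_carrier_one]] by (simp add: a_inv_def)
    qed (use that in \<open>auto simp: mpoly_ring_simps(2-)\<close>)
    fix a f :: "('v, 'a) mpoly" assume "a \<in> I" "f \<in> carrier (mpoly_ring V)"
    then show "f \<otimes>\<^bsub>mpoly_ring V\<^esub> a \<in> I" "a \<otimes>\<^bsub>mpoly_ring V\<^esub> f \<in> I"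
      using that(4) by (simp_all add: mpoly_ring_simps(2-) mult.commute)
  qed
  have mem: "f * a \<in> I" if "ideal I (mpoly_ring V)" "a \<in> I" "f \<in> carrier (mpoly_ring V)" for I and a f :: "('v, 'a) mpoly"
    using ideal.I_l_closed[OF that] by (simp add: mpoly_ring_simps(2-))
  have sum: "a + b \<in> I" if "ideal I (mpoly_ring V)" "a \<in> I" "b \<in> I" for I and a b :: "('v, 'a) mpoly"
    using additive_subgroup.a_closed[OF ideal.axioms(1)[OF that(1)] that(2,3)] by (simp add: mpoly_ring_simps(2-))
  have "ideal ?J (mpoly_ring V)"
  proof (rule idl)
    show "?J \<subseteq> carrier (mpoly_ring V)" by (auto intro!: car)
    show "0 \<in> ?J" by (intro CollectI exI[of _ 0]) (simp add: car(4))
    fix a b :: "('v, 'a) mpoly" assume "a \<in> ?J" "b \<in> ?J"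
    then obtain h k h' k' where *: "h \<in> carrier (mpoly_ring V)" "k \<in> carrier (mpoly_ring V)" "a = r1 * h + r2 * k"
      "h' \<in> carrier (mpoly_ring V)" "k' \<in> carrier (mpoly_ring V)" "b = r1 * h' + r2 * k'" by blast
    then have "a + b = r1 * (h + h') + r2 * (k + k')" by (simp add: algebra_simps)
    then show "a + b \<in> ?J" using * car(1) by blast
  next
    fix a f :: "('v, 'a) mpoly" assume "a \<in> ?J" and f: "f \<in> carrier (mpoly_ring V)"
    then obtain h k where *: "h \<in> carrier (mpoly_ring V)" "k \<in> carrier (mpoly_ring V)" "a = r1 * h + r2 * k" by blast
    then have "f * a = r1 * (f * h) + r2 * (f * k)" by (simp add: algebra_simps)
    then show "f * a \<in> ?J" using * f car(2) by blast
  qed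
  moreover have "r1 \<in> ?J"
    by (rule CollectI, rule exI[of _ 1], rule exI[of _ 0]) (simp add: car(4,5))
  moreover have "r2 \<in> ?J"
    by (rule CollectI, rule exI[of _ 0], rule exI[of _ 1]) (simp add: car(4,5))
  ultimately have "genideal (mpoly_ring V) {r1, r2} \<subseteq> ?J" by (intro R.genideal_minimal) auto
  moreover have "?J \<subseteq> genideal (mpoly_ring V) {r1, r2}"
  proof clarify
    fix h k :: "('v, 'a) mpoly" assume hk: "h \<in> carrier (mpoly_ring V)" "k \<in> carrier (mpoly_ring V)"
    have i: "ideal (genideal (mpoly_ring V) {r1, r2}) (mpoly_ring V)" by (rule R.genideal_ideal) (use car in auto)
    have "r1 \<in> genideal (mpoly_ring V) {r1, r2}" "r2 \<in> genideal (mpoly_ring V) {r1, r2}"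
      using R.genideal_self[of "{r1, r2}"] car by auto
    from mem[OF i this(1) hk(1)] mem[OF i this(2) hk(2)] show "r1 * h + r2 * k \<in> genideal (mpoly_ring V) {r1, r2}"
      using sum[OF i] by (simp add: mult.commute)
  qed
  ultimately show "genideal (mpoly_ring V) {r1, r2} = ?J" by blast
  have "ideal ?K (mpoly_ring V)"
  proof (rule idl)
    show "?K \<subseteq> carrier (mpoly_ring V)" by (auto intro!: car)
    show "0 \<in> ?K" by (intro CollectI exI[of _ 0]) (simp add: car(4))
    fix a b :: "('v, 'a) mpoly" assume "a \<in> ?K" "b \<in> ?K"
    then obtain h h' where *: "h \<in> carrier (mpoly_ring V)" "a = r1 * h"
      "h' \<in> carrier (mpoly_ring V)" "b = r1 * h'" by blast
    then have "a + b = r1 * (h + h')" by (simp add: algebra_simps)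
    then show "a + b \<in> ?K" using * car(1) by blast
  next
    fix a f :: "('v, 'a) mpoly" assume "a \<in> ?K" and f: "f \<in> carrier (mpoly_ring V)"
    then obtain h where *: "h \<in> carrier (mpoly_ring V)" "a = r1 * h" by blast
    then have "f * a = r1 * (f * h)" by (simp add: algebra_simps)
    then show "f * a \<in> ?K" using * f car(2) by blast
  qed
  moreover have "r1 \<in> ?K"
    by (rule CollectI, rule exI[of _ 1]) (simp add: car(5))
  ultimately have "genideal (mpoly_ring V) {r1} \<subseteq> ?K" by (intro R.genideal_minimal) auto
  moreover have "?K \<subseteq> genideal (mpoly_ring V) {r1}"
  proof clarify
    fix h :: "('v, 'a) mpoly" assume h: "h \<in> carrier (mpoly_ring V)"
    have i: "ideal (genideal (mpoly_ring V) {r1}) (mpoly_ring V)" by (rule R.genideal_ideal) (use car in auto)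
    have "r1 \<in> genideal (mpoly_ring V) {r1}" using R.genideal_self[of "{r1}"] car by auto
    from mem[OF i this h] show "r1 * h \<in> genideal (mpoly_ring V) {r1}" by (simp add: mult.commute)
  qed
  ultimately show "genideal (mpoly_ring V) {r1} = ?K" by blast
  have "ideal {0} (mpoly_ring V :: ('v, 'a) mpoly ring)" by (rule idl) (auto simp: car)
  then have "genideal (mpoly_ring V :: ('v, 'a) mpoly ring) {} \<subseteq> {0}" by (intro R.genideal_minimal) auto
  moreover have "0 \<in> genideal (mpoly_ring V :: ('v, 'a) mpoly ring) {}"
    using additive_subgroup.zero_closed[OF ideal.axioms(1)[OF R.genideal_ideal[of "{}"]]]
    by (simp add: mpoly_ring_simps(5))
  ultimately show "genideal (mpoly_ring V :: ('v, 'a) mpoly ring) {} = {0}" by blast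
qed

lemma regular_pair:
  assumes "genideal (mpoly_ring V) {r1, r2} \<noteq> carrier (mpoly_ring V)"
  shows "regular_sequence (mpoly_ring V) [r1, r2]"
proof -
  have nz: "r1 \<noteq> 0" using r1(3) by auto
  have "g \<in> genideal (mpoly_ring V) (set (take i [r1, r2]))"
    if i: "i < length [r1, r2]" and g: "g \<in> carrier (mpoly_ring V)"
      and m: "[r1, r2] ! i \<otimes>\<^bsub>mpoly_ring V\<^esub> g \<in> genideal (mpoly_ring V) (set (take i [r1, r2]))" for i g
  proof -
    consider "i = 0" | "i = 1" using i by fastforce
    then show ?thesis
    proof cases
      case 1
      then show ?thesis using m nz by (simp add: ideal_empty mpoly_ring_simps(2))
    next
      case 2
      then have "r2 * g \<in> {r1 * h | h. h \<in> carrier (mpoly_ring V)}"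
        using m by (simp add: ideal_single mpoly_ring_simps(2))
      then obtain h where "h \<in> carrier (mpoly_ring V)" "r2 * g = r1 * h" by blast
      from nonzerodivisor[OF g this] 2 show ?thesis by (auto simp: ideal_single)
    qed
  qed
  then show ?thesis using assms r1(1) r2(1) by (simp add: regular_sequence_def)
qed

end

lemma pres_kernel_eq:
  "pres_kernel bs = {f \<in> carrier (pres_ring bs). pres_map bs f = 0}"
  by (auto simp: pres_kernel_def a_kernel_def' mpoly_ring_simps)

text \<open>Modulo \<open>r1\<close> and \<open>r2\<close> a kernel element is a combination of
  normal monomials. Their images have distinct lead monomials, so the combination is zero and the
  element lies in the ideal. The ideal is proper since 1 is not in the kernel.\<close>

lemma presentation_regular:
  fixes bs :: "(xyz, 'a::field) mpoly list"
  assumes "coprime_leads {..<length bs} \<kappa> u v p r1 r2" "0 \<notin> set bs"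
    and rel: "pres_map bs r1 = 0" "pres_map bs r2 = 0"
    and inj: "inj_on (\<lambda>K. lead_mono (bprod bs K))
      {K \<in> pres_mono bs. lookup K u < p \<and> lookup K v < p}"
  shows "regular_sequence (pres_ring bs) [r1, r2] \<and>
    pres_kernel bs = genideal (pres_ring bs) (set [r1, r2])"
proof -
  interpret coprime_leads "{..<length bs}" \<kappa> u v p r1 r2 by (rule assms(1))
  note hom = alg_hom_add[OF alg_hom_pres_map] alg_hom_mult[OF alg_hom_pres_map]
  have Nm: "normal_monos = {K \<in> pres_mono bs. lookup K u < p \<and> lookup K v < p}"
    by (auto simp: normal_monos_def pres_mono_def)
  have R: "mpoly_ring {..<length bs} = pres_ring bs" by (simp add: pres_ring_def)
  have normal0: "g = 0" if g: "g \<in> mpoly_vs.span ((\<lambda>m. single m 1) ` normal_monos)" "pres_map bs g = 0" for g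
  proof (rule ccontr)
    assume nz: "g \<noteq> 0"
    have keys: "keys g \<subseteq> normal_monos"
      using g(1)
    proof (induction rule: mpoly_vs.span_induct_alt)
      case (step c x y)
      then obtain m where m: "m \<in> normal_monos" "x = single m 1" by auto
      have "keys (mscale c x) \<subseteq> normal_monos"
        using m by (auto simp: mscale_def mconst_def mult_single)
      then show ?case using step keys_add[of "mscale c x" y] by blast
    qed simp
    then have "g \<in> carrier (pres_ring bs)" by (auto simp: carrier_pres_ring Nm)
    then have 0: "(\<Sum>K\<in>keys g. mconst (lookup g K) * bprod bs K) = 0"
      using g(2) by (simp add: pres_map_expand)
    have "\<exists>K\<in>keys g. lead_mono (bprod bs K) \<in>
        keys (\<Sum>K\<in>keys g. mconst (lookup g K) * bprod bs K) \<and>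
        (\<forall>L\<in>keys g. key3 (lead_mono (bprod bs L)) \<le> key3 (lead_mono (bprod bs K)))"
    proof (rule leads_sum_key)
      show "inj_on (\<lambda>K. lead_mono (bprod bs K)) (keys g)"
        using keys inj unfolding Nm by (rule inj_on_subset[rotated])
      show "leads3 (bprod bs K) (lead_mono (bprod bs K))" for K
        using bprod_nz[OF assms(2)] by (rule leads3_ex)
    qed (use nz in \<open>auto simp: in_keys_iff\<close>)
    then show False by (simp add: 0)
  qed
  have kernel: "pres_kernel bs = genideal (pres_ring bs) {r1, r2}"
  proof (intro equalityI subsetI)
    fix f assume "f \<in> pres_kernel bs"
    then have f: "f \<in> carrier (mpoly_ring {..<length bs})" "pres_map bs f = 0"
      by (simp_all add: pres_kernel_eq R)
    obtain g h k where g: "g \<in> mpoly_vs.span ((\<lambda>m. single m 1) ` normal_monos)"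
      "h \<in> carrier (mpoly_ring {..<length bs})" "k \<in> carrier (mpoly_ring {..<length bs})" "f = g + r1 * h + r2 * k"
      using carrier_decompose[OF f(1)] .
    have "pres_map bs g = 0" using f(2) by (simp add: g(4) hom rel)
    then have "g = 0" using normal0 g(1) by blast
    then show "f \<in> genideal (pres_ring bs) {r1, r2}"
      using g unfolding R[symmetric] ideal_pair by auto
  next
    fix f assume "f \<in> genideal (pres_ring bs) {r1, r2}"
    then obtain h k where hk: "h \<in> carrier (mpoly_ring {..<length bs})" "k \<in> carrier (mpoly_ring {..<length bs})"
      "f = r1 * h + r2 * k" unfolding R[symmetric] ideal_pair by blast
    have "f \<in> carrier (mpoly_ring {..<length bs})"
      unfolding hk(3) using hk(1,2) r1(1) r2(1) by (intro mpoly_carrier_add mpoly_carrier_mult)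
    then show "f \<in> pres_kernel bs" by (simp add: pres_kernel_eq hk(3) hom rel R)
  qed
  have "regular_sequence (pres_ring bs) [r1, r2]"
    unfolding R[symmetric]
  proof (rule regular_pair, rule notI)
    assume "genideal (mpoly_ring {..<length bs}) {r1, r2} = carrier (mpoly_ring {..<length bs})"
    then have "1 \<in> genideal (pres_ring bs) {r1, r2}"
      by (simp add: mpoly_carrier_one pres_ring_def)
    then have "1 \<in> pres_kernel bs" using kernel by simp
    then show False by (simp add: pres_kernel_eq alg_hom_1[OF alg_hom_pres_map])
  qed
  with kernel show ?thesis by simp
qed

subsection \<open>Minors\<close>

text \<open>Laplace expansion with the minors again in the form \<open>mat n n f\<close>, so that
  rewriting evaluates a determinant of fixed size.\<close>

lemma det_mat_Suc:
  "det (mat (Suc n) (Suc n) f) = (\<Sum>j<Suc n. f (0, j) * ((- 1) ^ j *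
    det (mat n n (\<lambda>(i, k). f (Suc i, if k < j then k else Suc k)))))"
proof -
  have "det (mat (Suc n) (Suc n) f) = (\<Sum>j<Suc n. mat (Suc n) (Suc n) f $$ (0, j) * cofactor (mat (Suc n) (Suc n) f) 0 j)"
    by (rule laplace_expansion_row) simp_all
  also have "\<dots> = (\<Sum>j<Suc n. f (0, j) * ((- 1) ^ j *
    det (mat n n (\<lambda>(i, k). f (Suc i, if k < j then k else Suc k)))))"
  proof (intro sum.cong refl)
    fix j assume j: "j \<in> {..<Suc n}"
    have "mat_delete (mat (Suc n) (Suc n) f) 0 j = mat n n (\<lambda>(i, k). f (Suc i, if k < j then k else Suc k))"
      by (rule eq_matI) (auto simp: mat_delete_def)
    with j show "mat (Suc n) (Suc n) f $$ (0, j) * cofactor (mat (Suc n) (Suc n) f) 0 j =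
      f (0, j) * ((- 1) ^ j * det (mat n n (\<lambda>(i, k). f (Suc i, if k < j then k else Suc k))))"
      by (simp add: cofactor_def)
  qed
  finally show ?thesis .
qed

definition det3 :: "(nat \<Rightarrow> 'a::comm_ring_1) \<Rightarrow> (nat \<Rightarrow> 'a) \<Rightarrow> (nat \<Rightarrow> 'a) \<Rightarrow> nat \<Rightarrow> nat \<Rightarrow> nat \<Rightarrow> 'a"
  where "det3 b c d i j k = b i * (c j * d k - c k * d j) - b j * (c i * d k - c k * d i) + b k * (c i * d j - c j * d i)"

definition det4 :: "(nat \<Rightarrow> 'a::comm_ring_1) \<Rightarrow> (nat \<Rightarrow> 'a) \<Rightarrow> (nat \<Rightarrow> 'a) \<Rightarrow> (nat \<Rightarrow> 'a) \<Rightarrow> 'a"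
  where "det4 a b c d = a 0 * det3 b c d 1 2 3 - a 1 * det3 b c d 0 2 3 + a 2 * det3 b c d 0 1 3 - a 3 * det3 b c d 0 1 2"

lemma det_mat_4: "det (mat 4 4 f) = det4 (\<lambda>j. f (0, j)) (\<lambda>j. f (1, j)) (\<lambda>j. f (2, j)) (\<lambda>j. f (3, j))"
proof -
  have "det (mat 4 4 f) = det (mat (Suc (Suc (Suc (Suc 0)))) (Suc (Suc (Suc (Suc 0)))) f)"
    by (simp add: numeral_eq_Suc)
  also have "\<dots> = det4 (\<lambda>j. f (0, j)) (\<lambda>j. f (1, j)) (\<lambda>j. f (2, j)) (\<lambda>j. f (3, j))"
    by (simp add: det_mat_Suc det4_def det3_def numeral_eq_Suc) (simp add: algebra_simps)
  finally show ?thesis .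
qed

text \<open>Rows counted from 1, as in \<open>gam\<close>. In this form the p-th power of row k is
  row k + 2.\<close>

definition grow :: "nat \<Rightarrow> 'a::comm_ring_1 mat \<Rightarrow> nat \<Rightarrow> nat \<Rightarrow> 'a"
  where "grow p M k j = (M $$ ((k - 1) mod 2, j)) ^ (p ^ ((k - 1) div 2))"

lemma gam_eq_det4:
  assumes "i \<in> {1..10}" "j \<in> {1..10}" "k \<in> {1..10}" "l \<in> {1..10}"
  shows "gam p M i j k l = det4 (grow p M i) (grow p M j) (grow p M k) (grow p M l)"
proof -
  have r: "row (gamma_mat p M) (r - 1) = vec 4 (grow p M r)" if "r \<in> {1..10}" for r
    using that by (auto simp: gamma_mat_def grow_def intro!: eq_vecI)
  have "mat_of_rows 4 (map (\<lambda>r. row (gamma_mat p M) (r - 1)) [i, j, k, l]) =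
      mat 4 4 (\<lambda>(a, b). grow p M ([i, j, k, l] ! a) b)"
  proof (rule eq_matI)
    fix a b assume "a < dim_row (mat 4 4 (\<lambda>(a, b). grow p M ([i, j, k, l] ! a) b))"
      "b < dim_col (mat 4 4 (\<lambda>(a, b). grow p M ([i, j, k, l] ! a) b))"
    then have ab: "a < 4" "b < 4" by simp_all
    then consider "a = 0" | "a = 1" | "a = 2" | "a = 3" by linarith
    then show "mat_of_rows 4 (map (\<lambda>r. row (gamma_mat p M) (r - 1)) [i, j, k, l]) $$ (a, b) =
      mat 4 4 (\<lambda>(a, b). grow p M ([i, j, k, l] ! a) b) $$ (a, b)"
      by cases (use ab assms in \<open>simp_all add: mat_of_rows_index r[unfolded One_nat_def]\<close>)
  qed simp_all
  then have "gam p M i j k l = det (mat 4 4 (\<lambda>(a, b). grow p M ([i, j, k, l] ! a) b))"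
    by (simp only: gam_def)
  then show ?thesis by (simp add: det_mat_4)
qed

text \<open>A 5 by 5 determinant with two equal columns: the rows are the five vectors, each
  extended by its own j-th coordinate, and the expansion is along the added column.\<close>

lemma det4_cramer:
  assumes "j < 4"
  shows "det4 a b c d * e j - det4 a b c e * d j + det4 a b d e * c j - det4 a c d e * b j + det4 b c d e * a j = 0"
proof -
  consider "j = 0" | "j = 1" | "j = 2" | "j = 3" using assms by linarith
  then show ?thesis
    by cases (simp_all add: det4_def det3_def algebra_simps)
qed

lemma det4_swap: "det4 a b c d = - det4 b a c d" "det4 a b c d = - det4 a c b d" "det4 a b c d = - det4 a b d c"
  by (simp_all add: det4_def det3_def algebra_simps)

lemma det4_rotate: "det4 c e a d = - det4 a c d e" "det4 c e a d = det4 a c e d"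
  by (simp_all add: det4_def det3_def algebra_simps)

lemma det4_linear3: "det4 a b (\<lambda>j. s * u j + t * v j) d = s * det4 a b u d + t * det4 a b v d"
  by (simp add: det4_def det3_def algebra_simps)

lemma det4_cong3:
  assumes "\<And>j. j < 4 \<Longrightarrow> c j = c' j"
  shows "det4 a b c d = det4 a b c' d"
proof -
  have "c 0 = c' 0" "c 1 = c' 1" "c 2 = c' 2" "c 3 = c' 3" using assms by simp_all
  then show ?thesis by (simp add: det4_def det3_def)
qed

lemma det4_same: "det4 a b a d = 0" "det4 a b b d = 0"
  by (simp_all add: det4_def det3_def algebra_simps)

text \<open>Obtained by expanding the Cramer relation of \<open>u, v, x, y, z\<close> in the third row of a
  determinant whose other rows are \<open>u\<close>, \<open>v\<close> and \<open>w\<close>.\<close>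

lemma det4_pluecker:
  fixes u v x y z w :: "nat \<Rightarrow> 'a::comm_ring_1"
  shows "det4 u v x y * det4 u v z w - det4 u v x z * det4 u v y w + det4 u v y z * det4 u v x w = 0"
proof -
  let ?A = "det4 u v x y" and ?B = "det4 u v x z" and ?C = "det4 u v y z"
  have "det4 u v (\<lambda>j. ?A * z j + (- 1) * (?B * y j + (- ?C) * x j)) w =
      det4 u v (\<lambda>j. det4 u x y z * v j + (- det4 v x y z) * u j) w"
  proof (rule det4_cong3)
    fix j :: nat assume "j < 4"
    have "(?A * z j + (- 1) * (?B * y j + (- ?C) * x j)) - (det4 u x y z * v j + (- det4 v x y z) * u j) =
        ?A * z j - ?B * y j + ?C * x j - det4 u x y z * v j + det4 v x y z * u j"
      by (simp add: algebra_simps)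
    also have "\<dots> = 0" by (rule det4_cramer[OF \<open>j < 4\<close>])
    finally show "?A * z j + (- 1) * (?B * y j + (- ?C) * x j) = det4 u x y z * v j + (- det4 v x y z) * u j"
      by (simp only: right_minus_eq)
  qed
  also have "\<dots> = 0" unfolding det4_linear3 by (simp add: det4_same)
  finally show ?thesis unfolding det4_linear3 by (simp add: algebra_simps)
qed

text \<open>Cramer's rule: combining the four orthogonality equations with the cofactors of column j
  leaves \<open>det4 a b c d * n j\<close>.\<close>

lemma det4_kernel:
  fixes a b c d n :: "nat \<Rightarrow> 'a::comm_ring_1"
  assumes "\<And>r. r \<in> {a, b, c, d} \<Longrightarrow> n 0 * r 0 + n 1 * r 1 + n 2 * r 2 + n 3 * r 3 = 0" and "j < (4 :: nat)"
  shows "det4 a b c d * n j = 0"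
proof -
  let ?s = "\<lambda>r. n 0 * r 0 + n 1 * r 1 + n 2 * r 2 + n 3 * r 3"
  have n0: "det4 a b c d * n 0 = ?s a * det3 b c d 1 2 3 - ?s b * det3 a c d 1 2 3 + ?s c * det3 a b d 1 2 3 - ?s d * det3 a b c 1 2 3"
    by (simp add: det4_def det3_def algebra_simps)
  have n1: "det4 a b c d * n 1 = - (?s a * det3 b c d 0 2 3 - ?s b * det3 a c d 0 2 3 + ?s c * det3 a b d 0 2 3 - ?s d * det3 a b c 0 2 3)"
    by (simp add: det4_def det3_def algebra_simps)
  have n2: "det4 a b c d * n 2 = ?s a * det3 b c d 0 1 3 - ?s b * det3 a c d 0 1 3 + ?s c * det3 a b d 0 1 3 - ?s d * det3 a b c 0 1 3"
    by (simp add: det4_def det3_def algebra_simps)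
  have n3: "det4 a b c d * n 3 = - (?s a * det3 b c d 0 1 2 - ?s b * det3 a c d 0 1 2 + ?s c * det3 a b d 0 1 2 - ?s d * det3 a b c 0 1 2)"
    by (simp add: det4_def det3_def algebra_simps)
  have z: "?s a = 0" "?s b = 0" "?s c = 0" "?s d = 0"
    by (simp_all only: assms(1) insert_iff simp_thms)
  consider "j = 0" | "j = 1" | "j = 2" | "j = 3" using assms(2) by linarith
  then show ?thesis
  proof cases
    case 1 then show ?thesis by (simp only: n0 z) simp
  next
    case 2 then show ?thesis by (simp only: n1 z) simp
  next
    case 3 then show ?thesis by (simp only: n2 z) simp
  next
    case 4 then show ?thesis by (simp only: n3 z) simp
  qed
qed

section \<open>Frobenius on the minors\<close>

context
  fixes p :: nat
  assumes p: "prime p" "CHAR('a::comm_ring_1) = p"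
begin

lemma frob_add: "(x + y :: 'a) ^ p = x ^ p + y ^ p"
  by (rule freshmans_dream) (simp_all add: p)

lemma frob_diff: "(x - y :: 'a) ^ p = x ^ p - y ^ p"
proof -
  have "(x - y) ^ p + y ^ p = x ^ p" by (simp flip: frob_add)
  then show ?thesis by (simp only: eq_diff_eq)
qed

lemma frob_of_nat: "(of_nat n :: 'a) ^ p = of_nat n"
  using prime_gt_0_nat[OF p(1)] by (induction n) (simp_all add: frob_add zero_power)

lemma frob_det4: "det4 a b c d ^ p = det4 (\<lambda>j. a j ^ p) (\<lambda>j. b j ^ p) (\<lambda>j. c j ^ p) (\<lambda>j. d j ^ p :: 'a)"
  by (simp add: det4_def det3_def frob_add frob_diff power_mult_distrib)

text \<open>The bound matters: truncated subtraction makes \<open>grow p M 0\<close> the first row,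
  whose p-th power is row 3 and not row 2.\<close>

lemma frob_grow: "k \<ge> 1 \<Longrightarrow> (grow p M k j :: 'a) ^ p = grow p M (k + 2) j"
proof -
  assume "k \<ge> 1"
  then obtain m where "k = Suc m" by (cases k) auto
  moreover have "(x ^ (p ^ n)) ^ p = x ^ (p ^ Suc n)" for x :: 'a and n
    unfolding power_mult[symmetric] by (simp add: mult.commute)
  ultimately show ?thesis by (simp add: grow_def)
qed

lemma frob_gam:
  assumes "i \<in> {1..8}" "j \<in> {1..8}" "k \<in> {1..8}" "l \<in> {1..8}"
  shows "(gam p M i j k l :: 'a) ^ p = gam p M (i + 2) (j + 2) (k + 2) (l + 2)"
proof -
  have "gam p M i j k l ^ p = (det4 (grow p M i) (grow p M j) (grow p M k) (grow p M l) :: 'a) ^ p"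
    using assms by (subst gam_eq_det4) auto
  also have "\<dots> = det4 (grow p M (i + 2)) (grow p M (j + 2)) (grow p M (k + 2)) (grow p M (l + 2))"
    using assms by (simp only: frob_det4) (simp add: frob_grow)
  also have "\<dots> = gam p M (i + 2) (j + 2) (k + 2) (l + 2)"
    using assms by (subst gam_eq_det4) auto
  finally show ?thesis .
qed

text \<open>The coefficient of the lead term of \<open>fbar3\<close>.\<close>

lemma gam_identity:
  "gam p M 1 2 3 5 ^ p * (gam p M 1 2 3 5 * gam p M 1 3 4 6 - gam p M 1 3 4 5 * gam p M 1 2 3 6) -
    gam p M 1 2 3 4 * (gam p M 1 3 4 5 * gam p M 1 3 4 5 ^ p) =
    gam p M 1 2 3 4 * gam p M 1 2 3 4 ^ p * (gam p M 1 3 5 7 :: 'a)"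
proof -
  let ?g = "\<lambda>i j k l. det4 (grow p M i) (grow p M j) (grow p M k) (grow p M l) :: 'a"
  have g: "gam p M 1 2 3 5 ^ p = ?g 3 4 5 7" "gam p M 1 3 4 5 ^ p = ?g 3 5 6 7" "gam p M 1 2 3 4 ^ p = ?g 3 4 5 6"
  proof -
    have n: "1 + 2 = (3::nat)" "2 + 2 = (4::nat)" "3 + 2 = (5::nat)" "4 + 2 = (6::nat)" "5 + 2 = (7::nat)" by simp_all
    show "gam p M 1 2 3 5 ^ p = ?g 3 4 5 7" "gam p M 1 3 4 5 ^ p = ?g 3 5 6 7" "gam p M 1 2 3 4 ^ p = ?g 3 4 5 6"
      using frob_gam[of 1 2 3 5 M, unfolded n] frob_gam[of 1 3 4 5 M, unfolded n] frob_gam[of 1 2 3 4 M, unfolded n]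
      by (simp_all add: gam_eq_det4)
  qed
  \<comment> \<open>The three-term relation with common rows 1 and 3 evaluates the bracket in the
    identity.\<close>
  have "?g 1 3 2 4 * ?g 1 3 5 6 - ?g 1 3 2 5 * ?g 1 3 4 6 + ?g 1 3 4 5 * ?g 1 3 2 6 = 0"
    by (rule det4_pluecker)
  then have 1: "?g 1 2 3 5 * ?g 1 3 4 6 - ?g 1 3 4 5 * ?g 1 2 3 6 = ?g 1 2 3 4 * ?g 1 3 5 6"
    unfolding det4_swap(2)[of "grow p M 1" "grow p M 3" "grow p M 2"] by (simp add: algebra_simps)
  note s = det4_rotate(1)[of "grow p M 3" "grow p M 5" "grow p M 1" "grow p M 4"]
    det4_rotate(2)[of "grow p M 3" "grow p M 5" "grow p M 1" "grow p M 6"]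
    det4_rotate(2)[of "grow p M 3" "grow p M 5" "grow p M 1" "grow p M 7"]
    det4_swap(2)[of "grow p M 3" "grow p M 5" "grow p M 4"]
  \<comment> \<open>The Frobenius images of the minors all contain rows 3 and 5, hence the relation
    with these rows in common.\<close>
  have "?g 3 5 1 4 * ?g 3 5 6 7 - ?g 3 5 1 6 * ?g 3 5 4 7 + ?g 3 5 4 6 * ?g 3 5 1 7 = 0"
    by (rule det4_pluecker)
  then have 2: "?g 3 4 5 7 * ?g 1 3 5 6 - ?g 1 3 4 5 * ?g 3 5 6 7 = ?g 3 4 5 6 * ?g 1 3 5 7"
    unfolding s by (simp add: algebra_simps)
  have G: "gam p M 1 2 3 5 = ?g 1 2 3 5" "gam p M 1 3 4 6 = ?g 1 3 4 6" "gam p M 1 3 4 5 = ?g 1 3 4 5"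
    "gam p M 1 2 3 6 = ?g 1 2 3 6" "gam p M 1 2 3 4 = ?g 1 2 3 4" "gam p M 1 3 5 7 = ?g 1 3 5 7"
    by (rule gam_eq_det4; simp)+
  have alg: "A * E - C * D = F * H \<Longrightarrow> A * (w * E) - w * (C * D) = w * F * H"
    for A C D E F H w :: 'a
  proof -
    assume h: "A * E - C * D = F * H"
    have "A * (w * E) - w * (C * D) = w * (A * E - C * D)" by (simp add: algebra_simps)
    then show ?thesis by (simp only: h mult.assoc)
  qed
  show ?thesis
    unfolding g unfolding G 1 using 2 by (rule alg)
qed

end

subsection \<open>The lead term computation\<close>

definition cg :: "'r::comm_ring_1 \<Rightarrow> 'r \<Rightarrow> 'r \<Rightarrow> bool"
  where "cg w u v \<longleftrightarrow> w dvd u - v"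

lemma cg_refl [simp]: "cg w u u"
  by (simp add: cg_def)

lemma cg_trans: "cg w u v \<Longrightarrow> cg w v t \<Longrightarrow> cg w u t"
  unfolding cg_def using dvd_add[of w "u - v" "v - t"] by simp

lemma cg_add: "cg w u v \<Longrightarrow> cg w u' v' \<Longrightarrow> cg w (u + u') (v + v')"
  unfolding cg_def using dvd_add[of w "u - v" "u' - v'"] by (simp add: algebra_simps)

lemma cg_mult: "cg w u v \<Longrightarrow> cg w u' v' \<Longrightarrow> cg w (u * u') (v * v')"
proof -
  assume "cg w u v" "cg w u' v'"
  then have "w dvd (u - v) * u' + v * (u' - v')" unfolding cg_def by simp
  then show ?thesis by (simp add: cg_def algebra_simps)
qed

lemma cg_power: "cg w u v \<Longrightarrow> cg w (u ^ n) (v ^ n)"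
  by (induction n) (auto intro: cg_mult)

text \<open>A factor \<open>x ^ k\<close> gains k in precision. So the later products of the
  combination, which carry high powers of \<open>x\<close>, have to be known modulo low powers
  only.\<close>

lemma cg_scale: "cg w u v \<Longrightarrow> cg (k * w) (k * u) (k * v)"
  unfolding cg_def by (metis mult_dvd_mono dvd_refl right_diff_distrib)

lemma cg_mono: "w dvd w' \<Longrightarrow> cg w' u v \<Longrightarrow> cg w u v"
  unfolding cg_def by (rule dvd_trans)

lemma cg_drop: "w dvd t \<Longrightarrow> cg w (u + t) u"
  by (simp add: cg_def)

lemma cg_drop': "w dvd t \<Longrightarrow> cg w (u - t) u"
  by (simp add: cg_def)

lemma powadd: "m + n = k \<Longrightarrow> (u :: 'r::comm_ring_1) ^ m * u ^ n = u ^ k"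
  by (simp flip: power_add)

text \<open>\<open>g\<close> stands for the minor 1234, \<open>a\<close> to \<open>d\<close> for 1235, 1245, 1345, 2345 and \<open>a'\<close> to \<open>d'\<close> for
  1236, 1246, 1346, 2346.\<close>

locale fbar3_computation =
  fixes p :: nat and x y z g a b c d a' b' c' d' h :: "'r::comm_ring_1"
  assumes p: "prime p" "p > 2" and char: "CHAR('r) = p" and h: "2 * h = 1"
begin

definition "dl = y ^ 2 - x * z"
text \<open>Apart from their first summands, \<open>F1\<close> and \<open>G\<close> are multiples of
  \<open>x ^ (p^2 - 2 * p)\<close> and \<open>x ^ (2 * p^2 - 2 * p)\<close>; \<open>ph\<close> and
  \<open>ps\<close> are the cofactors, both of the same shape and of degree 2p.\<close>

definition "ph = a * dl ^ p + b * x ^ p * y ^ p + c * x ^ (2 * p - 2) * dl + d * x ^ (2 * p - 1) * y"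
definition "ps = a' * dl ^ p + b' * x ^ p * y ^ p + c' * x ^ (2 * p - 2) * dl + d' * x ^ (2 * p - 1) * y"
definition "F1 = g * y ^ (p^2) + x ^ (p^2 - 2 * p) * ph"
definition "G = - g * dl ^ (p^2) + x ^ (2 * p^2 - 2 * p) * ps"
text \<open>The division that defines \<open>fbar2\<close>, carried out. In
  \<open>F1^2 + g * G\<close> the terms with y^(2p^2) cancel, because delta^(p^2) = y^(2p^2) -
  x^(p^2) z^(p^2), and all that is left is divisible by 2 x^(p^2 - 2p).\<close>

definition "F2 = h * g^2 * x ^ (2 * p) * z ^ (p^2) + g * y ^ (p^2) * ph + h * x ^ (p^2 - 2 * p) * ph^2 + h * g * x ^ (p^2) * ps"

lemma fadd: "(u + v :: 'r) ^ p = u ^ p + v ^ p"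
  by (rule frob_add[OF p(1) char])

lemma fdiff: "(u - v :: 'r) ^ p = u ^ p - v ^ p"
  by (rule frob_diff[OF p(1) char])

lemma p3: "3 \<le> p" "odd p"
  using p prime_odd_nat by auto

lemma p2: "3 * p \<le> p^2"
  using p3(1) by (simp add: power2_eq_square)

lemma p2': "p^2 = p * p" "p^3 = p * (p * p)"
  by (simp_all add: power2_eq_square power3_eq_cube)

lemma xq: "x ^ (p^2 - 2 * p) * x ^ (2 * p) = x ^ (p^2)" "x ^ (p^2) * x ^ (p^2 - 2 * p) = x ^ (2 * p^2 - 2 * p)"
  "x ^ (2 * p^2 - 2 * p) * x ^ (2 * p - 1) = x ^ (2 * p^2 - 1)"
  by (rule powadd, use p2 p3 in arith)+

lemma dl_pow: "dl ^ p = y ^ (2 * p) - x ^ p * z ^ p" "dl ^ (p^2) = y ^ (p^2) * y ^ (p^2) - x ^ (p^2) * z ^ (p^2)"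
proof -
  show 1: "dl ^ p = y ^ (2 * p) - x ^ p * z ^ p"
    unfolding dl_def fdiff by (simp add: power_mult_distrib flip: power_mult)
  show "dl ^ (p^2) = y ^ (p^2) * y ^ (p^2) - x ^ (p^2) * z ^ (p^2)"
  proof -
    have "2 * p * p = p^2 + p^2" by (simp add: power2_eq_square)
    then have "(y ^ (2 * p)) ^ p = y ^ (p^2) * y ^ (p^2)" by (simp flip: power_mult power_add)
    moreover have "dl ^ (p^2) = (dl ^ p) ^ p" by (simp add: power2_eq_square flip: power_mult)
    moreover have "(x ^ p * z ^ p) ^ p = x ^ (p^2) * z ^ (p^2)"
      by (simp add: power_mult_distrib power2_eq_square flip: power_mult)
    ultimately show ?thesis unfolding 1 fdiff by simp
  qed
qed

lemma F2_eq: "2 * x ^ (p^2 - 2 * p) * F2 = F1^2 + g * G"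
proof -
  have "2 * x ^ (p^2 - 2 * p) * F2 = (2 * h) * g^2 * (x ^ (p^2 - 2 * p) * x ^ (2 * p)) * z ^ (p^2)
      + 2 * x ^ (p^2 - 2 * p) * g * y ^ (p^2) * ph + (2 * h) * (x ^ (p^2 - 2 * p) * ph)^2
      + (2 * h) * g * (x ^ (p^2) * x ^ (p^2 - 2 * p)) * ps"
    unfolding F2_def by (simp add: algebra_simps power2_eq_square)
  also have "\<dots> = F1^2 + g * G"
    unfolding F1_def G_def h xq dl_pow by (simp add: algebra_simps power2_eq_square)
  finally show ?thesis .
qed

lemma ph_pow: "ph ^ p = a ^ p * dl ^ (p^2) + x ^ (p^2) * (b ^ p * y ^ (p^2) + c ^ p * x ^ (p^2 - 2 * p) * dl ^ p
    + d ^ p * x ^ (p^2 - p) * y ^ p)"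
proof -
  have e: "(2 * p - 2) * p = p^2 + (p^2 - 2 * p)" "(2 * p - 1) * p = p^2 + (p^2 - p)"
  proof -
    have "2 * p * p = p^2 + p^2" by (simp add: power2_eq_square)
    then show "(2 * p - 2) * p = p^2 + (p^2 - 2 * p)" "(2 * p - 1) * p = p^2 + (p^2 - p)"
      using p2 unfolding diff_mult_distrib by arith+
  qed
  show ?thesis
    unfolding ph_def fadd power_mult_distrib power_mult[symmetric] e power2_eq_square[symmetric] power_add
    by (simp only: distrib_left distrib_right mult_ac add_ac)
qed

lemma h_pow: "h ^ p = h"
proof -
  have "(2 :: 'r) ^ p = 2"
    using frob_of_nat[OF p(1) char, of 2] by simp
  then have "2 * h ^ p = (2 * h) ^ p" by (simp add: power_mult_distrib)
  then have "2 * h ^ p = 1" by (simp add: h)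
  then have "h = h * (2 * h ^ p)" by simp
  also have "\<dots> = (2 * h) * h ^ p" by (simp only: mult_ac)
  finally show ?thesis by (simp add: h)
qed

lemma F1_pow: "F1 ^ p = g ^ p * y ^ (p^3) + x ^ (p^3 - 2 * p^2) * ph ^ p"
proof -
  have e: "(p^2 - 2 * p) * p = p^3 - 2 * p^2" "p^2 * p = p^3"
    by (simp_all add: p2' diff_mult_distrib)
  show ?thesis unfolding F1_def fadd power_mult_distrib by (simp add: e flip: power_mult)
qed

lemma F2_pow: "F2 ^ p = h * g ^ (2 * p) * x ^ (2 * p^2) * z ^ (p^3) + g ^ p * y ^ (p^3) * ph ^ p
    + h * x ^ (p^3 - 2 * p^2) * (ph ^ p)^2 + h * g ^ p * x ^ (p^3) * ps ^ p"
proof -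
  have e: "(p^2 - 2 * p) * p = p^3 - 2 * p^2" "p^2 * p = p^3" "2 * p * p = 2 * p^2"
    by (simp_all add: p2' diff_mult_distrib)
  show ?thesis unfolding F2_def fadd power_mult_distrib h_pow
    by (simp add: e mult.commute[of p 2] flip: power_mult)
qed

text \<open>A term quadratic in \<open>a ^ p * dl ^ (p^2)\<close> enters with the factor x^(p^3 -
  2p^2). For p >= 5 this factor is 0 modulo x^(2p^2 - 1); for p = 3 its exponent is only p^2, and
  this coefficient survives.\<close>

definition "eps = (if p = 3 then h * g^2 * (a ^ p)^2 else 0)"

text \<open>The third product turns \<open>F1 ^ (p + 2)\<close> into
  \<open>F1 ^ p * (F1^2 - 2 * x ^ (p^2 - 2 * p) * F2)\<close>, which is
  \<open>- (g * F1 ^ p * G)\<close> by \<open>F2_eq\<close>. The p-th powers are then expanded by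
  Frobenius, and the terms with y^(p^3) delta^(p^2) cancel against those of
  \<open>g^2 * F2 ^ p\<close>.\<close>

lemma step1:
  "cg (x ^ (2 * p^2 - 1)) (a ^ p * F1 ^ (p + 2) - g^2 * F2 ^ p - 2 * a ^ p * x ^ (p^2 - 2 * p) * F1 ^ p * F2)
    (- (g * g ^ p) * y ^ (p^3) * x ^ (2 * p^2 - 2 * p) * (a ^ p * ps + g * c ^ p * dl ^ p + g * d ^ p * x ^ p * y ^ p)
      + (eps - g^2 * g ^ p * b ^ p) * x ^ (p^2) * y ^ (p^3) * y ^ (p^2))"
proof -
  let ?W = "x ^ (2 * p^2 - 1)" and ?T = "x ^ (2 * p^2 - 2 * p)" and ?P = "x ^ (p^3 - 2 * p^2)"
  let ?D = "dl ^ (p^2)" and ?xx = "x ^ (p^2)"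
  define E where "E = b ^ p * y ^ (p^2) + c ^ p * x ^ (p^2 - 2 * p) * dl ^ p + d ^ p * x ^ (p^2 - p) * y ^ p"
  have Phi: "ph ^ p = a ^ p * ?D + ?xx * E" by (simp add: ph_pow E_def)
  have n: "3 * p^2 \<le> p^3" using p3(1) by (simp add: p2')
  have w1: "?W dvd x ^ (2 * p^2)" "?W dvd x ^ (p^3)" by (intro le_imp_power_dvd, use n in simp)+
  have w2: "?W dvd ?P * ?T"
    unfolding power_add[symmetric] by (rule le_imp_power_dvd) (use n p2 p3 in linarith)
  have w3: "?W dvd ?xx * ?xx"
    unfolding power_add[symmetric] by (rule le_imp_power_dvd) simp
  \<comment> \<open>With \<open>ph ^ p\<close> the sum of A = \<open>a ^ p * dl ^ (p^2)\<close> and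
    B = \<open>x ^ (p^2) * E\<close>, this is A(A + B) - (A + B)^2/2 = (A^2 - B^2)/2.\<close>
  have sq: "a ^ p * ph ^ p * ?D - h * (ph ^ p)^2 = h * (a ^ p * ?D)^2 - h * (?xx * E)^2"
  proof -
    have "a ^ p * ph ^ p * ?D - h * (ph ^ p)^2 = (2 * h) * (a ^ p * ph ^ p * ?D) - h * (ph ^ p)^2" by (simp add: h)
    also have "\<dots> = h * (a ^ p * ?D)^2 - h * (?xx * E)^2"
      unfolding Phi by (simp add: algebra_simps power2_eq_square)
    finally show ?thesis .
  qed
  have eq: "a ^ p * F1 ^ (p + 2) - g^2 * F2 ^ p - 2 * a ^ p * x ^ (p^2 - 2 * p) * F1 ^ p * F2 =
      - (g * g ^ p) * y ^ (p^3) * ?T * (a ^ p * ps) - g^2 * g ^ p * y ^ (p^3) * (?xx * E)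
      + g^2 * ?P * (h * (a ^ p * ?D)^2)
      - (g^2 * ?P * (h * E^2) * (?xx * ?xx) + g * a ^ p * ps * ph ^ p * (?P * ?T)
        + g^2 * h * g ^ (2 * p) * z ^ (p^3) * x ^ (2 * p^2) + g^2 * h * g ^ p * ps ^ p * x ^ (p^3))"
  proof -
    have "a ^ p * F1 ^ (p + 2) - g^2 * F2 ^ p - 2 * a ^ p * x ^ (p^2 - 2 * p) * F1 ^ p * F2 =
        a ^ p * F1 ^ p * (F1^2 - 2 * x ^ (p^2 - 2 * p) * F2) - g^2 * F2 ^ p"
      by (simp only: power_add) (simp add: algebra_simps)
    also have "\<dots> = - (g * a ^ p * F1 ^ p * G) - g^2 * F2 ^ p"
      unfolding F2_eq by (simp add: algebra_simps)
    also have "\<dots> = - (g * g ^ p) * y ^ (p^3) * ?T * (a ^ p * ps)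
        + g^2 * g ^ p * y ^ (p^3) * (a ^ p * ?D - ph ^ p) + g^2 * ?P * (a ^ p * ph ^ p * ?D - h * (ph ^ p)^2)
      - (g * a ^ p * ps * ph ^ p * (?P * ?T)
        + g^2 * h * g ^ (2 * p) * z ^ (p^3) * x ^ (2 * p^2) + g^2 * h * g ^ p * ps ^ p * x ^ (p^3))"
      unfolding F1_pow F2_pow G_def by (simp add: algebra_simps power2_eq_square)
    also have "\<dots> = - (g * g ^ p) * y ^ (p^3) * ?T * (a ^ p * ps) - g^2 * g ^ p * y ^ (p^3) * (?xx * E)
      + g^2 * ?P * (h * (a ^ p * ?D)^2)
      - (g^2 * ?P * (h * E^2) * (?xx * ?xx) + g * a ^ p * ps * ph ^ p * (?P * ?T)
        + g^2 * h * g ^ (2 * p) * z ^ (p^3) * x ^ (2 * p^2) + g^2 * h * g ^ p * ps ^ p * x ^ (p^3))"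
      unfolding sq by (subst Phi) (simp add: algebra_simps power2_eq_square)
    finally show ?thesis .
  qed
  have "?W dvd g^2 * ?P * (h * E^2) * (?xx * ?xx) + g * a ^ p * ps * ph ^ p * (?P * ?T)
        + g^2 * h * g ^ (2 * p) * z ^ (p^3) * x ^ (2 * p^2) + g^2 * h * g ^ p * ps ^ p * x ^ (p^3)"
    by (intro dvd_add dvd_mult[OF w3] dvd_mult[OF w2] dvd_mult[OF w1(1)] dvd_mult[OF w1(2)])
  then have 1: "cg ?W (a ^ p * F1 ^ (p + 2) - g^2 * F2 ^ p - 2 * a ^ p * x ^ (p^2 - 2 * p) * F1 ^ p * F2)
      (- (g * g ^ p) * y ^ (p^3) * ?T * (a ^ p * ps) - g^2 * g ^ p * y ^ (p^3) * (?xx * E)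
      + g^2 * ?P * (h * (a ^ p * ?D)^2))"
    unfolding eq by (rule cg_drop')
  have 2: "cg ?W (g^2 * ?P * (h * (a ^ p * ?D)^2)) (eps * ?xx * y ^ (p^3) * y ^ (p^2))"
  proof (cases "p = 3")
    case False
    then have "p \<ge> 5" using p3 by (cases "p = 4") auto
    then have "5 * p^2 \<le> p^3" by (simp add: p2')
    then have "?W dvd ?P" by (intro le_imp_power_dvd) simp
    then show ?thesis using False by (simp add: cg_def eps_def)
  next
    case True
    \<comment> \<open>Here delta^(p^2) is Y Y - X Z. Together with the X in front, every term of its
      square but Y^4 contains X^2 = x^(2p^2) and drops out.\<close>
    have alg: "g^2 * X * (h * (A * (Y * Y - X * Z))^2) - h * g^2 * A^2 * X * (Y * Y * (Y * Y)) =
        (g^2 * h * A^2 * (X * Z * Z - 2 * Y * Y * Z)) * (X * X)" for X A Y Z :: 'r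
      by (simp add: algebra_simps power2_eq_square)
    have "p^3 - 2 * p^2 = p^2" "p^3 + p^2 = p^2 + p^2 + (p^2 + p^2)" by (simp_all add: True)
    then have P: "?P = ?xx" "y ^ (p^3) * y ^ (p^2) = y ^ (p^2) * y ^ (p^2) * (y ^ (p^2) * y ^ (p^2))"
      by (simp_all only: flip: power_add)
    have eps: "eps = h * g^2 * (a ^ p)^2" unfolding eps_def by (rule if_P[OF True])
    have "eps * ?xx * y ^ (p^3) * y ^ (p^2) = h * g^2 * (a ^ p)^2 * ?xx * (y ^ (p^2) * y ^ (p^2) * (y ^ (p^2) * y ^ (p^2)))"
      unfolding eps P(2)[symmetric] by (simp only: mult.assoc)
    then show ?thesis unfolding cg_def dl_pow P(1) alg using dvd_mult[OF w3] by (simp only: alg)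
  qed
  have e: "x ^ (p^2) * x ^ (p^2 - p) = ?T * x ^ p" by (subst (1 2) powadd[OF refl], rule arg_cong[where f = "power x"]) (use p2 p3 in arith)
  have 3: "- (g * g ^ p) * y ^ (p^3) * ?T * (a ^ p * ps) - g^2 * g ^ p * y ^ (p^3) * (?xx * E)
      + eps * ?xx * y ^ (p^3) * y ^ (p^2) =
    - (g * g ^ p) * y ^ (p^3) * ?T * (a ^ p * ps + g * c ^ p * dl ^ p + g * d ^ p * x ^ p * y ^ p)
      + (eps - g^2 * g ^ p * b ^ p) * x ^ (p^2) * y ^ (p^3) * y ^ (p^2)"
  proof -
    have "?xx * E = ?xx * b ^ p * y ^ (p^2) + (?xx * x ^ (p^2 - 2 * p)) * c ^ p * dl ^ p + (?xx * x ^ (p^2 - p)) * d ^ p * y ^ p"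
      by (simp add: E_def algebra_simps)
    then show ?thesis unfolding e xq by (simp add: algebra_simps power2_eq_square)
  qed
  show ?thesis
    unfolding 3[symmetric] by (rule cg_trans[OF 1 cg_add[OF cg_refl 2]])
qed

text \<open>The choice of \<open>al2\<close> removes the term with x^(p^2) y^(p^3) y^(p^2), the only
  one in \<open>step1\<close> without the factor x^(2p^2 - 2p). From here on a precision of x^(2p -
  1) in the cofactor is enough.\<close>

lemma step2:
  assumes al2: "al2 * (g * g ^ p) = g^2 * g ^ p * b ^ p - eps"
  shows "cg (x ^ (2 * p^2 - 1)) (a ^ p * F1 ^ (p + 2) - g^2 * F2 ^ p - 2 * a ^ p * x ^ (p^2 - 2 * p) * F1 ^ p * F2
      + al2 * x ^ (p^2) * F1 ^ (p + 1))
    (x ^ (2 * p^2 - 2 * p) * (y ^ (p^3) * (al2 * g ^ p * ph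
      - g * g ^ p * (a ^ p * ps + g * c ^ p * dl ^ p + g * d ^ p * x ^ p * y ^ p))))"
proof -
  have n: "3 * p^2 \<le> p^3" using p3(1) by (simp add: p2')
  have "x ^ (2 * p^2 - 1) dvd x ^ (p^2) * x ^ (p^3 - 2 * p^2)"
    unfolding power_add[symmetric] by (rule le_imp_power_dvd) (use n in simp)
  then have "x ^ (2 * p^2 - 1) dvd al2 * ph ^ p * F1 * (x ^ (p^2) * x ^ (p^3 - 2 * p^2))"
    by (rule dvd_mult)
  moreover have "al2 * x ^ (p^2) * F1 ^ (p + 1) = al2 * (g * g ^ p) * x ^ (p^2) * y ^ (p^3) * y ^ (p^2)
      + al2 * g ^ p * (x ^ (p^2) * x ^ (p^2 - 2 * p)) * y ^ (p^3) * ph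
      + al2 * ph ^ p * F1 * (x ^ (p^2) * x ^ (p^3 - 2 * p^2))"
    unfolding power_add F1_pow by (subst (1) F1_def) (simp add: F1_def algebra_simps)
  ultimately have "cg (x ^ (2 * p^2 - 1)) (al2 * x ^ (p^2) * F1 ^ (p + 1)) (al2 * (g * g ^ p) * x ^ (p^2) * y ^ (p^3) * y ^ (p^2)
      + al2 * g ^ p * (x ^ (p^2) * x ^ (p^2 - 2 * p)) * y ^ (p^3) * ph)"
    by (simp add: cg_def)
  from cg_add[OF step1 this] show ?thesis
    unfolding al2 xq by (simp add: algebra_simps)
qed

text \<open>For p = 3 the exponent p^2 - 2p = 3 is below 2p - 1 = 5, so the part of
  \<open>F1 ^ (p - 1) * F2\<close> linear in x^(p^2 - 2p) counts: \<open>h\<close> comes from the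
  square of \<open>ph\<close> in \<open>F2\<close>, and 2 from the mixed term of
  \<open>F1 ^ 2\<close>.\<close>

definition "tt = (if p = 3 then g^2 * (h + 2) * a^2 else 0)"

lemma ph_cg: "cg (x ^ (p - 1)) ph (a * y ^ (2 * p))"
proof -
  have "ph = a * y ^ (2 * p) + (x ^ p * (b * y ^ p - a * z ^ p) + x ^ (2 * p - 2) * (c * dl) + x ^ (2 * p - 1) * (d * y))"
    unfolding ph_def dl_pow by (simp add: algebra_simps)
  then show ?thesis
  proof (rule ssubst, intro cg_drop)
    show "x ^ (p - 1) dvd x ^ p * (b * y ^ p - a * z ^ p) + x ^ (2 * p - 2) * (c * dl) + x ^ (2 * p - 1) * (d * y)"
      using p3 by (intro dvd_add dvd_mult2 le_imp_power_dvd) simp_all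
  qed
qed

lemma step3: "cg (x ^ (2 * p - 1)) (F1 ^ (p - 1) * F2) (y ^ (p^3) * (g ^ p * ph + tt * x ^ p * y ^ p))"
proof -
  let ?U = "x ^ (2 * p - 1)"
  have gy: "(g * y ^ (p^2)) ^ (p - 1) * (g * y ^ (p^2)) = g ^ p * y ^ (p^3)"
  proof -
    have "(g * y ^ (p^2)) ^ (p - 1) * (g * y ^ (p^2)) = (g * y ^ (p^2)) ^ p"
      using p3 by (cases p) (simp_all add: mult.commute)
    then show ?thesis by (simp add: power_mult_distrib p2' flip: power_mult) (simp add: mult_ac)
  qed
  have U: "?U dvd x ^ (2 * p)" "?U dvd x ^ (p^2)" using p2 by (auto intro!: le_imp_power_dvd)
  have F2: "cg ?U F2 (g * y ^ (p^2) * ph + h * x ^ (p^2 - 2 * p) * ph^2)"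
  proof -
    have "?U dvd x ^ (2 * p) * (h * g^2 * z ^ (p^2)) + x ^ (p^2) * (h * g * ps)"
      using U by (intro dvd_add dvd_mult2)
    moreover have "F2 = (g * y ^ (p^2) * ph + h * x ^ (p^2 - 2 * p) * ph^2) +
        (x ^ (2 * p) * (h * g^2 * z ^ (p^2)) + x ^ (p^2) * (h * g * ps))"
      unfolding F2_def by (simp add: algebra_simps)
    ultimately show ?thesis by (simp only: cg_drop)
  qed
  show ?thesis
  proof (cases "p = 3")
    case False
    then have "p \<ge> 5" using p3 by (cases "p = 4") auto
    then have "5 * p \<le> p^2" by (simp add: p2')
    then have Q: "?U dvd x ^ (p^2 - 2 * p)" by (intro le_imp_power_dvd) simp
    have "cg ?U F1 (g * y ^ (p^2))" unfolding F1_def using Q by (intro cg_drop dvd_mult2)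
    moreover have "cg ?U F2 (g * y ^ (p^2) * ph)"
    proof (rule cg_trans[OF F2 cg_drop])
      show "?U dvd h * x ^ (p^2 - 2 * p) * ph^2" using Q by (simp add: dvd_mult dvd_mult2)
    qed
    ultimately have "cg ?U (F1 ^ (p - 1) * F2) ((g * y ^ (p^2)) ^ (p - 1) * (g * y ^ (p^2) * ph))"
      by (intro cg_mult cg_power)
    also have "(g * y ^ (p^2)) ^ (p - 1) * (g * y ^ (p^2) * ph) = g ^ p * y ^ (p^3) * ph"
      unfolding gy[symmetric] by (simp only: mult.assoc)
    finally show ?thesis using False by (simp add: tt_def mult_ac)
  next
    case True
    have e: "p^2 - 2 * p = 3" "p - 1 = 2" "2 * p - 1 = 5" and e': "2 * p = 6" using True by simp_all
    \<comment> \<open>Because of the factor x^3 in front, \<open>ph\<close> has to be known only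
      modulo x^2, where it is a y^6.\<close>
    have "cg (x ^ 3 * x ^ 2) (x ^ 3 * ph^2) (x ^ 3 * (a * y ^ 6)^2)"
      using cg_scale[OF cg_power[OF ph_cg, of 2], of "x ^ 3"] unfolding e e' .
    then have sq: "cg (x ^ 5) (x ^ 3 * ph^2) (x ^ 3 * (a * y ^ 6)^2)" by (simp flip: power_add)
    have "cg (x ^ 5) (F1 ^ 2 * F2) (F1 ^ 2 * (g * y ^ (p^2) * ph + h * x ^ 3 * ph^2))"
      using F2 unfolding e by (intro cg_mult) auto
    also have "F1 ^ 2 * (g * y ^ (p^2) * ph + h * x ^ 3 * ph^2) =
        (g * y ^ (p^2)) ^ 3 * ph + g^2 * (h + 2) * (y ^ (p^2))^2 * (x ^ 3 * ph^2)
        + x ^ 5 * (x * ((2 * g * h + g) * y ^ (p^2) * ph ^ 3 + h * x ^ 3 * ph ^ 4))"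
    proof -
      have alg: "(g * Y + X * f) ^ 2 * (g * Y * f + h * X * f ^ 2) = (g * Y) ^ 3 * f + g^2 * (h + 2) * Y^2 * (X * f^2)
          + X * X * ((2 * g * h + g) * Y * f ^ 3 + h * X * f ^ 4)" for X Y f :: 'r
        by (simp add: eval_nat_numeral algebra_simps)
      have x: "x ^ 3 * x ^ 3 = x ^ 5 * x" by (simp flip: power_add power_Suc2)
      show ?thesis unfolding F1_def e alg x by (simp only: mult.assoc)
    qed
    finally have "cg (x ^ 5) (F1 ^ 2 * F2) ((g * y ^ (p^2)) ^ 3 * ph + g^2 * (h + 2) * (y ^ (p^2))^2 * (x ^ 3 * ph^2))"
      by (rule cg_trans) (rule cg_drop, simp)
    moreover have "cg (x ^ 5) ((g * y ^ (p^2)) ^ 3 * ph + g^2 * (h + 2) * (y ^ (p^2))^2 * (x ^ 3 * ph^2))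
       ((g * y ^ (p^2)) ^ 3 * ph + g^2 * (h + 2) * (y ^ (p^2))^2 * (x ^ 3 * (a * y ^ 6)^2))"
      by (intro cg_add cg_mult sq cg_refl)
    ultimately have "cg (x ^ 5) (F1 ^ 2 * F2) ((g * y ^ (p^2)) ^ 3 * ph + g^2 * (h + 2) * (y ^ (p^2))^2 * (x ^ 3 * (a * y ^ 6)^2))"
      by (rule cg_trans)
    moreover have "(g * y ^ (p^2)) ^ 3 * ph + g^2 * (h + 2) * (y ^ (p^2))^2 * (x ^ 3 * (a * y ^ 6)^2) =
        y ^ (p^3) * (g ^ p * ph + tt * x ^ p * y ^ p)"
    proof -
      have y: "(y ^ 9)\<^sup>2 * (y ^ 6)\<^sup>2 = y ^ 27 * y ^ 3" "(y ^ 9) ^ 3 = y ^ 27"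
        by (simp_all flip: power_mult power_add)
      have "(g * y ^ 9) ^ 3 * ph + g^2 * (h + 2) * (y ^ 9)^2 * (x ^ 3 * (a * y ^ 6)^2) =
        g ^ 3 * (y ^ 9) ^ 3 * ph + g^2 * (h + 2) * a^2 * x ^ 3 * ((y ^ 9)\<^sup>2 * (y ^ 6)\<^sup>2)"
        by (simp add: power_mult_distrib mult_ac)
      moreover have "p^2 = 9" "p^3 = 27" "x ^ p = x ^ 3" "y ^ p = y ^ 3" "g ^ p = g ^ 3" using True by simp_all
      moreover have "tt = g^2 * (h + 2) * a^2" unfolding tt_def by (rule if_P[OF True])
      ultimately show ?thesis unfolding y by (simp only: distrib_left mult_ac)
    qed
    ultimately show ?thesis unfolding e by simp
  qed
qed

text \<open>The exponents are those for which the power of \<open>y\<close> becomes p^2 (p - 1) + 2p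
  (p + 1)/2 = p^3 + p, as the term to be cancelled requires. The product will carry the factor
  x^(2p^2 - p), so precision x^(p - 1) suffices.\<close>

lemma step4: "cg (x ^ (p - 1)) (F1 ^ ((p - 3) div 2) * F2 ^ ((p + 1) div 2))
    (g ^ (p - 1) * a ^ ((p + 1) div 2) * y ^ (p^3) * y ^ p)"
proof -
  let ?U = "x ^ (p - 1)"
  have U: "?U dvd x ^ (p^2 - 2 * p)" "?U dvd x ^ (2 * p)" "?U dvd x ^ (p^2)"
    using p2 by (auto intro!: le_imp_power_dvd)
  have 1: "cg ?U F1 (g * y ^ (p^2))" unfolding F1_def using U by (intro cg_drop dvd_mult2)
  have "?U dvd x ^ (2 * p) * (h * g^2 * z ^ (p^2)) + x ^ (p^2 - 2 * p) * (h * ph^2) + x ^ (p^2) * (h * g * ps)"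
    using U by (intro dvd_add dvd_mult2)
  moreover have "F2 = g * y ^ (p^2) * ph +
      (x ^ (2 * p) * (h * g^2 * z ^ (p^2)) + x ^ (p^2 - 2 * p) * (h * ph^2) + x ^ (p^2) * (h * g * ps))"
    unfolding F2_def by (simp add: algebra_simps)
  ultimately have "cg ?U F2 (g * y ^ (p^2) * ph)" by (simp only: cg_drop)
  then have 2: "cg ?U F2 (g * y ^ (p^2) * (a * y ^ (2 * p)))"
    by (rule cg_trans) (intro cg_mult ph_cg cg_refl)
  obtain r where r: "p = 2 * r + 1" using p3(2) by (auto elim: oddE)
  have r0: "r \<ge> 1" using p r by simp
  have e: "(p - 3) div 2 = r - 1" "(p + 1) div 2 = r + 1" "p - 1 = (r - 1) + (r + 1)" using r r0 by simp_all
  have "(g * y ^ (p^2)) ^ (r - 1) * (g * y ^ (p^2) * (a * y ^ (2 * p))) ^ (r + 1) =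
      g ^ ((r - 1) + (r + 1)) * a ^ (r + 1) * ((y ^ (p^2)) ^ ((r - 1) + (r + 1)) * (y ^ (2 * p)) ^ (r + 1))"
    unfolding power_mult_distrib power_add by (simp only: mult_ac)
  also have "(y ^ (p^2)) ^ ((r - 1) + (r + 1)) * (y ^ (2 * p)) ^ (r + 1) = y ^ (p^3) * y ^ p"
  proof -
    have "p^2 * ((r - 1) + (r + 1)) + 2 * p * (r + 1) = p^3 + p"
    proof -
      have "(r - 1) + (r + 1) = 2 * r" using r0 by simp
      then have "p^2 * ((r - 1) + (r + 1)) + 2 * p * (r + 1) = p^2 * (2 * r) + p * (2 * r + 1) + p"
        by (simp add: algebra_simps)
      also have "p * (2 * r + 1) = p^2" using r by (simp add: power2_eq_square)
      also have "p^2 * (2 * r) + p^2 + p = p^2 * (2 * r + 1) + p" by (simp add: algebra_simps)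
      also have "\<dots> = p^3 + p" unfolding r[symmetric] by (simp add: power2_eq_square power3_eq_cube)
      finally show ?thesis .
    qed
    moreover have "(y ^ (p^2)) ^ ((r - 1) + (r + 1)) * (y ^ (2 * p)) ^ (r + 1) =
        y ^ (p^2 * ((r - 1) + (r + 1)) + 2 * p * (r + 1))"
      by (simp only: power_mult power_add)
    ultimately show ?thesis by (simp only: power_add)
  qed
  finally have "(g * y ^ (p^2)) ^ (r - 1) * (g * y ^ (p^2) * (a * y ^ (2 * p))) ^ (r + 1) =
      g ^ ((r - 1) + (r + 1)) * a ^ (r + 1) * y ^ (p^3) * y ^ p" by (simp only: mult.assoc)
  then show ?thesis
    using cg_mult[OF cg_power[OF 1, of "r - 1"] cg_power[OF 2, of "r + 1"]] unfolding e by simp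
qed

text \<open>Besides the factor x^(2p^2 - 2p) y^(p^3) a combination of delta^p, x^p y^p, x^(2p - 2)
  delta and x^(2p - 1) y remains. The equations for \<open>al3\<close> and \<open>al4\<close> make
  the first two coefficients zero, the last term vanishes modulo x^(2p - 1), and in the third delta
  may be replaced by y^2, being congruent to it modulo x.\<close>

lemma final_congruence:
  assumes al2: "al2 * (g * g ^ p) = g^2 * g ^ p * b ^ p - eps"
    and al3: "al3 * (g ^ p * a) = - (al2 * g ^ p * a - g * g ^ p * (a ^ p * a' + g * c ^ p))"
    and al4: "al4 * (g ^ (p - 1) * a ^ ((p + 1) div 2)) =
      - (al2 * g ^ p * b - g * g ^ p * (a ^ p * b' + g * d ^ p) + al3 * (g ^ p * b + tt))"
    and C: "C = al2 * g ^ p * c - g * g ^ p * (a ^ p * c') + al3 * (g ^ p * c)"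
  shows "cg (x ^ (2 * p^2 - 1)) (a ^ p * F1 ^ (p + 2) - g^2 * F2 ^ p - 2 * a ^ p * x ^ (p^2 - 2 * p) * F1 ^ p * F2
      + al2 * x ^ (p^2) * F1 ^ (p + 1) + al3 * x ^ (2 * p^2 - 2 * p) * (F1 ^ (p - 1) * F2)
      + al4 * x ^ (2 * p^2 - p) * (F1 ^ ((p - 3) div 2) * F2 ^ ((p + 1) div 2)))
    (C * x ^ (2 * p^2 - 2) * y ^ (p^3 + 2))"
proof -
  let ?W = "x ^ (2 * p^2 - 1)" and ?T = "x ^ (2 * p^2 - 2 * p)" and ?U = "x ^ (2 * p - 1)" and ?Y = "y ^ (p^3)"
  have W: "?T * ?U = ?W" by (rule xq)
  have T: "x ^ (2 * p^2 - p) = ?T * x ^ p" and U: "x ^ p * x ^ (p - 1) = ?U"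
    and T2: "?T * x ^ (2 * p - 2) = x ^ (2 * p^2 - 2)" and U2: "x ^ (2 * p - 2) * x = ?U"
  proof -
    show "x ^ (2 * p^2 - p) = ?T * x ^ p" by (rule powadd[symmetric]) (use p2 p3 in arith)
    show "x ^ p * x ^ (p - 1) = ?U" by (rule powadd) (use p3 in arith)
    show "?T * x ^ (2 * p - 2) = x ^ (2 * p^2 - 2)" by (rule powadd) (use p2 p3 in arith)
    show "x ^ (2 * p - 2) * x = ?U" using powadd[of "2 * p - 2" 1 "2 * p - 1" x] p3 by simp
  qed
  have s3: "cg ?W (al3 * ?T * (F1 ^ (p - 1) * F2)) (?T * (al3 * (?Y * (g ^ p * ph + tt * x ^ p * y ^ p))))"
    using cg_scale[OF cg_mult[OF cg_refl[of _ al3] step3], of ?T] unfolding W by (simp only: mult_ac)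
  have s4: "cg ?W (al4 * x ^ (2 * p^2 - p) * (F1 ^ ((p - 3) div 2) * F2 ^ ((p + 1) div 2)))
      (?T * (x ^ p * (al4 * (g ^ (p - 1) * a ^ ((p + 1) div 2) * ?Y * y ^ p))))"
    using cg_scale[OF cg_scale[OF cg_mult[OF cg_refl[of _ al4] step4], of "x ^ p"], of ?T]
    unfolding U W T by (simp only: mult_ac)
  note sum = cg_add[OF cg_add[OF step2[OF al2] s3] s4]
  have "(?T * (?Y * (al2 * g ^ p * ph - g * g ^ p * (a ^ p * ps + g * c ^ p * dl ^ p + g * d ^ p * x ^ p * y ^ p)))
      + ?T * (al3 * (?Y * (g ^ p * ph + tt * x ^ p * y ^ p)))
      + ?T * (x ^ p * (al4 * (g ^ (p - 1) * a ^ ((p + 1) div 2) * ?Y * y ^ p)))) =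
    ?T * ?Y * (dl ^ p * (al2 * g ^ p * a - g * g ^ p * (a ^ p * a' + g * c ^ p) + al3 * (g ^ p * a))
      + x ^ p * y ^ p * (al2 * g ^ p * b - g * g ^ p * (a ^ p * b' + g * d ^ p) + al3 * (g ^ p * b + tt)
        + al4 * (g ^ (p - 1) * a ^ ((p + 1) div 2)))
      + x ^ (2 * p - 2) * dl * C
      + ?U * y * (al2 * g ^ p * d - g * g ^ p * (a ^ p * d') + al3 * (g ^ p * d)))"
    unfolding ph_def ps_def C by (simp add: algebra_simps)
  also have "\<dots> = ?T * ?Y * (x ^ (2 * p - 2) * dl * C)
      + ?T * ?U * (?Y * y * (al2 * g ^ p * d - g * g ^ p * (a ^ p * d') + al3 * (g ^ p * d)))"
    unfolding al3 al4 by (simp add: algebra_simps)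
  also have "?T * ?Y * (x ^ (2 * p - 2) * dl * C) = C * (?T * x ^ (2 * p - 2)) * (?Y * y^2) - ?T * (x ^ (2 * p - 2) * x) * (?Y * z * C)"
    unfolding dl_def by (simp add: algebra_simps)
  also have "\<dots> = C * x ^ (2 * p^2 - 2) * y ^ (p^3 + 2) - ?W * (?Y * z * C)"
    unfolding T2 U2 W power_add by simp
  finally have "(?T * (?Y * (al2 * g ^ p * ph - g * g ^ p * (a ^ p * ps + g * c ^ p * dl ^ p + g * d ^ p * x ^ p * y ^ p)))
      + ?T * (al3 * (?Y * (g ^ p * ph + tt * x ^ p * y ^ p)))
      + ?T * (x ^ p * (al4 * (g ^ (p - 1) * a ^ ((p + 1) div 2) * ?Y * y ^ p)))) =
     C * x ^ (2 * p^2 - 2) * y ^ (p^3 + 2) + ?W * (?Y * y * (al2 * g ^ p * d - g * g ^ p * (a ^ p * d') + al3 * (g ^ p * d)) - ?Y * z * C)"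
    unfolding W by (simp add: algebra_simps)
  with sum show ?thesis by (simp only:) (erule cg_trans, rule cg_drop, simp)
qed

end

subsection \<open>The translation action\<close>

text \<open>Normalised so that \<open>delta\<close> is mapped to \<open>delta + v x\<^sup>2\<close>.\<close>

definition tr :: "'a::comm_ring_1 \<Rightarrow> 'a \<Rightarrow> (xyz, 'a) mpoly \<Rightarrow> (xyz, 'a) mpoly"
  where "tr c v = mpoly_eval (\<lambda>w. case w of
      X \<Rightarrow> mvar X
    | Y \<Rightarrow> mvar Y + mconst c * mvar X
    | Z \<Rightarrow> mvar Z + mconst (2 * c) * mvar Y + mconst (c ^ 2 - v) * mvar X)"

lemma alg_hom_tr: "alg_hom (tr c v)"
  unfolding tr_def by (rule alg_hom_mpoly_eval)

lemma tr_mvar [simp]: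
  "tr c v (mvar X) = mvar X" "tr c v (mvar Y) = mvar Y + mconst c * mvar X"
  "tr c v (mvar Z) = mvar Z + mconst (2 * c) * mvar Y + mconst (c ^ 2 - v) * mvar X"
  by (simp_all add: tr_def)

lemmas tr_simps = alg_hom_simps[OF alg_hom_tr]

lemma tr_tr: "tr c v (tr c' v' f) = tr (c + c') (v + v') f"
proof -
  have "(\<lambda>f. tr c v (tr c' v' f)) = tr (c + c') (v + v')"
  proof (rule alg_hom_eqI[OF alg_hom_comp[OF alg_hom_tr alg_hom_tr] alg_hom_tr])
    fix w show "tr c v (tr c' v' (mvar w)) = tr (c + c') (v + v') (mvar w)"
      by (cases w) (simp_all add: tr_simps mconst_add mconst_mult mconst_diff mconst_power algebra_simps power2_eq_square)
  qed
  then show ?thesis by metis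
qed

lemma tr_0: "tr 0 0 f = f"
proof -
  have "tr 0 0 = (\<lambda>f. f)"
    by (rule alg_hom_eqI[OF alg_hom_tr alg_hom_id]) (case_tac v; simp)
  then show ?thesis by metis
qed

lemma tr_delta: "tr c v delta = delta + mconst v * mvar X ^ 2"
  unfolding delta_def tr_simps tr_mvar
  by (simp add: mconst_mult mconst_diff mconst_power algebra_simps power2_eq_square)

lemma act_gen_tr: "act_gen M j = tr (entry M 1 j) (- entry M 2 j)"
  unfolding act_gen_def tr_def by (simp only: diff_minus_eq_add)

lemma act_gen_power: "(act_gen M j ^^ n) f = tr (of_nat n * entry M 1 j) (- (of_nat n * entry M 2 j)) f"
proof (induction n)
  case 0
  show ?case by (simp add: tr_0)
next
  case (Suc n)
  then show ?case by (simp add: act_gen_tr tr_tr algebra_simps)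
qed

text \<open>Row i of \<open>M\<close> as a homomorphism from (Z/p)^4 to the additive group of the
  field, in characteristic p.\<close>

definition lamv :: "'a::comm_ring_1 mat \<Rightarrow> nat \<Rightarrow> (nat \<Rightarrow> int) \<Rightarrow> 'a"
  where "lamv M i a = (\<Sum>j\<in>{1..4}. of_int (a j) * entry M i j)"

lemma act_tr:
  fixes M :: "'a::comm_ring_1 mat"
  assumes "\<And>j. j \<in> {1..4} \<Longrightarrow> a j \<ge> 0"
  shows "act M f a = tr (lamv M 1 a) (- lamv M 2 a) f"
proof -
  have s: "(\<Sum>j\<in>{1..4}. t j) = t 1 + t 2 + t 3 + t (4::nat)" for t :: "nat \<Rightarrow> 'a"
    by (simp add: numeral_eq_Suc)
  have n: "of_nat (nat (a j)) = (of_int (a j) :: 'a)" if "j \<in> {1..4}" for j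
    using assms[OF that] by (simp add: of_nat_nat)
  have cong: "tr u w f = tr u' w' f" if "u = u'" "w = w'" for u u' w w' :: 'a
    using that by simp
  show ?thesis
    unfolding act_def lamv_def s by (simp add: act_gen_power tr_tr n, rule cong; simp add: algebra_simps)
qed

section \<open>The finite group of translations\<close>

lemma solve_linear4:
  fixes g C :: "'a::field"
  assumes "g * C + s1 + s2 + s3 + s4 = 0" "g \<noteq> 0"
  shows "C = - (s1 / g) - s2 / g - s3 / g - s4 / g"
proof -
  have "g * C = - (s1 + s2 + s3 + s4)" using assms(1) by (simp only: eq_neg_iff_add_eq_0 add.assoc)
  then have "C = - (s1 + s2 + s3 + s4) / g"
    using assms(2) by (metis nonzero_mult_div_cancel_left)
  then show ?thesis by (simp add: add_divide_distrib diff_divide_distrib)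
qed

locale rank_four =
  fixes p :: nat and M :: "'a::field mat"
  assumes p: "prime p" "p > 2" and char: "CHAR('a) = p"
    and M: "M \<in> carrier_mat 2 4"
    and nz: "gam p M 1 2 3 4 \<noteq> 0" "gam p M 1 2 3 5 \<noteq> 0" "gam p M 1 3 5 7 \<noteq> 0"
begin

abbreviation "E \<equiv> carrier (E_group p)"

definition Lam :: "('a \<times> 'a) set"
  where "Lam = (\<lambda>a. (lamv M 1 a, - lamv M 2 a)) ` E"

lemma p3: "3 \<le> p" "odd p"
  using p prime_odd_nat by auto

lemma E_eq: "E = PiE {1..4} (\<lambda>_. {0..<int p})"
  using p by (simp add: E_group_def carrier_integer_mod_group)

lemma invariants_eq: "invariants p M = {f. \<forall>(c, v)\<in>Lam. tr c v f = f}"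
proof -
  have "act M f a = tr (lamv M 1 a) (- lamv M 2 a) f" if "a \<in> E" for a f
    using that unfolding E_eq by (intro act_tr) (auto simp: PiE_iff)
  then show ?thesis by (auto simp: invariants_def Lam_def)
qed

lemma of_int_mod_p: "(of_int (n mod int p) :: 'a) = of_int n"
proof -
  have "(of_int (int p) :: 'a) = 0" using of_nat_CHAR[where 'a = 'a] by (simp add: char)
  then have "(of_int (n div int p * int p) :: 'a) = 0" by (simp only: of_int_mult mult_zero_right)
  moreover have "n = n div int p * int p + n mod int p" by simp
  ultimately show ?thesis by (metis add_0 of_int_add)
qed

lemma Lam_add:
  assumes "(c, v) \<in> Lam" "(c', v') \<in> Lam"
  shows "(c + c', v + v') \<in> Lam"
proof -
  obtain a b where a: "a \<in> E" "c = lamv M 1 a" "v = - lamv M 2 a" and b: "b \<in> E" "c' = lamv M 1 b" "v' = - lamv M 2 b"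
    using assms by (auto simp: Lam_def)
  let ?s = "\<lambda>j\<in>{1..4}. (a j + b j) mod int p"
  have "?s \<in> E" using p by (auto simp: E_eq)
  moreover have "lamv M i ?s = lamv M i a + lamv M i b" for i
    by (simp add: lamv_def of_int_mod_p distrib_right sum.distrib)
  ultimately show ?thesis unfolding Lam_def a b
    by (intro image_eqI[of _ _ ?s]) auto
qed

lemma frob_of_int: "0 \<le> n \<Longrightarrow> (of_int n :: 'a) ^ p = of_int n"
  using frob_of_nat[OF p(1) char, of "nat n"] by (simp add: of_nat_nat)

text \<open>The coordinates of a group element lie in the prime field, so Frobenius fixes them and
  only moves the row.\<close>

lemma lam_grow:
  assumes "a \<in> E"
  shows "lamv M 1 a ^ (p ^ i) = (\<Sum>j<4. of_int (a (Suc j)) * grow p M (2 * i + 1) j)"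
    "lamv M 2 a ^ (p ^ i) = (\<Sum>j<4. of_int (a (Suc j)) * grow p M (2 * i + 2) j)"
proof -
  have n: "0 \<le> a (Suc j)" if "j < 4" for j
    using assms that by (auto simp: E_eq PiE_iff)
  have l: "lamv M k a = (\<Sum>j<4. of_int (a (Suc j)) * grow p M k j)" if "k = 1 \<or> k = 2" for k
  proof -
    have "{1..4} = Suc ` {..<4}" by (simp add: image_Suc_lessThan)
    then have "lamv M k a = (\<Sum>j<4. of_int (a (Suc j)) * entry M k (Suc j))"
      unfolding lamv_def by (simp add: sum.reindex)
    also have "\<dots> = (\<Sum>j<4. of_int (a (Suc j)) * grow p M k j)"
      using that by (intro sum.cong) (auto simp: entry_def grow_def)
    finally show ?thesis .
  qed
  have step: "(\<Sum>j<4. of_int (a (Suc j)) * grow p M k j) ^ p = (\<Sum>j<4. of_int (a (Suc j)) * grow p M (k + 2) j)"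
    if "k \<ge> 1" for k
  proof -
    have "(\<Sum>j<4. of_int (a (Suc j)) * grow p M k j) ^ p = (\<Sum>j<4. (of_int (a (Suc j)) * grow p M k j) ^ p)"
      by (rule freshmans_dream_sum) (simp_all add: char p)
    also have "\<dots> = (\<Sum>j<4. of_int (a (Suc j)) * grow p M (k + 2) j)"
      using that n by (intro sum.cong) (simp_all add: power_mult_distrib frob_of_int frob_grow[OF p(1) char])
    finally show ?thesis .
  qed
  show "lamv M 1 a ^ (p ^ i) = (\<Sum>j<4. of_int (a (Suc j)) * grow p M (2 * i + 1) j)"
  proof (induction i)
    case (Suc i)
    have eq: "lamv M 1 a ^ (p ^ Suc i) = (lamv M 1 a ^ (p ^ i)) ^ p"
      by (simp add: mult.commute flip: power_mult)
    have e: "2 * Suc i + 1 = 2 * i + 1 + 2" by simp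
    show ?case unfolding eq Suc e by (rule step) simp
  qed (simp add: l)
  show "lamv M 2 a ^ (p ^ i) = (\<Sum>j<4. of_int (a (Suc j)) * grow p M (2 * i + 2) j)"
  proof (induction i)
    case (Suc i)
    have eq: "lamv M 2 a ^ (p ^ Suc i) = (lamv M 2 a ^ (p ^ i)) ^ p"
      by (simp add: mult.commute flip: power_mult)
    have e: "2 * Suc i + 2 = 2 * i + 2 + 2" by simp
    show ?case unfolding eq Suc e by (rule step) simp
  qed (simp add: l numeral_2_eq_2[symmetric])
qed

lemma lam_grow_low:
  assumes "a \<in> E"
  shows "lamv M 1 a = (\<Sum>j<4. of_int (a (Suc j)) * grow p M 1 j)" "lamv M 2 a = (\<Sum>j<4. of_int (a (Suc j)) * grow p M 2 j)"
    "lamv M 1 a ^ p = (\<Sum>j<4. of_int (a (Suc j)) * grow p M 3 j)" "lamv M 2 a ^ p = (\<Sum>j<4. of_int (a (Suc j)) * grow p M 4 j)"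
    "lamv M 1 a ^ (p^2) = (\<Sum>j<4. of_int (a (Suc j)) * grow p M 5 j)" "lamv M 2 a ^ (p^2) = (\<Sum>j<4. of_int (a (Suc j)) * grow p M 6 j)"
proof -
  have n: "2 * 0 + 1 = (1::nat)" "2 * 0 + 2 = (2::nat)" "2 * 1 + 1 = (3::nat)" "2 * 1 + 2 = (4::nat)"
    "2 * 2 + 1 = (5::nat)" "2 * 2 + 2 = (6::nat)" by simp_all
  note l = lam_grow[OF assms, of 0, unfolded n power_0 power_one_right]
    lam_grow[OF assms, of 1, unfolded n power_one_right] lam_grow[OF assms, of 2, unfolded n]
  show "lamv M 1 a = (\<Sum>j<4. of_int (a (Suc j)) * grow p M 1 j)" "lamv M 2 a = (\<Sum>j<4. of_int (a (Suc j)) * grow p M 2 j)"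
    "lamv M 1 a ^ p = (\<Sum>j<4. of_int (a (Suc j)) * grow p M 3 j)" "lamv M 2 a ^ p = (\<Sum>j<4. of_int (a (Suc j)) * grow p M 4 j)"
    "lamv M 1 a ^ (p^2) = (\<Sum>j<4. of_int (a (Suc j)) * grow p M 5 j)" "lamv M 2 a ^ (p^2) = (\<Sum>j<4. of_int (a (Suc j)) * grow p M 6 j)"
    by (fact l)+
qed

lemma cramer_sum:
  assumes "{i, j, k, l, m} \<subseteq> {1..10}"
  shows "gam p M i j k l * (\<Sum>s<4. t s * grow p M m s) - gam p M i j k m * (\<Sum>s<4. t s * grow p M l s)
    + gam p M i j l m * (\<Sum>s<4. t s * grow p M k s) - gam p M i k l m * (\<Sum>s<4. t s * grow p M j s)
    + gam p M j k l m * (\<Sum>s<4. t s * grow p M i s) = 0"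
proof -
  have "gam p M i j k l * (\<Sum>s<4. t s * grow p M m s) - gam p M i j k m * (\<Sum>s<4. t s * grow p M l s)
    + gam p M i j l m * (\<Sum>s<4. t s * grow p M k s) - gam p M i k l m * (\<Sum>s<4. t s * grow p M j s)
    + gam p M j k l m * (\<Sum>s<4. t s * grow p M i s) =
    (\<Sum>s<4. t s * (gam p M i j k l * grow p M m s - gam p M i j k m * grow p M l s
      + gam p M i j l m * grow p M k s - gam p M i k l m * grow p M j s + gam p M j k l m * grow p M i s))"
    by (simp add: sum_distrib_left sum_subtractf sum.distrib algebra_simps)
  also have "\<dots> = 0"
  proof (rule sum.neutral, rule ballI)
    fix s :: nat assume "s \<in> {..<4}"
    then have "gam p M i j k l * grow p M m s - gam p M i j k m * grow p M l s
      + gam p M i j l m * grow p M k s - gam p M i k l m * grow p M j s + gam p M j k l m * grow p M i s = 0"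
      using det4_cramer[of s "grow p M i" "grow p M j" "grow p M k" "grow p M l" "grow p M m"] assms
      by (simp add: gam_eq_det4)
    then show "t s * (gam p M i j k l * grow p M m s - gam p M i j k m * grow p M l s
      + gam p M i j l m * grow p M k s - gam p M i k l m * grow p M j s + gam p M j k l m * grow p M i s) = 0"
      by simp
  qed
  finally show ?thesis .
qed

text \<open>Rows 1 to 6, paired with the coordinates of the group element, give c, -v, c^p, -v^p,
  c^(p^2), -v^(p^2), since \<open>p\<close> is odd. The relations are Cramer's for the rows 1 to 5
  and for 1, 2, 3, 4, 6; they are what makes \<open>fbar1\<close> and \<open>fbar12346\<close>
  invariant.\<close>

lemma Lam_relations:
  assumes "(c, v) \<in> Lam"
  shows "gam p M 1 2 3 4 * c ^ (p^2) + gam p M 1 2 3 5 * v ^ p + gam p M 1 2 4 5 * c ^ p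
      + gam p M 1 3 4 5 * v + gam p M 2 3 4 5 * c = 0" (is ?A)
    and "- gam p M 1 2 3 4 * v ^ (p^2) + gam p M 1 2 3 6 * v ^ p + gam p M 1 2 4 6 * c ^ p
      + gam p M 1 3 4 6 * v + gam p M 2 3 4 6 * c = 0" (is ?B)
proof -
  obtain a where a: "a \<in> E" "c = lamv M 1 a" "v = - lamv M 2 a" using assms by (auto simp: Lam_def)
  let ?S = "\<lambda>k. \<Sum>j<4. of_int (a (Suc j)) * grow p M k j"
  have odd: "odd p" "odd (p^2)" using p3 by simp_all
  have e: "c = ?S 1" "v = - ?S 2" "c ^ p = ?S 3" "v ^ p = - ?S 4" "c ^ (p^2) = ?S 5" "v ^ (p^2) = - ?S 6"
    using lam_grow_low[OF a(1)] odd by (simp_all add: a)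
  show ?A using cramer_sum[of 1 2 3 4 5 "\<lambda>j. of_int (a (Suc j))"] unfolding e(3-6) unfolding e(1,2) by (simp add: algebra_simps)
  show ?B using cramer_sum[of 1 2 3 4 6 "\<lambda>j. of_int (a (Suc j))"] unfolding e(3-6) unfolding e(1,2) by (simp add: algebra_simps)
qed

text \<open>The difference of two coordinate vectors with the same image is orthogonal to rows 1 and
  2, and by Frobenius to rows 3 and 4, so the nonzero minor forces it to vanish modulo
  \<open>p\<close>.\<close>

lemma lamv_inj: "inj_on (\<lambda>a. (lamv M 1 a, - lamv M 2 a)) E"
proof (rule inj_onI)
  fix a b assume ab: "a \<in> E" "b \<in> E" "(lamv M 1 a, - lamv M 2 a) = (lamv M 1 b, - lamv M 2 b)"
  then have l: "lamv M 1 a = lamv M 1 b" "lamv M 2 a = lamv M 2 b" by simp_all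
  define n where "n j = (of_int (a (Suc j)) - of_int (b (Suc j)) :: 'a)" for j
  have n: "(\<Sum>j<4. n j * grow p M k j) = 0" if k: "k \<in> {1, 2, 3, 4}" for k
  proof -
    have d: "(\<Sum>j<4. n j * grow p M k j) = (\<Sum>j<4. of_int (a (Suc j)) * grow p M k j) - (\<Sum>j<4. of_int (b (Suc j)) * grow p M k j)"
      by (simp add: n_def left_diff_distrib sum_subtractf)
    show ?thesis
      unfolding d using k by (auto simp only: lam_grow_low[OF ab(1), symmetric] lam_grow_low[OF ab(2), symmetric] l
          insert_iff empty_iff diff_self)
  qed
  have s4: "(\<Sum>j<4. t j) = t 0 + t 1 + t 2 + t (3::nat)" for t :: "nat \<Rightarrow> 'a"
    by (simp add: eval_nat_numeral)
  have "det4 (grow p M 1) (grow p M 2) (grow p M 3) (grow p M 4) * n j = 0" if "j < 4" for j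
    by (rule det4_kernel[OF _ that]) (use n in \<open>auto simp: s4\<close>)
  moreover have "det4 (grow p M 1) (grow p M 2) (grow p M 3) (grow p M 4) \<noteq> 0"
    using nz(1) by (simp add: gam_eq_det4)
  ultimately have n0: "n j = 0" if "j < 4" for j using that by auto
  have eq: "a j = b j" if j: "j \<in> {1..4}" for j
  proof -
    have "n (j - 1) = 0" using n0 j by auto
    moreover have "Suc (j - 1) = j" using j by auto
    ultimately have "of_int (a j - b j) = (0 :: 'a)" by (simp add: n_def)
    then have dvd: "int p dvd a j - b j"
      using of_int_eq_0_iff_char_dvd[where 'a = 'a, of "a j - b j"] by (simp add: char)
    have "a j = a j mod int p" using ab(1) j by (auto simp: E_eq PiE_iff)
    also have "\<dots> = b j mod int p" using dvd by (simp only: mod_eq_dvd_iff)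
    also have "\<dots> = b j" using ab(2) j by (auto simp: E_eq PiE_iff)
    finally show ?thesis .
  qed
  show "a = b"
    by (rule PiE_ext[OF ab(1)[unfolded E_eq] ab(2)[unfolded E_eq]]) (rule eq)
qed

lemma card_Lam: "card Lam = p ^ 4" "finite Lam"
proof -
  have "card E = p ^ 4" by (simp add: E_eq card_PiE)
  then show "card Lam = p ^ 4" unfolding Lam_def card_image[OF lamv_inj] .
  show "finite Lam" unfolding Lam_def E_eq by (intro finite_imageI finite_PiE) auto
qed


subsection \<open>Interpolation on the translation group\<close>

text \<open>The bound p^2 on both exponents leaves p^4 monomials, as many as there are points in
  \<open>Lam\<close>.\<close>

definition interp :: "('a \<times> 'a \<Rightarrow> 'a) \<Rightarrow> bool"
  where "interp f \<longleftrightarrow> (\<exists>u. \<forall>c v. (c, v) \<in> Lam \<longrightarrow> f (c, v) = (\<Sum>j<p^2. \<Sum>k<p^2. u j k * (c ^ j * v ^ k)))"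

lemma interp_add: "interp f \<Longrightarrow> interp g \<Longrightarrow> interp (\<lambda>l. f l + g l)"
proof -
  assume "interp f" "interp g"
  then obtain u u' where "\<forall>c v. (c, v) \<in> Lam \<longrightarrow> f (c, v) = (\<Sum>j<p^2. \<Sum>k<p^2. u j k * (c ^ j * v ^ k))"
    "\<forall>c v. (c, v) \<in> Lam \<longrightarrow> g (c, v) = (\<Sum>j<p^2. \<Sum>k<p^2. u' j k * (c ^ j * v ^ k))"
    unfolding interp_def by blast
  then show ?thesis unfolding interp_def
    by (intro exI[of _ "\<lambda>j k. u j k + u' j k"]) (auto simp: distrib_right sum.distrib)
qed

lemma interp_scale: "interp f \<Longrightarrow> interp (\<lambda>l. s * f l)"
proof -
  assume "interp f"
  then obtain u where "\<forall>c v. (c, v) \<in> Lam \<longrightarrow> f (c, v) = (\<Sum>j<p^2. \<Sum>k<p^2. u j k * (c ^ j * v ^ k))"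
    unfolding interp_def by blast
  then show ?thesis unfolding interp_def
    by (intro exI[of _ "\<lambda>j k. s * u j k"]) (auto simp: sum_distrib_left mult.assoc)
qed

lemma interp_cong: "interp f \<Longrightarrow> (\<And>c v. (c, v) \<in> Lam \<Longrightarrow> f (c, v) = g (c, v)) \<Longrightarrow> interp g"
  unfolding interp_def by fastforce

lemma interp_sum: "(\<And>i. i \<in> A \<Longrightarrow> interp (f i)) \<Longrightarrow> interp (\<lambda>l. \<Sum>i\<in>A. f i l)"
proof (induction A rule: infinite_finite_induct)
  case (insert i A)
  then show ?case by (simp add: interp_add)
qed (simp_all add: interp_def, (intro exI[of _ "\<lambda>_ _. 0"], simp)+)

text \<open>With c and v of weights 1 and 2, \<open>Lam_relations\<close> replaces c^(p^2) and
  v^(p^2) by terms of weight at most 2p, which is less than p^2. So the weight j + 2k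
  decreases.\<close>

lemma interp_monomial: "interp (\<lambda>(c, v). c ^ j * v ^ k)"
proof (induction "j + 2 * k" arbitrary: j k rule: less_induct)
  case less
  let ?g = "gam p M 1 2 3 4"
  have p2: "3 * p \<le> p^2" using p3(1) by (simp add: power2_eq_square)
  consider "j < p^2" "k < p^2" | "p^2 \<le> j" | "p^2 \<le> k" by linarith
  then show ?case
  proof cases
    case 1
    have "c ^ j * v ^ k = (\<Sum>j'<p^2. \<Sum>k'<p^2. (if j' = j then if k' = k then 1 else 0 else 0) * (c ^ j' * v ^ k'))" for c v :: 'a
    proof -
      have "(\<Sum>j'<p^2. \<Sum>k'<p^2. (if j' = j then if k' = k then 1 else 0 else 0) * (c ^ j' * v ^ k')) =
          (\<Sum>j'<p^2. if j' = j then c ^ j' * v ^ k else 0)"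
        using 1 by (intro sum.cong refl) (simp add: if_distrib[of "\<lambda>t. t * _"] cong: if_cong)
      then show ?thesis using 1 by simp
    qed
    then show ?thesis unfolding interp_def
      by (intro exI[of _ "\<lambda>j' k'. if j' = j then if k' = k then 1 else 0 else 0"]) simp
  next
    case 2
    define i where "i = j - p^2"
    have j: "j = i + p^2" using 2 by (simp add: i_def)
    have ih: "interp (\<lambda>(c, v). c ^ j' * v ^ k')" if "j' + 2 * k' < j + 2 * k" for j' k'
      using less.hyps[OF that] .
    have "interp (\<lambda>l. - (gam p M 1 2 3 5 / ?g) * (case l of (c, v) \<Rightarrow> c ^ i * v ^ (k + p))
      + - (gam p M 1 2 4 5 / ?g) * (case l of (c, v) \<Rightarrow> c ^ (i + p) * v ^ k)
      + - (gam p M 1 3 4 5 / ?g) * (case l of (c, v) \<Rightarrow> c ^ i * v ^ (k + 1))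
      + - (gam p M 2 3 4 5 / ?g) * (case l of (c, v) \<Rightarrow> c ^ (i + 1) * v ^ k))"
      using p2 p3 by (intro interp_add interp_scale ih) (simp_all add: j)
    then show ?thesis
    proof (rule interp_cong)
      fix c v assume "(c, v) \<in> Lam"
      note C = solve_linear4[OF Lam_relations(1)[OF this] nz(1)]
      show "- (gam p M 1 2 3 5 / ?g) * (case (c, v) of (c, v) \<Rightarrow> c ^ i * v ^ (k + p))
      + - (gam p M 1 2 4 5 / ?g) * (case (c, v) of (c, v) \<Rightarrow> c ^ (i + p) * v ^ k)
      + - (gam p M 1 3 4 5 / ?g) * (case (c, v) of (c, v) \<Rightarrow> c ^ i * v ^ (k + 1))
      + - (gam p M 2 3 4 5 / ?g) * (case (c, v) of (c, v) \<Rightarrow> c ^ (i + 1) * v ^ k) =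
        (case (c, v) of (c, v) \<Rightarrow> c ^ j * v ^ k)"
        unfolding j power_add C prod.case by (simp add: algebra_simps)
    qed
  next
    case 3
    define i where "i = k - p^2"
    have k: "k = i + p^2" using 3 by (simp add: i_def)
    have ih: "interp (\<lambda>(c, v). c ^ j' * v ^ k')" if "j' + 2 * k' < j + 2 * k" for j' k'
      using less.hyps[OF that] .
    have "interp (\<lambda>l. (gam p M 1 2 3 6 / ?g) * (case l of (c, v) \<Rightarrow> c ^ j * v ^ (i + p))
      + (gam p M 1 2 4 6 / ?g) * (case l of (c, v) \<Rightarrow> c ^ (j + p) * v ^ i)
      + (gam p M 1 3 4 6 / ?g) * (case l of (c, v) \<Rightarrow> c ^ j * v ^ (i + 1))
      + (gam p M 2 3 4 6 / ?g) * (case l of (c, v) \<Rightarrow> c ^ (j + 1) * v ^ i))"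
      using p2 p3 by (intro interp_add interp_scale ih) (simp_all add: k)
    then show ?thesis
    proof (rule interp_cong)
      fix c v assume "(c, v) \<in> Lam"
      have C: "v ^ (p^2) = - (gam p M 1 2 3 6 * v ^ p / - ?g) - gam p M 1 2 4 6 * c ^ p / - ?g
          - gam p M 1 3 4 6 * v / - ?g - gam p M 2 3 4 6 * c / - ?g"
        by (rule solve_linear4[OF Lam_relations(2)[OF \<open>(c, v) \<in> Lam\<close>]]) (use nz(1) in simp)
      show "(gam p M 1 2 3 6 / ?g) * (case (c, v) of (c, v) \<Rightarrow> c ^ j * v ^ (i + p))
      + (gam p M 1 2 4 6 / ?g) * (case (c, v) of (c, v) \<Rightarrow> c ^ (j + p) * v ^ i)
      + (gam p M 1 3 4 6 / ?g) * (case (c, v) of (c, v) \<Rightarrow> c ^ j * v ^ (i + 1))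
      + (gam p M 2 3 4 6 / ?g) * (case (c, v) of (c, v) \<Rightarrow> c ^ (j + 1) * v ^ i) =
        (case (c, v) of (c, v) \<Rightarrow> c ^ j * v ^ k)"
        unfolding k power_add C prod.case by (simp add: algebra_simps)
    qed
  qed
qed

lemma interp_mult_fst: "interp f \<Longrightarrow> interp (\<lambda>l. fst l * f l)"
  and interp_mult_snd: "interp f \<Longrightarrow> interp (\<lambda>l. snd l * f l)"
proof -
  assume "interp f"
  then obtain u where u: "\<forall>c v. (c, v) \<in> Lam \<longrightarrow> f (c, v) = (\<Sum>j<p^2. \<Sum>k<p^2. u j k * (c ^ j * v ^ k))"
    unfolding interp_def by blast
  have "interp (\<lambda>l. \<Sum>j<p^2. \<Sum>k<p^2. u j k * (case l of (c, v) \<Rightarrow> c ^ Suc j * v ^ k))"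
    by (intro interp_sum interp_scale interp_monomial)
  then show "interp (\<lambda>l. fst l * f l)"
    by (rule interp_cong) (use u in \<open>auto simp: sum_distrib_left mult_ac\<close>)
  have "interp (\<lambda>l. \<Sum>j<p^2. \<Sum>k<p^2. u j k * (case l of (c, v) \<Rightarrow> c ^ j * v ^ Suc k))"
    by (intro interp_sum interp_scale interp_monomial)
  then show "interp (\<lambda>l. snd l * f l)"
    by (rule interp_cong) (use u in \<open>auto simp: sum_distrib_left mult_ac\<close>)
qed

text \<open>Multiply, over the other points, affine functions that are 1 at \<open>l0\<close> and 0
  at the point, each in a coordinate where the two differ. The degree of the product may be large,
  but interpolable functions are closed under multiplication by the coordinates.\<close>

lemma interp_indicator:
  assumes "l0 \<in> Lam"
  shows "interp (\<lambda>l. if l = l0 then 1 else 0)"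
proof -
  define e where "e \<mu> l = (if fst \<mu> \<noteq> fst l0 then (fst l - fst \<mu>) / (fst l0 - fst \<mu>)
    else (snd l - snd \<mu>) / (snd l0 - snd \<mu>))" for \<mu> l :: "'a \<times> 'a"
  have "interp (\<lambda>l. \<Prod>\<mu>\<in>T. e \<mu> l)" if "finite T" for T
    using that
  proof (induction T rule: finite_induct)
    case empty
    show ?case using interp_monomial[of 0 0] by (simp add: case_prod_unfold)
  next
    case (insert \<mu> T)
    let ?f = "\<lambda>l. \<Prod>\<mu>\<in>T. e \<mu> l"
    have "interp (\<lambda>l. s * (fst l * ?f l) + t * ?f l)" "interp (\<lambda>l. s * (snd l * ?f l) + t * ?f l)" for s t
      using insert.IH by (intro interp_add interp_scale interp_mult_fst interp_mult_snd; simp)+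
    from this(1)[of "1 / (fst l0 - fst \<mu>)" "- fst \<mu> / (fst l0 - fst \<mu>)"]
      this(2)[of "1 / (snd l0 - snd \<mu>)" "- snd \<mu> / (snd l0 - snd \<mu>)"]
    have "interp (\<lambda>l. e \<mu> l * ?f l)"
      by (cases "fst \<mu> \<noteq> fst l0") (auto simp: e_def diff_divide_distrib left_diff_distrib elim: interp_cong)
    then show ?case using insert.hyps by simp
  qed
  from this[of "Lam - {l0}"] have "interp (\<lambda>l. \<Prod>\<mu>\<in>Lam - {l0}. e \<mu> l)" using card_Lam(2) by simp
  then show ?thesis
  proof (rule interp_cong)
    fix c v assume l: "(c, v) \<in> Lam"
    show "(\<Prod>\<mu>\<in>Lam - {l0}. e \<mu> (c, v)) = (if (c, v) = l0 then 1 else 0)"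
    proof (cases "(c, v) = l0")
      case True
      have "e \<mu> l0 = 1" if "\<mu> \<in> Lam - {l0}" for \<mu>
        using that by (auto simp: e_def prod_eq_iff)
      then show ?thesis using True by simp
    next
      case False
      have "e (c, v) (c, v) = 0" by (simp add: e_def)
      then show ?thesis using False l card_Lam(2) by (auto intro!: prod_zero)
    qed
  qed
qed

text \<open>The square matrix of the values of the monomials on \<open>Lam\<close> has a right inverse by
  interpolation, hence a left inverse.\<close>

lemma extraction:
  obtains W where "\<And>j k s t. j < p^2 \<Longrightarrow> k < p^2 \<Longrightarrow> s < p^2 \<Longrightarrow> t < p^2 \<Longrightarrow>
    (\<Sum>(c, v)\<in>Lam. W j k (c, v) * (c ^ s * v ^ t)) = (if s = j \<and> t = k then 1 else 0 :: 'a)"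
proof -
  let ?n = "p ^ 4" and ?I = "{..<p^2} \<times> {..<p^2}"
  have "card ?I = ?n" by (simp add: card_cartesian_product flip: power_add)
  then obtain bI where bI: "bij_betw bI {0..<?n} ?I"
    using ex_bij_betw_nat_finite[of ?I] by auto
  obtain bL where bL: "bij_betw bL {0..<?n} Lam"
    using ex_bij_betw_nat_finite[OF card_Lam(2)] card_Lam(1) by auto
  define val where "val l i = (fst l ^ fst i * snd l ^ snd i)" for l :: "'a \<times> 'a" and i :: "nat \<times> nat"
  have "\<exists>u. \<forall>l\<in>Lam. (\<Sum>i\<in>?I. val l i * u i) = (if l = l0 then 1 else 0)" if l0: "l0 \<in> Lam" for l0
  proof -
    obtain u where u: "\<forall>c v. (c, v) \<in> Lam \<longrightarrow> (if (c, v) = l0 then 1 else 0) = (\<Sum>j<p^2. \<Sum>k<p^2. u j k * (c ^ j * v ^ k))"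
      using interp_indicator[OF l0] unfolding interp_def by blast
    have "(\<Sum>i\<in>?I. val l i * (case i of (j, k) \<Rightarrow> u j k)) = (if l = l0 then 1 else 0)" if "l \<in> Lam" for l
      using u that by (cases l) (auto simp: val_def sum.cartesian_product case_prod_unfold mult_ac)
    then show ?thesis by blast
  qed
  then obtain u where u: "\<And>l0 l. l0 \<in> Lam \<Longrightarrow> l \<in> Lam \<Longrightarrow> (\<Sum>i\<in>?I. val l i * u l0 i) = (if l = l0 then 1 else 0)"
    by metis
  \<comment> \<open>In \<open>A\<close> rows are points and columns are monomials; the columns of
    \<open>B\<close> hold the coefficients of the indicator functions.\<close>
  define A where "A = mat ?n ?n (\<lambda>(r, s). val (bL r) (bI s))"
  define B where "B = mat ?n ?n (\<lambda>(r, s). u (bL s) (bI r))"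
  have AB: "A * B = 1\<^sub>m ?n"
  proof (rule eq_matI)
    fix r s assume rs: "r < dim_row (1\<^sub>m ?n :: 'a mat)" "s < dim_col (1\<^sub>m ?n :: 'a mat)"
    have L: "bL r \<in> Lam" "bL s \<in> Lam" using rs bij_betwE[OF bL] by auto
    have "(A * B) $$ (r, s) = (\<Sum>t\<in>{0..<?n}. val (bL r) (bI t) * u (bL s) (bI t))"
      using rs by (simp add: A_def B_def scalar_prod_def)
    also have "\<dots> = (\<Sum>i\<in>?I. val (bL r) i * u (bL s) i)"
      by (rule sum.reindex_bij_betw[OF bI, of "\<lambda>i. val (bL r) i * u (bL s) i"])
    also have "\<dots> = (if bL r = bL s then 1 else 0)" by (rule u[OF L(2,1)])
    also have "\<dots> = 1\<^sub>m ?n $$ (r, s)"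
      using rs bij_betw_imp_inj_on[OF bL] by (auto simp: inj_on_def)
    finally show "(A * B) $$ (r, s) = 1\<^sub>m ?n $$ (r, s)" .
  qed (simp_all add: A_def B_def)
  have BA: "B * A = 1\<^sub>m ?n"
    by (rule mat_mult_left_right_inverse[OF _ _ AB]) (simp_all add: A_def B_def)
  define iI where "iI = inv_into {0..<?n} bI"
  have iI: "iI i < ?n" "bI (iI i) = i" if "i \<in> ?I" for i
    using that bI unfolding iI_def bij_betw_def
    by (metis atLeastLessThan_iff inv_into_into, metis f_inv_into_f)
  define W where "W j k l = u l (j, k)" for j k l
  have "(\<Sum>(c, v)\<in>Lam. W j k (c, v) * (c ^ s * v ^ t)) = (if s = j \<and> t = k then 1 else 0)"
    if jk: "j < p^2" "k < p^2" "s < p^2" "t < p^2" for j k s t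
  proof -
    have I: "(j, k) \<in> ?I" "(s, t) \<in> ?I" using jk by auto
    have "(\<Sum>(c, v)\<in>Lam. W j k (c, v) * (c ^ s * v ^ t)) = (\<Sum>l\<in>Lam. u l (j, k) * val l (s, t))"
      by (simp add: W_def val_def case_prod_unfold)
    also have "\<dots> = (\<Sum>r\<in>{0..<?n}. u (bL r) (j, k) * val (bL r) (s, t))"
      by (rule sum.reindex_bij_betw[OF bL, of "\<lambda>l. u l (j, k) * val l (s, t)", symmetric])
    also have "\<dots> = (B * A) $$ (iI (j, k), iI (s, t))"
      using iI[OF I(1)] iI[OF I(2)] by (simp add: A_def B_def scalar_prod_def)
    also have "\<dots> = (if iI (j, k) = iI (s, t) then 1 else 0)"
      unfolding BA using iI[OF I(1)] iI[OF I(2)] by simp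
    also have "\<dots> = (if s = j \<and> t = k then 1 else 0)"
    proof -
      have "iI (j, k) = iI (s, t) \<longleftrightarrow> s = j \<and> t = k"
        by (metis iI(2)[OF I(1)] iI(2)[OF I(2)] prod.inject)
      then show ?thesis by simp
    qed
    finally show ?thesis .
  qed
  then show thesis using that by blast
qed

end

subsection \<open>Invariants after inverting \<open>x\<close>\<close>

lemma span_mconst: "u \<in> mpoly_vs.span S \<Longrightarrow> mconst c * u \<in> mpoly_vs.span S"
  using mpoly_vs.span_scale[of u S c] by (simp add: mscale_def)

lemma span_mult:
  assumes "u \<in> mpoly_vs.span S" "v \<in> mpoly_vs.span T" "\<And>s t. s \<in> S \<Longrightarrow> t \<in> T \<Longrightarrow> s * t \<in> mpoly_vs.span U"
  shows "u * v \<in> mpoly_vs.span U"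
proof -
  have "s * v \<in> mpoly_vs.span U" if "s \<in> S" for s
    using assms(2) by (rule span_mult_subset) (use assms(3) that in blast)
  then have "v * u \<in> mpoly_vs.span U"
    by (intro span_mult_subset[OF assms(1)]) (simp add: mult.commute)
  then show ?thesis by (simp add: mult.commute)
qed

context rank_four
begin

text \<open>The minors enter the computation as constant polynomials; one half exists because
  \<open>p\<close> is odd.\<close>

sublocale C: fbar3_computation p "mvar X" "mvar Y" "mvar Z" "mconst (gam p M 1 2 3 4)" "mconst (gam p M 1 2 3 5)"
  "mconst (gam p M 1 2 4 5)" "mconst (gam p M 1 3 4 5)" "mconst (gam p M 2 3 4 5)"
  "mconst (gam p M 1 2 3 6)" "mconst (gam p M 1 2 4 6)" "mconst (gam p M 1 3 4 6)" "mconst (gam p M 2 3 4 6)"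
  "mconst (1 / 2) :: (xyz, 'a) mpoly"
proof
  have two: "(2 :: 'a) \<noteq> 0"
  proof
    assume "(2 :: 'a) = 0"
    then have "CHAR('a) dvd 2" using of_nat_eq_0_iff_char_dvd[of 2, where 'a = 'a] by simp
    then show False using p by (auto simp: char dest: dvd_imp_le)
  qed
  show "2 * mconst (1 / 2) = (1 :: (xyz, 'a) mpoly)"
    using two by (simp flip: mconst_numeral mconst_mult)
qed (simp_all add: p CHAR_mpoly char)

abbreviation "x \<equiv> (mvar X :: (xyz, 'a) mpoly)"
abbreviation "y \<equiv> (mvar Y :: (xyz, 'a) mpoly)"
abbreviation "z \<equiv> (mvar Z :: (xyz, 'a) mpoly)"
abbreviation "g0 \<equiv> gam p M 1 2 3 4"

lemma two_nz: "(2 :: (xyz, 'a) mpoly) \<noteq> 0"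
  using C.h by (metis mult_zero_left zero_neq_one)

lemma two_nz': "(2 :: 'a) \<noteq> 0"
  using two_nz by (metis mconst_0 mconst_numeral)

lemma dl_eq: "C.dl = delta"
  by (simp add: C.dl_def delta_def)

lemma fbar1_eq: "fbar1 p M = C.F1"
proof -
  have e: "x ^ (p^2 - 2 * p) * x ^ p = x ^ (p^2 - p)" "x ^ (p^2 - 2 * p) * x ^ (2 * p - 2) = x ^ (p^2 - 2)"
    "x ^ (p^2 - 2 * p) * x ^ (2 * p - 1) = x ^ (p^2 - 1)"
    by (rule powadd, use C.p2 p3 in arith)+
  have "x ^ (p^2 - 2 * p) * C.ph = mconst (gam p M 1 2 3 5) * delta ^ p * x ^ (p^2 - 2*p)
    + mconst (gam p M 1 2 4 5) * (x ^ (p^2 - 2 * p) * x ^ p) * y ^ p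
    + mconst (gam p M 1 3 4 5) * delta * (x ^ (p^2 - 2 * p) * x ^ (2 * p - 2))
    + mconst (gam p M 2 3 4 5) * (x ^ (p^2 - 2 * p) * x ^ (2 * p - 1)) * y"
    unfolding C.ph_def dl_eq by (simp only: distrib_left mult_ac)
  then show ?thesis unfolding e fbar1_def C.F1_def by (simp only: add.assoc)
qed

lemma fbar12346_eq: "fbar12346 p M = C.G"
proof -
  have e: "x ^ (2 * p^2 - 2 * p) * x ^ p = x ^ (2 * p^2 - p)" "x ^ (2 * p^2 - 2 * p) * x ^ (2 * p - 2) = x ^ (2 * p^2 - 2)"
    "x ^ (2 * p^2 - 2 * p) * x ^ (2 * p - 1) = x ^ (2 * p^2 - 1)"
    by (rule powadd, use C.p2 p3 in arith)+
  have "x ^ (2 * p^2 - 2 * p) * C.ps = mconst (gam p M 1 2 3 6) * delta ^ p * x ^ (2 * p^2 - 2*p)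
    + mconst (gam p M 1 2 4 6) * (x ^ (2 * p^2 - 2 * p) * x ^ p) * y ^ p
    + mconst (gam p M 1 3 4 6) * delta * (x ^ (2 * p^2 - 2 * p) * x ^ (2 * p - 2))
    + mconst (gam p M 2 3 4 6) * (x ^ (2 * p^2 - 2 * p) * x ^ (2 * p - 1)) * y"
    unfolding C.ps_def dl_eq by (simp only: distrib_left mult_ac)
  then show ?thesis unfolding e fbar12346_def C.G_def dl_eq by (simp only: add.assoc)
qed

lemma fbar2_eq: "fbar2 p M = C.F2"
  unfolding fbar2_def fbar1_eq fbar12346_eq exact_quot_def
proof (rule the_equality)
  show "C.F2 * (2 * x ^ (p\<^sup>2 - 2 * p)) = C.F1\<^sup>2 + mconst g0 * C.G"
    using C.F2_eq by (simp only: mult_ac)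
  fix h assume "h * (2 * x ^ (p\<^sup>2 - 2 * p)) = C.F1\<^sup>2 + mconst g0 * C.G"
  also have "\<dots> = C.F2 * (2 * x ^ (p\<^sup>2 - 2 * p))" using C.F2_eq by (simp only: mult_ac)
  finally show "h = C.F2" using two_nz by simp
qed

section \<open>Invariants as fixed points of the translations\<close>

definition Inv :: "(xyz, 'a) mpoly set"
  where "Inv = {f. \<forall>(c, v)\<in>Lam. tr c v f = f}"

lemma Inv_invariants: "invariants p M = Inv"
  by (simp add: Inv_def invariants_eq)

lemma InvI: "(\<And>c v. (c, v) \<in> Lam \<Longrightarrow> tr c v f = f) \<Longrightarrow> f \<in> Inv"
  by (auto simp: Inv_def)

lemma InvD: "f \<in> Inv \<Longrightarrow> (c, v) \<in> Lam \<Longrightarrow> tr c v f = f"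
  by (auto simp: Inv_def)

lemma Inv_add: "f \<in> Inv \<Longrightarrow> g \<in> Inv \<Longrightarrow> f + g \<in> Inv"
  by (auto intro!: InvI simp: tr_simps InvD)

lemma Inv_diff: "f \<in> Inv \<Longrightarrow> g \<in> Inv \<Longrightarrow> f - g \<in> Inv"
  by (auto intro!: InvI simp: tr_simps InvD)

lemma Inv_mult: "f \<in> Inv \<Longrightarrow> g \<in> Inv \<Longrightarrow> f * g \<in> Inv"
  by (auto intro!: InvI simp: tr_simps InvD)

lemma Inv_power: "f \<in> Inv \<Longrightarrow> f ^ n \<in> Inv"
  by (auto intro!: InvI simp: tr_simps InvD)

lemma Inv_mconst: "mconst c \<in> Inv"
  by (auto intro!: InvI simp: tr_simps)

lemma Inv_x: "x \<in> Inv"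
  by (auto intro!: InvI)

lemma Inv_0: "0 \<in> Inv"
  by (auto intro!: InvI simp: tr_simps)

lemma Inv_cancel:
  assumes "h * f \<in> Inv" "h \<in> Inv" "h \<noteq> 0"
  shows "f \<in> Inv"
proof (rule InvI)
  fix c v assume l: "(c, v) \<in> Lam"
  have "h * tr c v f = h * f" using InvD[OF assms(1) l] InvD[OF assms(2) l] by (simp add: tr_simps)
  then show "tr c v f = f" using assms(3) by simp
qed

lemma tr_y_pow: "(y + mconst c * x) ^ p = y ^ p + mconst (c ^ p) * x ^ p"
  "(y + mconst c * x) ^ (p^2) = y ^ (p^2) + mconst (c ^ (p^2)) * x ^ (p^2)"
proof -
  show 1: "(y + mconst c * x) ^ p = y ^ p + mconst (c ^ p) * x ^ p" for c
    unfolding C.fadd power_mult_distrib mconst_power ..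
  have "(y + mconst c * x) ^ (p^2) = ((y + mconst c * x) ^ p) ^ p" by (simp add: power2_eq_square power_mult)
  also have "\<dots> = y ^ (p^2) + mconst (c ^ (p^2)) * x ^ (p^2)"
    unfolding 1 C.fadd power_mult_distrib mconst_power power2_eq_square power_mult ..
  finally show "(y + mconst c * x) ^ (p^2) = y ^ (p^2) + mconst (c ^ (p^2)) * x ^ (p^2)" .
qed

lemma tr_dl: "tr c v C.dl = C.dl + mconst v * x ^ 2"
  unfolding dl_eq by (rule tr_delta)

lemma tr_dl_pow: "(C.dl + mconst v * x ^ 2) ^ p = C.dl ^ p + mconst (v ^ p) * x ^ (2 * p)"
  "(C.dl + mconst v * x ^ 2) ^ (p^2) = C.dl ^ (p^2) + mconst (v ^ (p^2)) * x ^ (2 * p^2)"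
proof -
  show 1: "(C.dl + mconst v * x ^ 2) ^ p = C.dl ^ p + mconst (v ^ p) * x ^ (2 * p)" for v
    unfolding C.fadd power_mult_distrib mconst_power power_mult ..
  have "(C.dl + mconst v * x ^ 2) ^ (p^2) = ((C.dl + mconst v * x ^ 2) ^ p) ^ p" by (simp add: power2_eq_square power_mult)
  also have "\<dots> = C.dl ^ (p^2) + mconst (v ^ (p^2)) * x ^ (2 * p^2)"
    unfolding 1 C.fadd power_mult_distrib mconst_power power2_eq_square[of p] power_mult
    by (simp add: mult_ac flip: power_mult)
  finally show "(C.dl + mconst v * x ^ 2) ^ (p^2) = C.dl ^ (p^2) + mconst (v ^ (p^2)) * x ^ (2 * p^2)" .
qed

text \<open>By Frobenius each summand is additive in the translation, and its power of
  \<open>x\<close> is such that the increment is a multiple of \<open>x ^ (2 * p)\<close>. The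
  increments thus add up to one linear expression in v^p, c^p, v, c, as in
  \<open>Lam_relations\<close>.\<close>

lemma tr_form:
  "tr c v (mconst s1 * C.dl ^ p + mconst s2 * x ^ p * y ^ p + mconst s3 * x ^ (2 * p - 2) * C.dl + mconst s4 * x ^ (2 * p - 1) * y) =
    mconst s1 * C.dl ^ p + mconst s2 * x ^ p * y ^ p + mconst s3 * x ^ (2 * p - 2) * C.dl + mconst s4 * x ^ (2 * p - 1) * y
    + mconst (s1 * v ^ p + s2 * c ^ p + s3 * v + s4 * c) * x ^ (2 * p)"
proof -
  have e: "x ^ p * x ^ p = x ^ (2 * p)" "x ^ (2 * p - 2) * x ^ 2 = x ^ (2 * p)" "x ^ (2 * p - 1) * x = x ^ (2 * p)"
    using powadd[of "2 * p - 1" 1 "2 * p" x] p by (auto intro: powadd)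
  have "tr c v (mconst s1 * C.dl ^ p + mconst s2 * x ^ p * y ^ p + mconst s3 * x ^ (2 * p - 2) * C.dl + mconst s4 * x ^ (2 * p - 1) * y) =
    mconst s1 * C.dl ^ p + mconst s2 * x ^ p * y ^ p + mconst s3 * x ^ (2 * p - 2) * C.dl + mconst s4 * x ^ (2 * p - 1) * y
    + (mconst (s1 * v ^ p) * x ^ (2 * p) + mconst (s2 * c ^ p) * (x ^ p * x ^ p) + mconst (s3 * v) * (x ^ (2 * p - 2) * x ^ 2)
      + mconst (s4 * c) * (x ^ (2 * p - 1) * x))"
    unfolding tr_simps tr_mvar tr_dl tr_y_pow tr_dl_pow by (simp add: mconst_mult algebra_simps)
  then show ?thesis unfolding e by (simp add: mconst_add distrib_right)
qed

lemma Inv_F1: "C.F1 \<in> Inv"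
proof (rule InvI)
  fix c v assume l: "(c, v) \<in> Lam"
  have "tr c v C.F1 = C.F1 + mconst (g0 * c ^ (p^2)) * x ^ (p^2)
      + mconst (gam p M 1 2 3 5 * v ^ p + gam p M 1 2 4 5 * c ^ p + gam p M 1 3 4 5 * v + gam p M 2 3 4 5 * c)
        * (x ^ (p^2 - 2 * p) * x ^ (2 * p))"
    unfolding C.F1_def C.ph_def
    unfolding alg_hom_add[OF alg_hom_tr, of c v "_ * y ^ (p^2)"] alg_hom_mult[OF alg_hom_tr, of c v "x ^ (p^2 - 2 * p)"] tr_form
    unfolding tr_simps tr_mvar tr_y_pow by (simp add: mconst_mult algebra_simps)
  also have "\<dots> = C.F1 + mconst (g0 * c ^ (p^2) + gam p M 1 2 3 5 * v ^ p + gam p M 1 2 4 5 * c ^ p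
      + gam p M 1 3 4 5 * v + gam p M 2 3 4 5 * c) * x ^ (p^2)"
    unfolding C.xq by (simp add: mconst_add algebra_simps)
  finally show "tr c v C.F1 = C.F1" unfolding Lam_relations(1)[OF l] by simp
qed

lemma Inv_G: "C.G \<in> Inv"
proof (rule InvI)
  fix c v assume l: "(c, v) \<in> Lam"
  have e: "x ^ (2 * p^2 - 2 * p) * x ^ (2 * p) = x ^ (2 * p^2)"
    by (rule powadd) (use C.p2 p3 in arith)
  have "tr c v C.G = C.G + mconst (- g0 * v ^ (p^2)) * x ^ (2 * p^2)
      + mconst (gam p M 1 2 3 6 * v ^ p + gam p M 1 2 4 6 * c ^ p + gam p M 1 3 4 6 * v + gam p M 2 3 4 6 * c)
        * (x ^ (2 * p^2 - 2 * p) * x ^ (2 * p))"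
    unfolding C.G_def C.ps_def
    unfolding alg_hom_add[OF alg_hom_tr, of c v "_ * C.dl ^ (p^2)"] alg_hom_mult[OF alg_hom_tr, of c v "x ^ (2 * p^2 - 2 * p)"] tr_form
    unfolding tr_simps tr_mvar tr_dl tr_dl_pow by (simp add: mconst_mult mconst_uminus algebra_simps)
  also have "\<dots> = C.G + mconst (- g0 * v ^ (p^2) + gam p M 1 2 3 6 * v ^ p + gam p M 1 2 4 6 * c ^ p
      + gam p M 1 3 4 6 * v + gam p M 2 3 4 6 * c) * x ^ (2 * p^2)"
    unfolding e by (simp only: mconst_add distrib_right add.assoc)
  finally show "tr c v C.G = C.G" unfolding Lam_relations(2)[OF l] by simp
qed

lemma Inv_F2: "C.F2 \<in> Inv"
proof (rule Inv_cancel)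
  show "2 * x ^ (p^2 - 2 * p) * C.F2 \<in> Inv"
    unfolding C.F2_eq by (intro Inv_add Inv_mult Inv_power Inv_F1 Inv_G Inv_mconst)
  show "2 * x ^ (p^2 - 2 * p) \<in> Inv"
    unfolding mconst_numeral[symmetric] by (intro Inv_mult Inv_power Inv_mconst Inv_x)
qed (simp add: two_nz)

text \<open>A filtration with \<open>x\<close>, \<open>y\<close>, \<open>delta\<close> of weights 0,
  1, 2. The bound is strict, so that two polynomials have the same leading form of weight w when
  their difference lies in \<open>Wt w\<close>; this is also why products obey m + n \<le> w +
  1.\<close>

definition Wt :: "nat \<Rightarrow> (xyz, 'a) mpoly set"
  where "Wt w = mpoly_vs.span {x ^ i * y ^ j * C.dl ^ k | i j k. j + 2 * k < w}"

text \<open>The corresponding part of F[x, fbar1, fbar12346], the generators counted with the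
  weights 0, p^2, 2p^2 of their leading forms.\<close>

definition Q :: "nat \<Rightarrow> (xyz, 'a) mpoly set"
  where "Q w = mpoly_vs.span {x ^ i * C.F1 ^ a * C.G ^ b | i a b. p^2 * (a + 2 * b) < w}"

lemma Wt_gen: "j + 2 * k < w \<Longrightarrow> x ^ i * y ^ j * C.dl ^ k \<in> Wt w"
  unfolding Wt_def by (intro mpoly_vs.span_base) blast

lemma Wt_mono: "f \<in> Wt w \<Longrightarrow> w \<le> w' \<Longrightarrow> f \<in> Wt w'"
  unfolding Wt_def
  by (erule subsetD[OF mpoly_vs.span_mono, rotated],
    rule subsetI, elim CollectE exE conjE, intro CollectI exI conjI, assumption, simp)

lemma Wt_add: "f \<in> Wt w \<Longrightarrow> g \<in> Wt w \<Longrightarrow> f + g \<in> Wt w"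
  unfolding Wt_def by (rule mpoly_vs.span_add)

lemma Wt_diff: "f \<in> Wt w \<Longrightarrow> g \<in> Wt w \<Longrightarrow> f - g \<in> Wt w"
  unfolding Wt_def by (rule mpoly_vs.span_diff)

lemma Wt_0: "0 \<in> Wt w"
  unfolding Wt_def by (rule mpoly_vs.span_zero)

lemma Wt_mconst: "f \<in> Wt w \<Longrightarrow> mconst c * f \<in> Wt w"
  unfolding Wt_def by (rule span_mconst)

lemma Wt_mult: "f \<in> Wt m \<Longrightarrow> g \<in> Wt n \<Longrightarrow> m + n \<le> w + 1 \<Longrightarrow> f * g \<in> Wt w"
  unfolding Wt_def
proof (rule span_mult)
  fix s t assume mn: "m + n \<le> w + 1" and "s \<in> {x ^ i * y ^ j * C.dl ^ k | i j k. j + 2 * k < m}"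
    "t \<in> {x ^ i * y ^ j * C.dl ^ k | i j k. j + 2 * k < n}"
  then obtain i j k i' j' k' where s: "s = x ^ i * y ^ j * C.dl ^ k" "j + 2 * k < m"
    and t: "t = x ^ i' * y ^ j' * C.dl ^ k'" "j' + 2 * k' < n" by blast
  have "s * t = x ^ (i + i') * y ^ (j + j') * C.dl ^ (k + k')" unfolding s t power_add by (simp only: mult_ac)
  moreover have "(j + j') + 2 * (k + k') < w" using s t mn by simp
  ultimately show "s * t \<in> mpoly_vs.span {x ^ i * y ^ j * C.dl ^ k | i j k. j + 2 * k < w}"
    by (intro mpoly_vs.span_base) blast
qed

lemma Wt_x: "x ^ n \<in> Wt 1" and Wt_y: "y ^ n \<in> Wt (n + 1)" and Wt_dl: "C.dl ^ n \<in> Wt (2 * n + 1)"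
  using Wt_gen[of 0 0 1 n] Wt_gen[of n 0 "n + 1" 0] Wt_gen[of 0 n "2 * n + 1" 0] by simp_all

lemma Wt_xmult: "f \<in> Wt w \<Longrightarrow> x ^ n * f \<in> Wt w"
  using Wt_mult[OF Wt_x, of f w w n] by simp

lemma Wt_1: "1 \<in> Wt 1"
  using Wt_x[of 0] by simp

lemma Wt_power: "f \<in> Wt (w + 1) \<Longrightarrow> f ^ n \<in> Wt (n * w + 1)"
proof (induction n)
  case (Suc n)
  then show ?case using Wt_mult[of f "w + 1" "f ^ n" "n * w + 1" "Suc n * w + 1"] by simp
qed (use Wt_1 in simp)

lemma Wt_form: "mconst s1 * C.dl ^ p + mconst s2 * x ^ p * y ^ p + mconst s3 * x ^ (2 * p - 2) * C.dl + mconst s4 * x ^ (2 * p - 1) * y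
    \<in> Wt (2 * p + 1)"
proof -
  have "mconst s1 * C.dl ^ p + mconst s2 * x ^ p * y ^ p + mconst s3 * x ^ (2 * p - 2) * C.dl + mconst s4 * x ^ (2 * p - 1) * y =
      mconst s1 * (x ^ 0 * y ^ 0 * C.dl ^ p) + mconst s2 * (x ^ p * y ^ p * C.dl ^ 0)
      + mconst s3 * (x ^ (2 * p - 2) * y ^ 0 * C.dl ^ 1) + mconst s4 * (x ^ (2 * p - 1) * y ^ 1 * C.dl ^ 0)"
    by (simp add: mult.assoc)
  also have "\<dots> \<in> Wt (2 * p + 1)"
    using p by (intro Wt_add Wt_mconst Wt_gen) simp_all
  finally show ?thesis .
qed

lemma Wt_S: "y ^ 2 - C.dl \<in> Wt 3"
proof (rule Wt_diff)
  show "y ^ 2 \<in> Wt 3" using Wt_y[of 2] by simp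
  show "C.dl \<in> Wt 3" using Wt_dl[of 1] by simp
qed

text \<open>A power of \<open>x\<close> clears the variable \<open>z\<close>, because x z = y^2 -
  delta.\<close>

lemma every_Wt: "\<exists>n w. x ^ n * f \<in> Wt w"
proof -
  have mono: "\<exists>n w. x ^ n * mono_eval mvar t \<in> Wt w" for t
  proof -
    let ?a = "lookup t X" and ?b = "lookup t Y" and ?c = "lookup t Z"
    have "mono_eval mvar t = x ^ ?a * y ^ ?b * z ^ ?c"
    proof -
      have "keys t \<subseteq> {X, Y, Z}" by (auto simp flip: UNIV_xyz)
      then show ?thesis by (simp add: mono_eval_superset[of "{X, Y, Z}"] mult_ac)
    qed
    then have "x ^ ?c * mono_eval mvar t = x ^ ?a * (y ^ ?b * (y ^ 2 - C.dl) ^ ?c)"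
      by (simp add: C.dl_def mult_ac flip: power_mult_distrib)
    moreover have "y ^ ?b * (y ^ 2 - C.dl) ^ ?c \<in> Wt (?b + ?c * 2 + 1)"
      by (rule Wt_mult[OF Wt_y Wt_power[of _ 2]]) (simp_all add: Wt_S)
    ultimately show ?thesis by (metis Wt_xmult)
  qed
  have lift: "x ^ (n + m) * h \<in> Wt w'" if "x ^ n * h \<in> Wt w" "w \<le> w'" for n m h w w'
    using Wt_mono[OF Wt_xmult[OF that(1), of m] that(2)] by (simp add: power_add mult_ac)
  have "\<exists>n w. x ^ n * (\<Sum>t\<in>T. single t (lookup f t)) \<in> Wt w" if "finite T" for T
    using that
  proof (induction T rule: finite_induct)
    case empty
    show ?case by (simp add: Wt_0)
  next
    case (insert t T)
    then obtain n w where nw: "x ^ n * (\<Sum>t\<in>T. single t (lookup f t)) \<in> Wt w" by blast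
    obtain m u where mu: "x ^ m * mono_eval mvar t \<in> Wt u" using mono by blast
    have "x ^ m * single t (lookup f t) \<in> Wt u"
      unfolding single_eq_mconst_mult using Wt_mconst[OF mu, of "lookup f t"] by (simp only: mult_ac)
    then have "x ^ (m + n) * single t (lookup f t) \<in> Wt (max u w)"
      by (rule lift) simp
    moreover have "x ^ (n + m) * (\<Sum>t\<in>T. single t (lookup f t)) \<in> Wt (max u w)"
      using nw by (rule lift) simp
    ultimately have "x ^ (m + n) * (\<Sum>t\<in>insert t T. single t (lookup f t)) \<in> Wt (max u w)"
      using insert.hyps by (simp add: distrib_left add.commute Wt_add)
    then show ?case by blast
  qed
  from this[of "keys f"] show ?thesis using mpoly_expand[of f] by simp
qed

text \<open>Of the coefficients only that of 1 is required to lie in \<open>Q w\<close>, because it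
  alone is left when \<open>f\<close> is invariant; of the others invariance is enough to show that
  they vanish.\<close>

definition dec :: "nat \<Rightarrow> (xyz, 'a) mpoly \<Rightarrow> bool"
  where "dec w f \<longleftrightarrow> (\<exists>P. f = (\<Sum>j<p^2. \<Sum>k<p^2. P j k * (y ^ j * C.dl ^ k)) \<and> (\<forall>j k. P j k \<in> Inv) \<and> P 0 0 \<in> Q w)"

lemma dec_add: "dec w f \<Longrightarrow> dec w g \<Longrightarrow> dec w (f + g)"
proof -
  assume "dec w f" "dec w g"
  then obtain P P' where "f = (\<Sum>j<p^2. \<Sum>k<p^2. P j k * (y ^ j * C.dl ^ k))" "\<forall>j k. P j k \<in> Inv" "P 0 0 \<in> Q w"
    "g = (\<Sum>j<p^2. \<Sum>k<p^2. P' j k * (y ^ j * C.dl ^ k))" "\<forall>j k. P' j k \<in> Inv" "P' 0 0 \<in> Q w"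
    unfolding dec_def by blast
  then show ?thesis unfolding dec_def
    by (intro exI[of _ "\<lambda>j k. P j k + P' j k"])
      (simp add: distrib_right sum.distrib Inv_add Q_def mpoly_vs.span_add)
qed

lemma dec_mconst: "dec w f \<Longrightarrow> dec w (mconst c * f)"
proof -
  assume "dec w f"
  then obtain P where "f = (\<Sum>j<p^2. \<Sum>k<p^2. P j k * (y ^ j * C.dl ^ k))" "\<forall>j k. P j k \<in> Inv" "P 0 0 \<in> Q w"
    unfolding dec_def by blast
  then show ?thesis unfolding dec_def
    by (intro exI[of _ "\<lambda>j k. mconst c * P j k"])
      (simp add: sum_distrib_left mult.assoc Inv_mult Inv_mconst Q_def span_mconst)
qed

lemma dec_0: "dec w 0"
  unfolding dec_def by (intro exI[of _ "\<lambda>_ _. 0"]) (simp add: Inv_0 Q_def mpoly_vs.span_zero)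

lemma mconst_inverse_cancel: "c \<noteq> 0 \<Longrightarrow> mconst (1 / c) * (mconst c * f) = (f :: (xyz, 'a) mpoly)"
  by (simp flip: mult.assoc mconst_mult)

text \<open>The equations of \<open>F1\<close> and \<open>G\<close> serve as rewrite rules for
  y^(p^2) and delta^(p^2). The total weight, with \<open>F1\<close> and \<open>G\<close> counted as
  p^2 and 2p^2, does not grow, while the part j + 2k due to \<open>y\<close> and
  \<open>delta\<close> decreases.\<close>

lemma dec_gen:
  "p^2 * (a + 2 * b) + j + 2 * k < w \<Longrightarrow> dec w (x ^ i * C.F1 ^ a * C.G ^ b * (y ^ j * C.dl ^ k))"
proof (induction "j + 2 * k" arbitrary: i a b j k rule: less_induct)
  case less
  have p2: "3 * p \<le> p^2" by (rule C.p2)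
  consider "j < p^2" "k < p^2" | "p^2 \<le> j" | "p^2 \<le> k" by linarith
  then show ?case
  proof cases
    case 1
    let ?P = "\<lambda>j' k'. if j' = j then if k' = k then x ^ i * C.F1 ^ a * C.G ^ b else 0 else 0"
    have "(\<Sum>j'<p^2. \<Sum>k'<p^2. ?P j' k' * (y ^ j' * C.dl ^ k')) =
        (\<Sum>j'<p^2. if j' = j then x ^ i * C.F1 ^ a * C.G ^ b * (y ^ j' * C.dl ^ k) else 0)"
      using 1 by (intro sum.cong refl) (simp add: if_distrib[of "\<lambda>t. t * _"] cong: if_cong)
    also have "\<dots> = x ^ i * C.F1 ^ a * C.G ^ b * (y ^ j * C.dl ^ k)" using 1 by simp
    finally have "x ^ i * C.F1 ^ a * C.G ^ b * (y ^ j * C.dl ^ k) = (\<Sum>j'<p^2. \<Sum>k'<p^2. ?P j' k' * (y ^ j' * C.dl ^ k'))" ..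
    moreover have "x ^ i * C.F1 ^ a * C.G ^ b \<in> Inv" by (intro Inv_mult Inv_power Inv_x Inv_F1 Inv_G)
    moreover have "x ^ i * C.F1 ^ a * C.G ^ b \<in> Q w"
    proof -
      have "p^2 * (a + 2 * b) < w" using less.prems by simp
      then show ?thesis unfolding Q_def by (intro mpoly_vs.span_base) blast
    qed
    ultimately show ?thesis unfolding dec_def
      by (intro exI[of _ ?P]) (simp add: Inv_0 Q_def mpoly_vs.span_zero)
  next
    case 2
    define j' where "j' = j - p^2"
    have j: "j = j' + p^2" using 2 by (simp add: j'_def)
    define Fa where "Fa = C.F1 ^ a * C.G ^ b"
    have ih: "dec w (x ^ i1 * C.F1 ^ a1 * C.G ^ b1 * (y ^ j1 * C.dl ^ k1))"
      if "j1 + 2 * k1 < j + 2 * k" "p^2 * (a1 + 2 * b1) + j1 + 2 * k1 < w" for i1 a1 b1 j1 k1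
      using less.hyps[OF that(1)] that(2) .
    have T: "mconst g0 * (x ^ i * C.F1 ^ a * C.G ^ b * (y ^ j * C.dl ^ k)) =
        x ^ i * C.F1 ^ (a + 1) * C.G ^ b * (y ^ j' * C.dl ^ k)
        + mconst (- gam p M 1 2 3 5) * (x ^ (i + (p^2 - 2 * p)) * C.F1 ^ a * C.G ^ b * (y ^ j' * C.dl ^ (k + p)))
        + mconst (- gam p M 1 2 4 5) * (x ^ (i + (p^2 - 2 * p) + p) * C.F1 ^ a * C.G ^ b * (y ^ (j' + p) * C.dl ^ k))
        + mconst (- gam p M 1 3 4 5) * (x ^ (i + (p^2 - 2 * p) + (2 * p - 2)) * C.F1 ^ a * C.G ^ b * (y ^ j' * C.dl ^ (k + 1)))
        + mconst (- gam p M 2 3 4 5) * (x ^ (i + (p^2 - 2 * p) + (2 * p - 1)) * C.F1 ^ a * C.G ^ b * (y ^ (j' + 1) * C.dl ^ k))"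
      (is "_ = ?S")
    proof -
      have e1: "mconst g0 * y ^ (p^2) = C.F1 - x ^ (p^2 - 2 * p) * C.ph" unfolding C.F1_def by simp
      have e2: "mconst g0 * (x ^ i * C.F1 ^ a * C.G ^ b * (y ^ j * C.dl ^ k)) =
          x ^ i * C.F1 ^ a * C.G ^ b * (y ^ j' * C.dl ^ k) * (mconst g0 * y ^ (p^2))"
        unfolding j power_add by (simp only: mult_ac)
      show ?thesis unfolding e2 e1 C.ph_def power_add mconst_uminus by (simp add: algebra_simps)
    qed
    have "dec w ?S"
      using p2 p3 less.prems by (intro dec_add dec_mconst ih) (simp_all add: j algebra_simps)
    then have "dec w (mconst (1 / g0) * (mconst g0 * (x ^ i * C.F1 ^ a * C.G ^ b * (y ^ j * C.dl ^ k))))"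
      unfolding T by (rule dec_mconst)
    then show ?thesis unfolding mconst_inverse_cancel[OF nz(1)] .
  next
    case 3
    define k' where "k' = k - p^2"
    have k: "k = k' + p^2" using 3 by (simp add: k'_def)
    have ih: "dec w (x ^ i1 * C.F1 ^ a1 * C.G ^ b1 * (y ^ j1 * C.dl ^ k1))"
      if "j1 + 2 * k1 < j + 2 * k" "p^2 * (a1 + 2 * b1) + j1 + 2 * k1 < w" for i1 a1 b1 j1 k1
      using less.hyps[OF that(1)] that(2) .
    let ?q = "2 * p^2 - 2 * p"
    have T: "mconst g0 * (x ^ i * C.F1 ^ a * C.G ^ b * (y ^ j * C.dl ^ k)) =
        mconst (- 1) * (x ^ i * C.F1 ^ a * C.G ^ (b + 1) * (y ^ j * C.dl ^ k'))
        + mconst (gam p M 1 2 3 6) * (x ^ (i + ?q) * C.F1 ^ a * C.G ^ b * (y ^ j * C.dl ^ (k' + p)))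
        + mconst (gam p M 1 2 4 6) * (x ^ (i + ?q + p) * C.F1 ^ a * C.G ^ b * (y ^ (j + p) * C.dl ^ k'))
        + mconst (gam p M 1 3 4 6) * (x ^ (i + ?q + (2 * p - 2)) * C.F1 ^ a * C.G ^ b * (y ^ j * C.dl ^ (k' + 1)))
        + mconst (gam p M 2 3 4 6) * (x ^ (i + ?q + (2 * p - 1)) * C.F1 ^ a * C.G ^ b * (y ^ (j + 1) * C.dl ^ k'))"
      (is "_ = ?S")
    proof -
      have e1: "mconst g0 * C.dl ^ (p^2) = x ^ ?q * C.ps - C.G" unfolding C.G_def by simp
      have e2: "mconst g0 * (x ^ i * C.F1 ^ a * C.G ^ b * (y ^ j * C.dl ^ k)) =
          x ^ i * C.F1 ^ a * C.G ^ b * (y ^ j * C.dl ^ k') * (mconst g0 * C.dl ^ (p^2))"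
        unfolding k power_add by (simp only: mult_ac)
      show ?thesis unfolding e2 e1 C.ps_def power_add mconst_uminus by (simp add: algebra_simps)
    qed
    have "dec w ?S"
      using p2 p3 less.prems by (intro dec_add dec_mconst ih) (simp_all add: k algebra_simps)
    then have "dec w (mconst (1 / g0) * (mconst g0 * (x ^ i * C.F1 ^ a * C.G ^ b * (y ^ j * C.dl ^ k))))"
      unfolding T by (rule dec_mconst)
    then show ?thesis unfolding mconst_inverse_cancel[OF nz(1)] .
  qed
qed

lemma Wt_dec: "f \<in> Wt w \<Longrightarrow> dec w f"
  unfolding Wt_def
proof (induction rule: mpoly_vs.span_induct_alt)
  case (step c u f)
  then obtain i j k where u: "u = x ^ i * y ^ j * C.dl ^ k" "j + 2 * k < w" by blast
  have "dec w u" using dec_gen[of 0 0 j k w i] u by (simp add: mult.assoc)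
  then show ?case unfolding mscale_def by (intro dec_add dec_mconst step.IH)
qed (rule dec_0)

text \<open>Expand both binomials in powers of c and v: the weights \<open>W\<close> select the
  coefficient of c^jm v^km.\<close>

lemma binomial_extract:
  assumes W: "\<And>s t. s < p^2 \<Longrightarrow> t < p^2 \<Longrightarrow>
      (\<Sum>(c, v)\<in>Lam. W (c, v) * (c ^ s * v ^ t)) = (if s = jm \<and> t = km then 1 else 0 :: 'a)"
    and jk: "j < p^2" "k < p^2"
  shows "(\<Sum>(c, v)\<in>Lam. mconst (W (c, v)) * ((y + mconst c * x) ^ j * (C.dl + mconst v * x ^ 2) ^ k)) =
    (if jm \<le> j \<and> km \<le> k then of_nat (j choose jm) * of_nat (k choose km) *
      (y ^ (j - jm) * C.dl ^ (k - km) * x ^ (jm + 2 * km)) else 0)"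
proof -
  let ?c = "\<lambda>s t. of_nat (j choose s) * of_nat (k choose t) * (y ^ (j - s) * C.dl ^ (k - t) * x ^ (s + 2 * t))"
  have b: "(y + mconst c * x) ^ j * (C.dl + mconst v * x ^ 2) ^ k = (\<Sum>s\<le>j. \<Sum>t\<le>k. mconst (c ^ s * v ^ t) * ?c s t)" for c v
  proof -
    have "(mconst c * x + y) ^ j = (\<Sum>s\<le>j. of_nat (j choose s) * (mconst c * x) ^ s * y ^ (j - s))"
      "(mconst v * x ^ 2 + C.dl) ^ k = (\<Sum>t\<le>k. of_nat (k choose t) * (mconst v * x ^ 2) ^ t * C.dl ^ (k - t))"
      by (rule binomial_ring)+
    then show ?thesis
      by (simp add: add.commute[of y] add.commute[of C.dl] sum_product power_mult_distrib mconst_mult mconst_power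
          power_add mult_ac flip: power_mult)
  qed
  have "(\<Sum>(c, v)\<in>Lam. mconst (W (c, v)) * ((y + mconst c * x) ^ j * (C.dl + mconst v * x ^ 2) ^ k)) =
      (\<Sum>l\<in>Lam. \<Sum>s\<le>j. \<Sum>t\<le>k. mconst (W l * (fst l ^ s * snd l ^ t)) * ?c s t)"
    by (simp add: case_prod_unfold b sum_distrib_left mconst_mult mult.assoc)
  also have "\<dots> = (\<Sum>s\<le>j. \<Sum>t\<le>k. \<Sum>l\<in>Lam. mconst (W l * (fst l ^ s * snd l ^ t)) * ?c s t)"
    by (subst sum.swap, rule sum.cong[OF refl], rule sum.swap)
  also have "\<dots> = (\<Sum>s\<le>j. \<Sum>t\<le>k. mconst (if s = jm \<and> t = km then 1 else 0) * ?c s t)"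
  proof (intro sum.cong refl)
    fix s t assume "s \<in> {..j}" "t \<in> {..k}"
    then have "(\<Sum>(c, v)\<in>Lam. W (c, v) * (c ^ s * v ^ t)) = (if s = jm \<and> t = km then 1 else 0)"
      using jk by (intro W) auto
    then show "(\<Sum>l\<in>Lam. mconst (W l * (fst l ^ s * snd l ^ t)) * ?c s t) = mconst (if s = jm \<and> t = km then 1 else 0) * ?c s t"
      by (simp add: case_prod_unfold flip: sum_distrib_right mconst_sum)
  qed
  also have "\<dots> = (\<Sum>s\<le>j. if s = jm then (if km \<le> k then ?c s km else 0) else 0)"
  proof (intro sum.cong refl)
    fix s
    have "(\<Sum>t\<le>k. mconst (if s = jm \<and> t = km then 1 else 0) * ?c s t) = (\<Sum>t\<le>k. if t = km then (if s = jm then ?c s t else 0) else 0)"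
      by (intro sum.cong refl) simp
    then show "(\<Sum>t\<le>k. mconst (if s = jm \<and> t = km then 1 else 0) * ?c s t) = (if s = jm then (if km \<le> k then ?c s km else 0) else 0)"
      by simp
  qed
  also have "\<dots> = (if jm \<le> j \<and> km \<le> k then ?c jm km else 0)" by simp
  finally show ?thesis .
qed

text \<open>Among the nonzero coefficients other than \<open>P 0 0\<close> choose one with jm + km
  largest, and combine all translates of \<open>f\<close> with the weights that extract c^jm v^km.
  Maximality leaves only \<open>P jm km * x ^ (jm + 2 * km)\<close>. But all translates equal
  \<open>f\<close> and the weights add up to 0, so this is zero.\<close>

lemma Inv_Wt_Q:
  assumes "f \<in> Wt w" "f \<in> Inv"
  shows "f \<in> Q w"
proof -
  obtain P where P: "f = (\<Sum>j<p^2. \<Sum>k<p^2. P j k * (y ^ j * C.dl ^ k))" "\<And>j k. P j k \<in> Inv" "P 0 0 \<in> Q w"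
    using Wt_dec[OF assms(1)] unfolding dec_def by blast
  define S where "S = {(j, k). j < p^2 \<and> k < p^2 \<and> (j, k) \<noteq> (0, 0) \<and> P j k \<noteq> 0}"
  have p0: "0 < p^2" using p by simp
  have "S = {}"
  proof (rule ccontr)
    assume "S \<noteq> {}"
    have "S \<subseteq> {..<p^2} \<times> {..<p^2}" by (auto simp: S_def)
    then have fin: "finite S" by (rule finite_subset) simp
    have "Max ((\<lambda>(j, k). j + k) ` S) \<in> (\<lambda>(j, k). j + k) ` S" using fin \<open>S \<noteq> {}\<close> by (intro Max_in) auto
    then obtain jm km where m: "(jm, km) \<in> S" "jm + km = Max ((\<lambda>(j, k). j + k) ` S)" by auto
    have mx: "j + k \<le> jm + km" if "(j, k) \<in> S" for j k
      unfolding m(2) using fin that by (intro Max_ge) (auto intro: image_eqI[of _ _ "(j, k)"])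
    have jm: "jm < p^2" "km < p^2" "(jm, km) \<noteq> (0, 0)" "P jm km \<noteq> 0" using m(1) by (auto simp: S_def)
    obtain W where W: "\<And>j k s t. j < p^2 \<Longrightarrow> k < p^2 \<Longrightarrow> s < p^2 \<Longrightarrow> t < p^2 \<Longrightarrow>
      (\<Sum>(c, v)\<in>Lam. W j k (c, v) * (c ^ s * v ^ t)) = (if s = j \<and> t = k then 1 else 0 :: 'a)"
      using extraction by blast
    have f: "f = (\<Sum>j<p^2. \<Sum>k<p^2. P j k * ((y + mconst c * x) ^ j * (C.dl + mconst v * x ^ 2) ^ k))" if "(c, v) \<in> Lam" for c v
    proof -
      have "f = tr c v f" using InvD[OF assms(2) that] by simp
      also have "\<dots> = (\<Sum>j<p^2. \<Sum>k<p^2. P j k * ((y + mconst c * x) ^ j * (C.dl + mconst v * x ^ 2) ^ k))"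
        by (subst P(1)) (simp add: tr_simps tr_dl InvD[OF P(2) that])
      finally show ?thesis .
    qed
    have "(\<Sum>(c, v)\<in>Lam. mconst (W jm km (c, v)) * f) =
        (\<Sum>(c, v)\<in>Lam. mconst (W jm km (c, v)) * (\<Sum>j<p^2. \<Sum>k<p^2. P j k * ((y + mconst c * x) ^ j * (C.dl + mconst v * x ^ 2) ^ k)))"
      using f by (intro sum.cong refl) auto
    also have "\<dots> = (\<Sum>l\<in>Lam. \<Sum>j<p^2. \<Sum>k<p^2. P j k * (case l of (c, v) \<Rightarrow>
        mconst (W jm km (c, v)) * ((y + mconst c * x) ^ j * (C.dl + mconst v * x ^ 2) ^ k)))"
      by (intro sum.cong refl) (auto simp: sum_distrib_left mult_ac)
    also have "\<dots> = (\<Sum>j<p^2. \<Sum>k<p^2. \<Sum>l\<in>Lam. P j k * (case l of (c, v) \<Rightarrow>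
        mconst (W jm km (c, v)) * ((y + mconst c * x) ^ j * (C.dl + mconst v * x ^ 2) ^ k)))"
      by (subst sum.swap, rule sum.cong[OF refl], rule sum.swap)
    also have "\<dots> = (\<Sum>j<p^2. \<Sum>k<p^2. if k = km then (if j = jm then P j k * x ^ (jm + 2 * km) else 0) else 0)"
    proof (intro sum.cong refl)
      fix j k assume jk: "j \<in> {..<p^2}" "k \<in> {..<p^2}"
      have "(\<Sum>l\<in>Lam. P j k * (case l of (c, v) \<Rightarrow>
        mconst (W jm km (c, v)) * ((y + mconst c * x) ^ j * (C.dl + mconst v * x ^ 2) ^ k))) =
        P j k * (if jm \<le> j \<and> km \<le> k then of_nat (j choose jm) * of_nat (k choose km) *
          (y ^ (j - jm) * C.dl ^ (k - km) * x ^ (jm + 2 * km)) else 0)"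
        unfolding sum_distrib_left[symmetric] using jk
        by (subst binomial_extract[of "W jm km" jm km]) (use W jm in auto)
      also have "\<dots> = (if k = km then (if j = jm then P j k * x ^ (jm + 2 * km) else 0) else 0)"
      proof (cases "jm \<le> j \<and> km \<le> k \<and> (j, k) \<noteq> (jm, km)")
        case True
        then have "jm + km < j + k" "(j, k) \<noteq> (0, 0)" by auto
        then have "P j k = 0" using mx[of j k] jk by (force simp: S_def)
        then show ?thesis using True by auto
      next
        case False
        then show ?thesis by auto
      qed
      finally show "(\<Sum>l\<in>Lam. P j k * (case l of (c, v) \<Rightarrow>
        mconst (W jm km (c, v)) * ((y + mconst c * x) ^ j * (C.dl + mconst v * x ^ 2) ^ k))) =
        (if k = km then (if j = jm then P j k * x ^ (jm + 2 * km) else 0) else 0)" .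
    qed
    also have "\<dots> = P jm km * x ^ (jm + 2 * km)" using jm by simp
    finally have 1: "(\<Sum>(c, v)\<in>Lam. mconst (W jm km (c, v)) * f) = P jm km * x ^ (jm + 2 * km)" .
    \<comment> \<open>Extraction applied to the monomial c^0 v^0, which differs from c^jm
      v^km.\<close>
    have "(\<Sum>(c, v)\<in>Lam. W jm km (c, v)) = (if 0 = jm \<and> 0 = km then 1 else 0)"
      using W[OF jm(1,2) p0 p0] by simp
    also have "\<dots> = 0" using jm(3) by auto
    finally have "(\<Sum>(c, v)\<in>Lam. mconst (W jm km (c, v))) = (0 :: (xyz, 'a) mpoly)"
      by (metis (mono_tags, lifting) case_prod_unfold mconst_0 mconst_sum sum.cong)
    then have "(\<Sum>(c, v)\<in>Lam. mconst (W jm km (c, v)) * f) = 0"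
      by (simp add: case_prod_unfold flip: sum_distrib_right)
    with 1 show False using jm(4) by simp
  qed
  then have "P j k = 0" if "j < p^2" "k < p^2" "(j, k) \<noteq> (0, 0)" for j k
    using that by (auto simp: S_def)
  then have "(\<Sum>j<p^2. \<Sum>k<p^2. P j k * (y ^ j * C.dl ^ k)) = (\<Sum>j<p^2. \<Sum>k<p^2. if k = 0 then if j = 0 then P j k else 0 else 0)"
    by (intro sum.cong refl) auto
  also have "\<dots> = P 0 0" using p0 by simp
  finally show ?thesis using P by simp
qed

section \<open>The filtration of F[x, fbar1, fbar2] by the exponent of \<open>fbar2\<close>\<close>

definition D :: "nat \<Rightarrow> (xyz, 'a) mpoly set"
  where "D m = mpoly_vs.span {x ^ i * C.F1 ^ a * C.F2 ^ b | i a b. b < m}"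

lemma D_gen: "b < m \<Longrightarrow> x ^ i * C.F1 ^ a * C.F2 ^ b \<in> D m"
  unfolding D_def by (intro mpoly_vs.span_base) blast

lemma D_mono: "f \<in> D m \<Longrightarrow> m \<le> n \<Longrightarrow> f \<in> D n"
  unfolding D_def
  by (erule subsetD[OF mpoly_vs.span_mono, rotated],
    rule subsetI, elim CollectE exE conjE, intro CollectI exI conjI, assumption, simp)

lemma D_add: "f \<in> D m \<Longrightarrow> g \<in> D m \<Longrightarrow> f + g \<in> D m"
  unfolding D_def by (rule mpoly_vs.span_add)

lemma D_diff: "f \<in> D m \<Longrightarrow> g \<in> D m \<Longrightarrow> f - g \<in> D m"
  unfolding D_def by (rule mpoly_vs.span_diff)

lemma D_mconst: "f \<in> D m \<Longrightarrow> mconst c * f \<in> D m"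
  unfolding D_def by (rule span_mconst)

lemma D_mult: "f \<in> D m \<Longrightarrow> g \<in> D n \<Longrightarrow> m + n \<le> k + 1 \<Longrightarrow> f * g \<in> D k"
  unfolding D_def
proof (rule span_mult)
  fix s t assume mn: "m + n \<le> k + 1" and "s \<in> {x ^ i * C.F1 ^ a * C.F2 ^ b | i a b. b < m}"
    "t \<in> {x ^ i * C.F1 ^ a * C.F2 ^ b | i a b. b < n}"
  then obtain i a b i' a' b' where s: "s = x ^ i * C.F1 ^ a * C.F2 ^ b" "b < m"
    and t: "t = x ^ i' * C.F1 ^ a' * C.F2 ^ b'" "b' < n" by blast
  have "s * t = x ^ (i + i') * C.F1 ^ (a + a') * C.F2 ^ (b + b')" unfolding s t power_add by (simp only: mult_ac)
  moreover have "b + b' < k" using s t mn by simp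
  ultimately show "s * t \<in> mpoly_vs.span {x ^ i * C.F1 ^ a * C.F2 ^ b | i a b. b < k}"
    by (intro mpoly_vs.span_base) blast
qed

lemma D_x: "x ^ n \<in> D 1" and D_F1: "C.F1 ^ n \<in> D 1" and D_F2: "C.F2 ^ n \<in> D (n + 1)"
  using D_gen[of 0 1 n 0] D_gen[of 0 1 0 n] D_gen[of n "n + 1" 0 0] by simp_all

lemma D_power: "f \<in> D (m + 1) \<Longrightarrow> f ^ n \<in> D (n * m + 1)"
proof (induction n)
  case (Suc n)
  then show ?case using D_mult[of f "m + 1" "f ^ n" "n * m + 1" "Suc n * m + 1"] by simp
qed (use D_x[of 0] in simp)

lemma G_D: "C.G \<in> D 2"
proof -
  have "C.G = mconst (1 / g0) * (mconst g0 * C.G)" by (rule mconst_inverse_cancel[OF nz(1), symmetric])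
  also have "mconst g0 * C.G = mconst 2 * (x ^ (p^2 - 2 * p) * C.F1 ^ 0 * C.F2 ^ 1) - x ^ 0 * C.F1 ^ 2 * C.F2 ^ 0"
    using C.F2_eq by (simp add: algebra_simps)
  finally have eq: "C.G = mconst (1 / g0) * (mconst 2 * (x ^ (p^2 - 2 * p) * C.F1 ^ 0 * C.F2 ^ 1) - x ^ 0 * C.F1 ^ 2 * C.F2 ^ 0)" .
  show ?thesis by (subst eq) (intro D_mconst D_diff D_gen; simp)
qed

text \<open>\<open>G\<close> is linear in \<open>F2\<close>, so its exponent b bounds that of
  \<open>F2\<close>. The sharper second bound, b < p^2 from 2 p^2 b < 2 p^4, is made for the
  norm.\<close>

lemma Q_D: "Q w \<subseteq> D (w div p^2 + 1)" and Q_D': "Q (2 * p^4) \<subseteq> D (p^2)"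
proof -
  have gen: "x ^ i * C.F1 ^ a * C.G ^ b \<in> D (b + 1)" for i a b
  proof -
    have "x ^ i * C.F1 ^ a \<in> D 1" using D_gen[of 0 1 i a] by simp
    moreover have "C.G ^ b \<in> D (b + 1)" using D_power[of C.G 1 b] G_D by (simp add: numeral_2_eq_2)
    ultimately show ?thesis by (rule D_mult) simp
  qed
  show "Q w \<subseteq> D (w div p^2 + 1)"
    unfolding Q_def
  proof (subst D_def, rule mpoly_vs.span_minimal, clarify, fold D_def)
    fix i a b assume "p^2 * (a + 2 * b) < w"
    then have "p^2 * b \<le> w" by (metis add_leE less_imp_le_nat mult_2 distrib_left)
    then have "b \<le> w div p^2" using p by (simp add: less_eq_div_iff_mult_less_eq mult.commute)
    then show "x ^ i * C.F1 ^ a * C.G ^ b \<in> D (w div p^2 + 1)" by (intro D_mono[OF gen]) simp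
  qed (unfold D_def, rule mpoly_vs.subspace_span)
  show "Q (2 * p^4) \<subseteq> D (p^2)"
    unfolding Q_def
  proof (subst D_def, rule mpoly_vs.span_minimal, clarify, fold D_def)
    fix i a b assume "p^2 * (a + 2 * b) < 2 * p^4"
    then have "p^2 * (a + 2 * b) < p^2 * (2 * p^2)" by (simp add: eval_nat_numeral mult_ac)
    then have "b + 1 \<le> p^2" by simp
    then show "x ^ i * C.F1 ^ a * C.G ^ b \<in> D (p^2)" by (rule D_mono[OF gen])
  qed (unfold D_def, rule mpoly_vs.subspace_span)
qed

lemma Inv_D: "f \<in> Inv \<Longrightarrow> \<exists>n m. x ^ n * f \<in> D m"
proof -
  assume f: "f \<in> Inv"
  obtain n w where "x ^ n * f \<in> Wt w" using every_Wt by blast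
  moreover have "x ^ n * f \<in> Inv" using f by (intro Inv_mult Inv_power Inv_x)
  ultimately have "x ^ n * f \<in> Q w" by (rule Inv_Wt_Q)
  then show ?thesis using Q_D by blast
qed

subsection \<open>The norm of \<open>z\<close>\<close>

definition linf :: "'a \<times> 'a \<Rightarrow> (xyz, 'a) mpoly"
  where "linf = (\<lambda>(c, v). tr c v z)"

lemma linf_eq: "linf (c, v) = z + mconst (2 * c) * y + mconst (c ^ 2 - v) * x"
  by (simp add: linf_def)

lemma linf_single: "linf (c, v) = single (xm 0 0 1) 1 + single (xm 0 1 0) (2 * c)
    + single (xm 1 0 0) (c ^ 2 - v)"
  by (simp add: linf_eq mvar_def mconst_def mult_single)

text \<open>\<open>norm_z\<close> multiplies over the set of orbit elements; injectivity turns this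
  into a product over \<open>Lam\<close>.\<close>

lemma inj_linf: "inj linf"
proof (rule injI, clarify)
  fix c v c' v' assume eq: "linf (c, v) = linf (c', v')"
  have "lookup (linf (c, v)) (xm 0 1 0) = 2 * c" "lookup (linf (c, v)) (xm 1 0 0) = c ^ 2 - v" for c v
    unfolding linf_single by (simp_all add: lookup_add lookup_single)
  then have "2 * c = 2 * c'" "c ^ 2 - v = c' ^ 2 - v'" using eq by metis+
  then show "c = c' \<and> v = v'" using two_nz' by simp
qed

lemma norm_z_eq: "norm_z p M = (\<Prod>l\<in>Lam. linf l)"
proof -
  have "act M z a = linf (lamv M 1 a, - lamv M 2 a)" if "a \<in> E" for a
    unfolding linf_def prod.case using that unfolding E_eq by (intro act_tr) (auto simp: PiE_iff)
  then have "act M z ` E = linf ` Lam" unfolding Lam_def image_image by (intro image_cong) auto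
  then show ?thesis unfolding norm_z_def
    by (simp add: prod.reindex[OF inj_on_subset[OF inj_linf]])
qed

lemma Inv_norm: "norm_z p M \<in> Inv"
proof (rule InvI)
  fix c v assume l: "(c, v) \<in> Lam"
  let ?s = "\<lambda>(c', v'). (c + c', v + v')"
  have "inj_on ?s Lam" by (auto simp: inj_on_def)
  moreover have sub: "?s ` Lam \<subseteq> Lam" using Lam_add[OF l] by auto
  ultimately have "bij_betw ?s Lam Lam"
    using endo_inj_surj[OF card_Lam(2)] by (simp add: bij_betw_def)
  then have "(\<Prod>k\<in>Lam. linf (?s k)) = (\<Prod>k\<in>Lam. linf k)"
    by (rule prod.reindex_bij_betw)
  moreover have "tr c v (\<Prod>k\<in>Lam. linf k) = (\<Prod>k\<in>Lam. linf (?s k))"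
    unfolding tr_simps by (intro prod.cong refl) (auto simp: linf_def tr_tr simp del: tr_mvar)
  ultimately show "tr c v (norm_z p M) = norm_z p M" by (simp add: norm_z_eq)
qed

lemma norm_leads: "leads3 (norm_z p M) (xm 0 0 (p^4))" "homog (p^4) (norm_z p M)"
proof -
  have lin: "leads3 (linf l) (xm 0 0 1)" for l
  proof (cases l)
    case (Pair c v)
    have K: "s = xm 0 0 1 \<or> s = xm 0 1 0 \<or> s = xm 1 0 0" if "s \<in> keys (linf (c, v))" for s
      using that unfolding linf_single by (auto simp: in_keys_iff lookup_add lookup_single when_def split: if_splits)
    have 1: "lookup (linf (c, v)) (xm 0 0 1) = 1"
      unfolding linf_single by (simp add: lookup_add lookup_single)
    have k: "key3 (xm 0 1 0) < key3 (xm 0 0 1)" "key3 (xm 1 0 0) < key3 (xm 0 0 1)"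
      by (simp_all add: key3_def)
    show ?thesis unfolding Pair leads_def
    proof (intro conjI ballI impI)
      show "xm 0 0 1 \<in> keys (linf (c, v))" using 1 by (simp only: in_keys_iff) simp
      fix s assume "s \<in> keys (linf (c, v))" "s \<noteq> xm 0 0 1"
      then show "key3 s < key3 (xm 0 0 1)" using K[of s] k by blast
    qed
  qed
  have "leads3 (\<Prod>l\<in>T. linf l) (xm 0 0 (card T))" if "finite T" for T
    using that
  proof (induction T rule: finite_induct)
    case empty
    show ?case using leads_one[of key3] by (simp add: xm_0)
  next
    case (insert l T)
    then show ?case using leads_mult(1)[OF compat_key3 lin insert.IH, of l] by (simp add: xm_add)
  qed
  from this[OF card_Lam(2)] show "leads3 (norm_z p M) (xm 0 0 (p^4))" by (simp add: norm_z_eq card_Lam)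
  have "homog 1 (linf l)" for l
    by (cases l) (simp only: linf_eq, intro homog_add homog_mconst_mult homog_mvar)
  then have "homog (\<Sum>l\<in>Lam. 1) (norm_z p M)" unfolding norm_z_eq by (intro homog_prod)
  then show "homog (p^4) (norm_z p M)" by (simp add: card_Lam)
qed

text \<open>Times \<open>x\<close>, each linear form is y^2 - delta up to terms of weight at most 1,
  and leading forms multiply.\<close>

lemma x_linf_prod:
  assumes "finite T"
  shows "(\<Prod>l\<in>T. x * linf l) - (y ^ 2 - C.dl) ^ card T \<in> Wt (2 * card T)"
    and "(\<Prod>l\<in>T. x * linf l) \<in> Wt (2 * card T + 1)"
proof -
  have xl: "x * linf l - (y ^ 2 - C.dl) \<in> Wt 2" for l
  proof (cases l)
    case (Pair c v)
    have "x * linf l - (y ^ 2 - C.dl) = mconst (2 * c) * (x ^ 1 * y ^ 1 * C.dl ^ 0) + mconst (c ^ 2 - v) * (x ^ 2 * y ^ 0 * C.dl ^ 0)"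
      by (simp add: Pair linf_eq C.dl_def algebra_simps power2_eq_square)
    also have "\<dots> \<in> Wt 2" by (intro Wt_add Wt_mconst Wt_gen) simp_all
    finally show ?thesis .
  qed
  have main: "(\<Prod>l\<in>T. x * linf l) - (y ^ 2 - C.dl) ^ card T \<in> Wt (2 * card T)"
    using assms
  proof (induction T rule: finite_induct)
    case (insert l T)
    let ?S = "y ^ 2 - C.dl" and ?P = "\<Prod>l\<in>T. x * linf l"
    have "x * linf l = (x * linf l - ?S) + ?S" by simp
    also have "\<dots> \<in> Wt 3" using Wt_mono[OF xl, of 3 l] Wt_S by (intro Wt_add) simp_all
    finally have 1: "x * linf l \<in> Wt 3" .
    have 2: "?S ^ card T \<in> Wt (2 * card T + 1)"
      using Wt_power[of ?S 2 "card T"] Wt_S by (simp add: mult.commute)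
    have "(x * linf l) * (?P - ?S ^ card T) + (x * linf l - ?S) * ?S ^ card T \<in> Wt (2 * card T + 2)"
      by (intro Wt_add Wt_mult[OF 1 insert.IH] Wt_mult[OF xl 2]) simp_all
    then show ?case using insert.hyps by (simp add: algebra_simps)
  qed (simp add: Wt_0)
  show "(\<Prod>l\<in>T. x * linf l) - (y ^ 2 - C.dl) ^ card T \<in> Wt (2 * card T)" by (rule main)
  have "(y ^ 2 - C.dl) ^ card T \<in> Wt (2 * card T + 1)"
    using Wt_power[of "y ^ 2 - C.dl" 2 "card T"] Wt_S by (simp add: mult.commute)
  from Wt_add[OF Wt_mono[OF main] this] show "(\<Prod>l\<in>T. x * linf l) \<in> Wt (2 * card T + 1)" by simp
qed

lemma Wt_power_diff:
  assumes "u - v \<in> Wt w" "u \<in> Wt (w + 1)" "v \<in> Wt (w + 1)"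
  shows "u ^ n - v ^ n \<in> Wt (n * w)"
proof (induction n)
  case (Suc n)
  have "u * (u ^ n - v ^ n) + (u - v) * v ^ n \<in> Wt (Suc n * w)"
    by (intro Wt_add Wt_mult[OF assms(2) Suc] Wt_mult[OF assms(1) Wt_power[OF assms(3)]]) simp_all
  then show ?case by (simp add: algebra_simps)
qed (simp add: Wt_0)

text \<open>With \<open>y\<close> and \<open>delta\<close> of weights 1 and 2, the leading form of \<open>x\<^sup>N N(z)\<close> is a power of
  \<open>y\<^sup>2 - delta\<close>, as is that of \<open>fbar1\<^sup>2 + gamma fbar12346\<close>, a multiple of \<open>fbar2\<close>.\<close>

lemma norm_monic:
  obtains \<kappa> m n where "\<kappa> \<noteq> 0" "x ^ n * norm_z p M - mconst \<kappa> * (x ^ m * C.F2 ^ (p^2)) \<in> D (p^2)"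
proof -
  let ?S = "y ^ 2 - C.dl"
  \<comment> \<open>\<open>u\<close> equals \<open>2 * x ^ (p^2 - 2 * p) * F2\<close> by
    \<open>F2_eq\<close>, and \<open>v\<close> is its leading form.\<close>
  define u where "u = C.F1^2 + mconst g0 * C.G"
  define v where "v = mconst (g0^2) * ?S ^ (p^2)"
  have S: "?S ^ (p^2) = y ^ (2 * p^2) - C.dl ^ (p^2)"
  proof -
    have "?S ^ (p^2) = (?S ^ p) ^ p" by (simp add: power2_eq_square power_mult)
    also have "\<dots> = ((y ^ 2) ^ p) ^ p - (C.dl ^ p) ^ p" unfolding C.fdiff ..
    also have "((y ^ 2) ^ p) ^ p = y ^ (2 * p^2)"
      unfolding power_mult[symmetric] by (rule arg_cong[where f = "power y"]) (simp add: power2_eq_square)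
    also have "(C.dl ^ p) ^ p = C.dl ^ (p^2)" by (simp only: power2_eq_square power_mult)
    finally show ?thesis .
  qed
  have p4: "p^2 * p^2 = p^4" by (simp flip: power_add)
  have p2: "3 * p \<le> p^2" by (rule C.p2)
  have ph: "C.ph \<in> Wt (2 * p + 1)" and ps: "C.ps \<in> Wt (2 * p + 1)"
    unfolding C.ph_def C.ps_def by (rule Wt_form)+
  have "u - v = mconst (2 * g0) * (x ^ (p^2 - 2 * p) * (y ^ (p^2) * C.ph)) + x ^ (2 * (p^2 - 2 * p)) * (C.ph * C.ph)
      + mconst g0 * (x ^ (2 * p^2 - 2 * p) * C.ps)"
  proof -
    have yy: "y ^ (2 * p^2) = y ^ (p^2) * y ^ (p^2)"
      and xx: "x ^ (2 * (p^2 - 2 * p)) = x ^ (p^2 - 2 * p) * x ^ (p^2 - 2 * p)"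
      by (simp_all only: mult_2 power_add)
    have alg: "(gg * Y + X * f)^2 + gg * (- gg * dd + T * s) - gg^2 * (Y * Y - dd) =
        2 * gg * (X * (Y * f)) + X * X * (f * f) + gg * (T * s)" for gg Y X f dd T s :: "(xyz, 'a) mpoly"
      by (simp add: algebra_simps power2_eq_square)
    show ?thesis
      unfolding u_def v_def S C.F1_def C.G_def yy mconst_power alg xx mconst_mult mconst_numeral ..
  qed
  also have "\<dots> \<in> Wt (2 * p^2)"
    using p2 p3 by (intro Wt_add Wt_mconst Wt_xmult Wt_mult[OF Wt_y ph] Wt_mult[OF ph ph] Wt_mono[OF ps]) simp_all
  finally have uv: "u - v \<in> Wt (2 * p^2)" .
  have v1: "v \<in> Wt (2 * p^2 + 1)"
    unfolding v_def using Wt_power[of ?S 2 "p^2"] Wt_S by (intro Wt_mconst) (simp add: mult.commute)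
  have u1: "u \<in> Wt (2 * p^2 + 1)"
    using Wt_add[OF Wt_mono[OF uv] v1] by simp
  have d1: "u ^ (p^2) - v ^ (p^2) \<in> Wt (2 * p^4)"
  proof -
    have "p^2 * (2 * p^2) = 2 * p^4" unfolding p4[symmetric] by (rule mult.left_commute)
    then show ?thesis using Wt_power_diff[OF uv u1 v1, of "p^2"] by (simp only:)
  qed
  have vp: "v ^ (p^2) = mconst ((g0^2) ^ (p^2)) * ?S ^ (p^4)"
    unfolding v_def power_mult_distrib mconst_power power_mult[symmetric] p4 ..
  define c where "c = (g0^2) ^ (p^2)"
  have c: "c \<noteq> 0" using nz(1) by (simp add: c_def)
  have "x ^ (p^4) * norm_z p M = (\<Prod>l\<in>Lam. x * linf l)"
    by (simp add: norm_z_eq prod.distrib card_Lam)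
  then have d2: "x ^ (p^4) * norm_z p M - ?S ^ (p^4) \<in> Wt (2 * p^4)"
    using x_linf_prod(1)[OF card_Lam(2)] by (simp add: card_Lam)
  \<comment> \<open>Both terms have the leading form (y^2 - delta)^(p^4), so the difference has
    weight below 2p^4. Being invariant, it lies in \<open>D (p^2)\<close> by \<open>Inv_Wt_Q\<close>
    and \<open>Q_D'\<close>.\<close>
  have "x ^ (p^4) * norm_z p M - mconst (1 / c) * u ^ (p^2) =
      (x ^ (p^4) * norm_z p M - ?S ^ (p^4)) - mconst (1 / c) * (u ^ (p^2) - v ^ (p^2))"
    unfolding vp c_def[symmetric] using mconst_inverse_cancel[OF c, of "?S ^ (p^4)"] by (simp add: right_diff_distrib)
  also have "\<dots> \<in> Wt (2 * p^4)" by (intro Wt_diff Wt_mconst d1 d2)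
  finally have "x ^ (p^4) * norm_z p M - mconst (1 / c) * u ^ (p^2) \<in> Wt (2 * p^4)" .
  moreover have "x ^ (p^4) * norm_z p M - mconst (1 / c) * u ^ (p^2) \<in> Inv"
    unfolding u_def by (intro Inv_diff Inv_mult Inv_power Inv_add Inv_x Inv_norm Inv_mconst Inv_F1 Inv_G)
  ultimately have "x ^ (p^4) * norm_z p M - mconst (1 / c) * u ^ (p^2) \<in> D (p^2)"
    using Inv_Wt_Q Q_D' by blast
  moreover have "mconst (1 / c) * u ^ (p^2) = mconst (1 / c * 2 ^ (p^2)) * (x ^ ((p^2 - 2 * p) * p^2) * C.F2 ^ (p^2))"
    unfolding u_def C.F2_eq[symmetric] power_mult_distrib mconst_mult mconst_power mconst_numeral power_mult[symmetric]
    by (simp only: mult_ac)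
  moreover have "1 / c * 2 ^ (p^2) \<noteq> 0" using c two_nz' by simp
  ultimately show thesis using that by metis
qed

end

subsection \<open>The third generator\<close>

lemma lookup_single_mult:
  "lookup (single s 1 * f) (s + t) = lookup (f :: ('v, 'a::comm_ring_1) mpoly) t"
proof -
  have "single s 1 * f = (\<Sum>u\<in>keys f. single (s + u) (lookup f u))"
    by (subst mpoly_expand[of f]) (simp add: sum_distrib_left mult_single)
  then show ?thesis
    by (simp add: lookup_sum lookup_single when_def in_keys_iff)
qed

lemma keys_mvar_power_mult:
  assumes "s \<in> keys (mvar v ^ n * f)"
  shows "n \<le> lookup s v"
proof -
  obtain u where "s = single v n + u"
    using assms keys_mult[of "mvar v ^ n" f] by (auto simp: mvar_power split: if_splits)
  then show ?thesis by (simp add: lookup_add)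
qed

lemma homog_mvar_power_cancel:
  assumes "homog (n + d) (mvar v ^ n * f)"
  shows "homog d f"
  unfolding homog_def
proof
  fix t assume "t \<in> keys f"
  then have "single v n + t \<in> keys (mvar v ^ n * f)"
    by (simp only: in_keys_iff mvar_power lookup_single_mult not_False_eq_True)
  then have "total_degree (single v n + t) = n + d" using assms unfolding homog_def by blast
  then show "total_degree t = d" by (simp add: total_degree_add del: xm_simps)
qed

lemma mvar_power_mult_unique:
  fixes g g' :: "('v::linorder, 'a::idom) mpoly"
  assumes "mvar v ^ m * g = mvar v ^ n * g'" "\<not> mvar v dvd g" "\<not> mvar v dvd g'"
  shows "m = n \<and> g = g'"
proof -
  have nz: "(mvar v :: ('v, 'a) mpoly) \<noteq> 0" by (rule mvar_nz)
  have le: "n \<le> m" if "mvar v ^ m * g = mvar v ^ n * g'" "\<not> mvar v dvd g" for m n and g g' :: "('v, 'a) mpoly"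
  proof (rule ccontr)
    assume "\<not> n \<le> m"
    then obtain k where "n = m + Suc k" using less_imp_Suc_add[of m n] by auto
    then have "mvar v ^ m * g = mvar v ^ m * (mvar v * (mvar v ^ k * g'))"
      using that(1) by (simp add: power_add mult.assoc)
    then have "g = mvar v * (mvar v ^ k * g')" using nz by simp
    then show False using that(2) by (metis dvd_triv_left)
  qed
  have "m = n" using le[OF assms(1,2)] le[OF assms(1)[symmetric] assms(3)] by simp
  then show ?thesis using assms(1) nz by simp
qed

text \<open>All other monomials of \<open>f\<close> involve \<open>X\<close>, and in equal degree
  such monomials are smaller than the power of \<open>Y\<close>.\<close>

lemma leads3_Y:
  fixes f :: "(xyz, 'a::comm_ring_1) mpoly"
  assumes "homog d f" "cg (mvar X) f (mconst c * mvar Y ^ d)" "c \<noteq> 0"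
  shows "leads3 f (xm 0 d 0)" "lookup f (xm 0 d 0) = c"
proof -
  obtain r where "f - mconst c * mvar Y ^ d = mvar X * r" using assms(2) by (auto simp: cg_def)
  then have r: "f = mconst c * mvar Y ^ d + mvar X ^ 1 * r" by (simp add: algebra_simps)
  have X: "lookup (mvar X ^ 1 * r) s = 0" if "lookup s X = 0" for s
    using keys_mvar_power_mult[of s X 1 r] that by (metis in_keys_iff not_one_le_zero)
  show 1: "lookup f (xm 0 d 0) = c"
  proof -
    have "lookup (mvar X ^ 1 * r) (xm 0 d 0) = 0" by (rule X) simp
    then show ?thesis unfolding r lookup_add by (simp add: mvar_power del: power_one_right)
  qed
  show "leads3 f (xm 0 d 0)"
    unfolding leads_def
  proof (intro conjI ballI impI)
    show "xm 0 d 0 \<in> keys f" using 1 assms(3) by (simp add: in_keys_iff)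
    fix s assume s: "s \<in> keys f" "s \<noteq> xm 0 d 0"
    have d: "total_degree s = d" using assms(1) s(1) by (simp add: homog_def)
    have "lookup s X \<noteq> 0"
    proof
      assume "lookup s X = 0"
      then have "lookup f s = c * lookup (mvar Y ^ d) s"
        unfolding r lookup_add using X by (simp del: power_one_right)
      then have "lookup f s = 0" using s(2) by (simp add: mvar_power lookup_single when_def)
      then show False using s(1) by (simp add: in_keys_iff)
    qed
    then show "key3 s < key3 (xm 0 d 0)" using d by (simp add: key3_def total_degree_xyz)
  qed
qed

text \<open>Modulo the odd number \<open>p\<close> the factor 2 can be cancelled, which determines i
  among the residues.\<close>

lemma odd_split_unique:
  fixes p i i' A A' :: nat
  assumes "odd p" "i < p" "i' < p" "p * A + 2 * i = p * A' + 2 * i'"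
  shows "i = i' \<and> A = A'"
proof -
  have le: "i' \<le> i" if "i' < p" "p * A + 2 * i = p * A' + 2 * i'" for i i' A A'
  proof (rule ccontr)
    assume "\<not> i' \<le> i"
    then have "p * A = p * A' + 2 * (i' - i)" using that(2) by simp
    then have "p dvd 2 * (i' - i)" by (metis dvd_add_right_iff dvd_triv_left)
    then have "p dvd i' - i" using assms(1) by (simp add: coprime_dvd_mult_right_iff)
    then show False using \<open>\<not> i' \<le> i\<close> that(1) by (auto dest: dvd_imp_le)
  qed
  have "i = i'" using le[OF assms(3,4)] le[OF assms(2) assms(4)[symmetric]] by simp
  then show ?thesis using assms by auto
qed

context rank_four
begin

lemma homog_forms: "homog (2 * p) C.ph" "homog (2 * p) C.ps" "homog (p^2) C.F1" "homog (p^2 + 2 * p) C.F2"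
proof -
  have e: "x ^ n = mconst 1 * x ^ n" for n by simp
  have dl: "homog 2 C.dl"
    unfolding C.dl_def
    using homog_power[OF homog_mvar, of 2 Y] homog_mult[OF homog_mvar homog_mvar, of X Z]
    by (intro homog_diff) (simp_all add: numeral_2_eq_2)
  have pw: "homog n (mvar v ^ n)" for n v using homog_power[OF homog_mvar, of n v] by simp
  have dlp: "homog (2 * n) (C.dl ^ n)" for n using homog_power[OF dl, of n] by (simp add: mult.commute)
  have m: "homog k (f * g)" if "homog i f" "homog j g" "i + j = k" for i j k and f g :: "(xyz, 'a) mpoly"
    using homog_mult[OF that(1,2)] that(3) by simp
  have form: "homog (2 * p) (mconst s1 * C.dl ^ p + mconst s2 * x ^ p * y ^ p + mconst s3 * x ^ (2 * p - 2) * C.dl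
      + mconst s4 * x ^ (2 * p - 1) * y)" for s1 s2 s3 s4
    unfolding mult.assoc using p
    by (intro homog_add homog_mconst_mult dlp m[OF pw pw] m[OF pw dl] m[OF pw homog_mvar]) simp_all
  show ph: "homog (2 * p) C.ph" and ps: "homog (2 * p) C.ps"
    unfolding C.ph_def C.ps_def by (rule form)+
  show "homog (p^2) C.F1"
    unfolding C.F1_def using C.p2 by (intro homog_add homog_mconst_mult pw m[OF pw ph]) simp
  have "homog (p^2 + 2 * p) (mconst (1 / 2 * g0^2) * (x ^ (2 * p) * z ^ (p^2)) + mconst g0 * (y ^ (p^2) * C.ph)
      + mconst (1 / 2) * (x ^ (p^2 - 2 * p) * (C.ph * C.ph)) + mconst (1 / 2 * g0) * (x ^ (p^2) * C.ps))"
    using C.p2 by (intro homog_add homog_mconst_mult m[OF pw pw] m[OF pw ph] m[OF pw ps] m[OF pw m[OF ph ph refl]]) simp_all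
  then show "homog (p^2 + 2 * p) C.F2"
    unfolding C.F2_def mconst_mult mconst_power by (simp only: power2_eq_square[of C.ph] mult.assoc)
qed

lemma leads_F1: "leads3 C.F1 (xm 0 (p^2) 0)" "lookup C.F1 (xm 0 (p^2) 0) = g0"
proof -
  have "x ^ 1 dvd x ^ (p^2 - 2 * p)" by (rule le_imp_power_dvd) (use C.p2 p in linarith)
  then have "cg x C.F1 (mconst g0 * y ^ (p^2))" unfolding C.F1_def by (intro cg_drop dvd_mult2) simp
  then show "leads3 C.F1 (xm 0 (p^2) 0)" "lookup C.F1 (xm 0 (p^2) 0) = g0"
    using leads3_Y[OF homog_forms(3)] nz(1) by blast+
qed

lemma leads_F2: "leads3 C.F2 (xm 0 (p^2 + 2 * p) 0)"
  "lookup C.F2 (xm 0 (p^2 + 2 * p) 0) = g0 * gam p M 1 2 3 5"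
proof -
  have pw: "x dvd x ^ n" if "n > 0" for n using that by simp
  have "cg x C.ph (mconst (gam p M 1 2 3 5) * y ^ (2 * p))"
    using cg_mono[OF pw C.ph_cg] p by simp
  then have 1: "cg x (mconst g0 * y ^ (p^2) * C.ph) (mconst g0 * y ^ (p^2) * (mconst (gam p M 1 2 3 5) * y ^ (2 * p)))"
    by (intro cg_mult cg_refl)
  have 2: "cg x C.F2 (mconst g0 * y ^ (p^2) * C.ph)"
  proof -
    have d: "x dvd mconst (1/2) * mconst g0 ^ 2 * x ^ (2 * p) * z ^ (p^2)"
      "x dvd mconst (1/2) * x ^ (p^2 - 2 * p) * C.ph ^ 2" "x dvd mconst (1/2) * mconst g0 * x ^ (p^2) * C.ps"
      using C.p2 p by (intro dvd_mult2 dvd_mult pw; simp)+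
    have "C.F2 = mconst g0 * y ^ (p^2) * C.ph + (mconst (1/2) * mconst g0 ^ 2 * x ^ (2 * p) * z ^ (p^2)
      + (mconst (1/2) * x ^ (p^2 - 2 * p) * C.ph ^ 2 + mconst (1/2) * mconst g0 * x ^ (p^2) * C.ps))"
      unfolding C.F2_def by (simp only: ac_simps)
    then show ?thesis using cg_drop[OF dvd_add[OF d(1) dvd_add[OF d(2,3)]]] by simp
  qed
  have "mconst g0 * y ^ (p^2) * (mconst (gam p M 1 2 3 5) * y ^ (2 * p)) = mconst (g0 * gam p M 1 2 3 5) * y ^ (p^2 + 2 * p)"
    unfolding mconst_mult power_add by (simp only: mult_ac)
  then have "cg x C.F2 (mconst (g0 * gam p M 1 2 3 5) * y ^ (p^2 + 2 * p))" using cg_trans[OF 2 1] by simp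
  moreover have "g0 * gam p M 1 2 3 5 \<noteq> 0" using nz by simp
  ultimately show "leads3 C.F2 (xm 0 (p^2 + 2 * p) 0)"
    "lookup C.F2 (xm 0 (p^2 + 2 * p) 0) = g0 * gam p M 1 2 3 5"
    using leads3_Y[OF homog_forms(4)] by blast+
qed

lemma F_nz: "C.F1 \<noteq> 0" "C.F2 \<noteq> 0"
  using leads_F1 leads_F2 by (auto simp: leads3_iff)

text \<open>The correction terms of the explicit formula for \<open>fbar3\<close>. Three
  coefficients are parameters because they are to be solved for; at p = 3 they absorb the
  contributions of \<open>eps\<close> and \<open>tt\<close>.\<close>

definition tail :: "'a \<Rightarrow> 'a \<Rightarrow> 'a \<Rightarrow> (xyz, 'a) mpoly"
  where "tail s2 s3 s4 = - mconst (2 * gam p M 1 2 3 5 ^ p) * (x ^ (p^2 - 2 * p) * C.F1 ^ p * C.F2 ^ 1)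
    + mconst s2 * (x ^ (p^2) * C.F1 ^ (p + 1) * C.F2 ^ 0)
    + mconst s3 * (x ^ (2 * p^2 - 2 * p) * C.F1 ^ (p - 1) * C.F2 ^ 1)
    + mconst s4 * (x ^ (2 * p^2 - p) * C.F1 ^ ((p - 3) div 2) * C.F2 ^ ((p + 1) div 2))"

lemma pair_degrees: "(p + 2) * p^2 = p^3 + 2 * p^2" "p * (p^2 + 2 * p) = p^3 + 2 * p^2"
  by (simp_all add: power2_eq_square power3_eq_cube algebra_simps)

lemma tail_degrees:
  "p^2 - 2 * p + p^2 * p + (p^2 + 2 * p) * 1 = p^3 + 2 * p^2"
  "p^2 + p^2 * (p + 1) + (p^2 + 2 * p) * 0 = p^3 + 2 * p^2"
  "2 * p^2 - 2 * p + p^2 * (p - 1) + (p^2 + 2 * p) * 1 = p^3 + 2 * p^2"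
  "2 * p^2 - p + p^2 * ((p - 3) div 2) + (p^2 + 2 * p) * ((p + 1) div 2) = p^3 + 2 * p^2"
proof -
  have p32: "p^3 = p * p^2" "p^3 = p^2 * p" by (simp_all add: power2_eq_square power3_eq_cube)
  show "p^2 - 2 * p + p^2 * p + (p^2 + 2 * p) * 1 = p^3 + 2 * p^2"
    "p^2 + p^2 * (p + 1) + (p^2 + 2 * p) * 0 = p^3 + 2 * p^2"
    using C.p2 by (simp_all add: p32(2) distrib_left)
  define T where "T = p^2 * (p - 1)"
  have "T + p^2 = p^3" using p by (simp add: T_def p32(2) algebra_simps)
  moreover have "2 * q - 2 * p + t + (q + 2 * p) * 1 = r + 2 * q" if "t + q = r" "3 * p \<le> q" for q r t :: nat
    using that by arith
  ultimately show "2 * p^2 - 2 * p + p^2 * (p - 1) + (p^2 + 2 * p) * 1 = p^3 + 2 * p^2"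
    using C.p2 unfolding T_def by blast
  define k where "k = (p - 3) div 2"
  have k: "p = 2 * k + 3" unfolding k_def using C.p3 by presburger
  have d: "(p + 1) div 2 = k + 2" by (simp add: k)
  have "(2 * k + 2) * p^2 + 2 * p * (k + 2) = p^3 + p"
    unfolding p32(1) by (simp add: k power2_eq_square algebra_simps)
  then have "p^2 * k + (p^2 + 2 * p) * (k + 2) = p^3 + p" by (simp add: algebra_simps)
  then show "2 * p^2 - p + p^2 * ((p - 3) div 2) + (p^2 + 2 * p) * ((p + 1) div 2) = p^3 + 2 * p^2"
    unfolding d k_def[symmetric] using C.p2 by linarith
qed

text \<open>\<open>final_congruence\<close> with its triangular equations solved. The divisors are
  products of powers of the minors 1234 and 1235; the minor 1357 enters through the coefficient
  \<open>C3\<close>.\<close>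

lemma fbar3_unscaled:
  obtains s2 s3 s4 C3 g3 where "C3 \<noteq> 0" "homog (p^3 + 2) g3" "cg x g3 (mconst C3 * y ^ (p^3 + 2))"
    "mconst (gam p M 1 2 3 5 ^ p) * C.F1 ^ (p + 2) - mconst (g0^2) * C.F2 ^ p + tail s2 s3 s4 = x ^ (2 * p^2 - 2) * g3"
proof -
  let ?a = "gam p M 1 2 3 5" and ?b = "gam p M 1 2 4 5" and ?c = "gam p M 1 3 4 5" and ?d = "gam p M 2 3 4 5"
    and ?a' = "gam p M 1 2 3 6" and ?b' = "gam p M 1 2 4 6" and ?c' = "gam p M 1 3 4 6" and ?d' = "gam p M 2 3 4 6"
  define e0 where "e0 = (if p = 3 then 1 / 2 * g0^2 * (?a ^ p)^2 else 0)"
  define t0 where "t0 = (if p = 3 then g0^2 * (1 / 2 + 2) * ?a^2 else 0)"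
  have e0: "C.eps = mconst e0"
    unfolding C.eps_def e0_def by (simp only: mconst_mult mconst_power mconst_0 if_distrib[of mconst])
  have t0: "C.tt = mconst t0"
    unfolding C.tt_def t0_def by (simp only: mconst_mult mconst_power mconst_add mconst_numeral mconst_0 if_distrib[of mconst])
  define s2 where "s2 = (g0^2 * g0 ^ p * ?b ^ p - e0) / (g0 * g0 ^ p)"
  define s3 where "s3 = - (s2 * g0 ^ p * ?a - g0 * g0 ^ p * (?a ^ p * ?a' + g0 * ?c ^ p)) / (g0 ^ p * ?a)"
  define s4 where "s4 = - (s2 * g0 ^ p * ?b - g0 * g0 ^ p * (?a ^ p * ?b' + g0 * ?d ^ p) + s3 * (g0 ^ p * ?b + t0))
    / (g0 ^ (p - 1) * ?a ^ ((p + 1) div 2))"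
  define C3 where "C3 = s2 * g0 ^ p * ?c - g0 * g0 ^ p * (?a ^ p * ?c') + s3 * (g0 ^ p * ?c)"
  have s2: "s2 * (g0 * g0 ^ p) = g0^2 * g0 ^ p * ?b ^ p - e0"
    and s3: "s3 * (g0 ^ p * ?a) = - (s2 * g0 ^ p * ?a - g0 * g0 ^ p * (?a ^ p * ?a' + g0 * ?c ^ p))"
    and s4: "s4 * (g0 ^ (p - 1) * ?a ^ ((p + 1) div 2)) =
      - (s2 * g0 ^ p * ?b - g0 * g0 ^ p * (?a ^ p * ?b' + g0 * ?d ^ p) + s3 * (g0 ^ p * ?b + t0))"
    unfolding s2_def[symmetric] using nz by (simp_all add: s2_def s3_def s4_def)
  \<comment> \<open>After multiplication by the minor 1235 the equation for \<open>s3\<close> can be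
    inserted; \<open>s2\<close> cancels, and up to a factor the left side of
    \<open>gam_identity\<close> remains.\<close>
  have "?a * C3 = s2 * g0 ^ p * ?c * ?a - g0 * g0 ^ p * ?a ^ p * (?a * ?c') + ?c * (s3 * (g0 ^ p * ?a))"
    unfolding C3_def by (simp add: algebra_simps)
  also have "\<dots> = - (g0 * g0 ^ p * (?a ^ p * (?a * ?c' - ?c * ?a') - g0 * (?c * ?c ^ p)))"
    unfolding s3 by (simp add: algebra_simps)
  also have "\<dots> = - (g0 * g0 ^ p * (g0 * g0 ^ p * gam p M 1 3 5 7))"
    unfolding gam_identity[OF p(1) char] ..
  finally have C3: "C3 \<noteq> 0" using nz by auto
  let ?F = "mconst (?a ^ p) * C.F1 ^ (p + 2) - mconst (g0^2) * C.F2 ^ p + tail s2 s3 s4"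
  have "cg (x ^ (2 * p^2 - 1)) (mconst ?a ^ p * C.F1 ^ (p + 2) - mconst g0^2 * C.F2 ^ p
      - 2 * mconst ?a ^ p * x ^ (p^2 - 2 * p) * C.F1 ^ p * C.F2
      + mconst s2 * x ^ (p^2) * C.F1 ^ (p + 1) + mconst s3 * x ^ (2 * p^2 - 2 * p) * (C.F1 ^ (p - 1) * C.F2)
      + mconst s4 * x ^ (2 * p^2 - p) * (C.F1 ^ ((p - 3) div 2) * C.F2 ^ ((p + 1) div 2)))
    (mconst C3 * x ^ (2 * p^2 - 2) * y ^ (p^3 + 2))"
    by (rule C.final_congruence)
      (simp_all only: e0 t0 mconst_mult[symmetric] mconst_power[symmetric] mconst_add[symmetric] mconst_diff[symmetric]
        mconst_uminus[symmetric] s2 s3 s4 C3_def)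
  also have "mconst ?a ^ p * C.F1 ^ (p + 2) - mconst g0^2 * C.F2 ^ p
      - 2 * mconst ?a ^ p * x ^ (p^2 - 2 * p) * C.F1 ^ p * C.F2
      + mconst s2 * x ^ (p^2) * C.F1 ^ (p + 1) + mconst s3 * x ^ (2 * p^2 - 2 * p) * (C.F1 ^ (p - 1) * C.F2)
      + mconst s4 * x ^ (2 * p^2 - p) * (C.F1 ^ ((p - 3) div 2) * C.F2 ^ ((p + 1) div 2)) = ?F"
    unfolding tail_def mconst_mult mconst_power mconst_numeral power_one_right power_0 mult_1_right
      minus_mult_left[symmetric] diff_conv_add_uminus
    by (simp only: add.assoc mult.assoc)
  finally obtain r where r: "?F - mconst C3 * x ^ (2 * p^2 - 2) * y ^ (p^3 + 2) = x ^ (2 * p^2 - 1) * r"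
    by (auto simp: cg_def)
  have "x ^ (2 * p^2 - 2) * x ^ 1 = x ^ (2 * p^2 - 1)" by (rule powadd) (use C.p2 p in linarith)
  then have X: "x ^ (2 * p^2 - 1) = x ^ (2 * p^2 - 2) * x" by simp
  define g3 where "g3 = mconst C3 * y ^ (p^3 + 2) + x * r"
  have "?F = (?F - mconst C3 * x ^ (2 * p^2 - 2) * y ^ (p^3 + 2)) + mconst C3 * x ^ (2 * p^2 - 2) * y ^ (p^3 + 2)" by (simp only: diff_add_cancel)
  also have "\<dots> = x ^ (2 * p^2 - 2) * g3"
    unfolding r X g3_def by (simp only: distrib_left mult_ac add.commute)
  finally have F: "?F = x ^ (2 * p^2 - 2) * g3" .
  have pw: "homog n (mvar v ^ n)" for n v using homog_power[OF homog_mvar, of n v] by simp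
  have hom: "homog k (x ^ i * C.F1 ^ a * C.F2 ^ b)" if "i + p^2 * a + (p^2 + 2 * p) * b = k" for i a b k
    using homog_mult[OF homog_mult[OF pw homog_power[OF homog_forms(3), of a]] homog_power[OF homog_forms(4), of b], of i X] that by (simp add: mult.commute)
  have "homog (p^3 + 2 * p^2) ?F"
    unfolding tail_def mconst_uminus[symmetric]
    by (intro homog_add homog_diff homog_mconst_mult homog_uminus hom tail_degrees
        homog_power[OF homog_forms(3), of "p + 2", unfolded pair_degrees] homog_power[OF homog_forms(4), of p, unfolded pair_degrees])
  moreover have "p^3 + 2 * p^2 = 2 * p^2 - 2 + (p^3 + 2)" using C.p2 p by linarith
  ultimately have "homog (2 * p^2 - 2 + (p^3 + 2)) ?F" by simp
  then have h3: "homog (p^3 + 2) g3" unfolding F by (rule homog_mvar_power_cancel)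
  have "cg x g3 (mconst C3 * y ^ (p^3 + 2))" unfolding g3_def by (intro cg_drop dvd_triv_left)
  from that[OF C3 h3 this F] show thesis .
qed

lemma D_tail: "tail s2 s3 s4 \<in> D p"
  unfolding tail_def mconst_uminus[symmetric]
  using p by (intro D_add D_mconst D_gen) simp_all

section \<open>The subduction that defines \<open>fbar3\<close>\<close>

definition gens3 :: "(xyz, 'a) mpoly list"
  where "gens3 = [x, C.F1, C.F2]"

definition deg3 :: "nat mono \<Rightarrow> nat"
  where "deg3 K = lookup K 0 + p^2 * lookup K 1 + (p^2 + 2 * p) * lookup K 2"

lemma bprod_gens3: "bprod gens3 K = x ^ lookup K 0 * C.F1 ^ lookup K 1 * C.F2 ^ lookup K 2"
proof -
  have "{..<length gens3} = {0, 1, 2}" by (auto simp: gens3_def)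
  then show ?thesis by (simp add: bprod_def gens3_def mult.assoc)
qed

lemma nz_gens3: "0 \<notin> set gens3"
  using F_nz by (auto simp: gens3_def)

lemma lead_mono_gens3: "lead_mono (bprod gens3 K) = xm (lookup K 0)
  (p^2 * lookup K 1 + (p^2 + 2 * p) * lookup K 2) 0"
proof -
  have lx: "lead_mono x = xm 1 0 0"
    by (rule leads3_lead_mono) (simp add: mvar_def leads_single)
  have "lead_mono C.F1 = xm 0 (p^2) 0" "lead_mono C.F2 = xm 0 (p^2 + 2 * p) 0"
    using leads_F1(1) leads_F2(1) by (simp_all add: leads3_iff)
  then show ?thesis
    using F_nz by (simp add: bprod_gens3 lead_mono_mult lead_mono_power[OF lx] lead_mono_power[of _ 0 _ 0] xm_add mult.commute)
qed

lemma homog_gens3: "homog (deg3 K) (bprod gens3 K)"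
  unfolding bprod_gens3 deg3_def
  using homog_mult[OF homog_mult[OF homog_power[OF homog_mvar, of "lookup K 0" X]
        homog_power[OF homog_forms(3), of "lookup K 1"]] homog_power[OF homog_forms(4), of "lookup K 2"]]
  by (simp add: mult.commute)

lemma lead_mono_deg3: "total_degree (lead_mono (bprod gens3 K)) = deg3 K"
  by (simp add: lead_mono_gens3 deg3_def)

text \<open>An exponent of \<open>F2\<close> of at least \<open>p\<close> would exhaust the degree
  and give the lead monomial of the pair itself. Below \<open>p\<close>, the exponent p(p(a + b) +
  2b) of \<open>y\<close> determines a and b, and that of \<open>x\<close> is visible.\<close>

lemma inj_gens3:
  "inj_on (\<lambda>K. lead_mono (bprod gens3 K)) {K \<in> pres_mono gens3. deg3 K = p^3 + 2 * p^2 \<and>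
    key3 (lead_mono (bprod gens3 K)) < key3 (lead_mono (bprod gens3 (single 1 (p + 2))))}"
proof (rule inj_onI)
  let ?S = "{K \<in> pres_mono gens3. deg3 K = p^3 + 2 * p^2 \<and>
    key3 (lead_mono (bprod gens3 K)) < key3 (lead_mono (bprod gens3 (single 1 (p + 2))))}"
  have small: "lookup K 2 < p" if "K \<in> ?S" for K
  proof (rule ccontr)
    assume "\<not> lookup K 2 < p"
    then have "(p^2 + 2 * p) * p \<le> (p^2 + 2 * p) * lookup K 2" by simp
    moreover have "(p^2 + 2 * p) * p = p^3 + 2 * p^2" by (simp add: power2_eq_square power3_eq_cube algebra_simps)
    ultimately have "p^3 + 2 * p^2 \<le> p^2 * lookup K 1 + (p^2 + 2 * p) * lookup K 2" by linarith
    moreover have "p^2 * (p + 2) = p^3 + 2 * p^2" by (simp add: power2_eq_square power3_eq_cube algebra_simps)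
    ultimately show False
      using that by (auto simp: lead_mono_gens3 lookup_single key3_def deg3_def)
  qed
  fix K K' assume K: "K \<in> ?S" "K' \<in> ?S" and eq: "lead_mono (bprod gens3 K) = lead_mono (bprod gens3 K')"
  have e: "p^2 * a + (p^2 + 2 * p) * b = p * (p * (a + b) + 2 * b)" for a b
    by (simp add: power2_eq_square algebra_simps)
  have "p * (lookup K 1 + lookup K 2) + 2 * lookup K 2 =
      p * (lookup K' 1 + lookup K' 2) + 2 * lookup K' 2"
    using eq p unfolding lead_mono_gens3 e xm_inject by simp
  from odd_split_unique[OF C.p3(2) small[OF K(1)] small[OF K(2)] this]
  have "lookup K 2 = lookup K' 2" "lookup K 1 = lookup K' 1" by auto
  moreover have "lookup K 0 = lookup K' 0" using eq by (simp add: lead_mono_gens3)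
  moreover have "lookup L i = 0" if "L \<in> pres_mono gens3" "i \<noteq> 0" "i \<noteq> 1" "i \<noteq> 2" for L i
  proof (rule ccontr)
    assume "lookup L i \<noteq> 0"
    then have "i \<in> keys L" by (simp only: in_keys_iff not_False_eq_True)
    then have "i < length gens3" using that(1) by (auto simp: pres_mono_def)
    then show False using that(2-) by (auto simp: gens3_def)
  qed
  ultimately show "K = K'"
    using K by (intro poly_mapping_eqI) (metis (mono_tags, lifting) mem_Collect_eq)
qed

definition exps3 :: "nat \<Rightarrow> nat \<Rightarrow> nat \<Rightarrow> nat mono"
  where "exps3 i a b = single 0 i + single 1 a + single 2 b"

lemma lookup_exps3: "lookup (exps3 i a b) 0 = i" "lookup (exps3 i a b) 1 = a"
  "lookup (exps3 i a b) 2 = b"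
  by (simp_all add: exps3_def lookup_add lookup_single)

lemma exps3_pres: "exps3 i a b \<in> pres_mono gens3"
proof -
  have "keys (exps3 i a b) \<subseteq> {0, 1, 2}"
    by (auto simp: exps3_def in_keys_iff lookup_add lookup_single when_def split: if_splits)
  then show ?thesis by (auto simp: pres_mono_def gens3_def)
qed

text \<open>Divided by the p-th power of the minor 1235, the identity writes the start of the
  subduction as the claimed result plus four products. These have smaller exponents of
  \<open>x\<close> in the same degree, so \<open>subduction_reach\<close> applies. The result is
  stuck because its exponent p^3 + 2 of \<open>y\<close> is not divisible by \<open>p\<close>,
  whereas those of all products are.\<close>

lemma fbar3_subduction:
  assumes "C3 \<noteq> 0" "homog (p^3 + 2) g3" "cg x g3 (mconst C3 * y ^ (p^3 + 2))"
    "mconst (gam p M 1 2 3 5 ^ p) * C.F1 ^ (p + 2) - mconst (g0^2) * C.F2 ^ p + tail s2 s3 s4 = x ^ (2 * p^2 - 2) * g3"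
  shows "subduction_result gens3 (single 1 (p + 2)) (single 2 p)
    (x ^ (2 * p^2 - 2) * (mconst (1 / gam p M 1 2 3 5 ^ p) * g3))"
proof -
  let ?I = "single 1 (p + 2) :: nat mono" and ?J = "single 2 p :: nat mono"
  define A where "A = gam p M 1 2 3 5 ^ p"
  have A: "A \<noteq> 0" using nz by (simp add: A_def)
  define H where "H = x ^ (2 * p^2 - 2) * (mconst (1 / A) * g3)"
  have I: "?I = exps3 0 (p + 2) 0" and J: "?J = exps3 0 0 p" by (simp_all add: exps3_def)
  have LI: "lead_mono (bprod gens3 ?I) = xm 0 (p^3 + 2 * p^2) 0" and LJ: "lead_mono (bprod gens3 ?J) = xm 0 (p^3 + 2 * p^2) 0"
    unfolding lead_mono_gens3 I J lookup_exps3 by (simp_all add: power2_eq_square power3_eq_cube algebra_simps)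
  have BI: "bprod gens3 ?I = C.F1 ^ (p + 2)" and BJ: "bprod gens3 ?J = C.F2 ^ p"
    unfolding bprod_gens3 I J lookup_exps3 by simp_all
  have tt: "tete_a_tete gens3 ?I ?J"
    unfolding tete_a_tete_def LI LJ unfolding I J by (simp only: exps3_pres)
  have c1: "lookup (C.F1 ^ (p + 2)) (xm 0 (p^3 + 2 * p^2) 0) = g0 ^ (p + 2)"
    using leads_power[OF compat_key3, of C.F1 Y "p^2" "p + 2"] leads_F1 unfolding xm_simps pair_degrees by simp
  have c2: "lookup (C.F2 ^ p) (xm 0 (p^3 + 2 * p^2) 0) = (g0 * gam p M 1 2 3 5) ^ p"
    using leads_power[OF compat_key3, of C.F2 Y "p^2 + 2 * p" p] leads_F2 unfolding xm_simps pair_degrees by simp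
  have lt: "lead_term (bprod gens3 ?I) = lead_term (mconst (g0^2 / A) * bprod gens3 ?J)"
  proof -
    have n0: "g0^2 / A \<noteq> 0" using nz A by simp
    have n: "bprod gens3 ?I \<noteq> 0" "mconst (g0^2 / A) * bprod gens3 ?J \<noteq> 0" using bprod_nz[OF nz_gens3] n0 by simp_all
    show ?thesis
      unfolding lead_term_eq_iff[OF n] lead_mono_mconst_mult[OF n0] LI LJ lookup_mconst_mult
      unfolding BI BJ c1 c2
      using A nz by (simp add: A_def power_mult_distrib power_add power2_eq_square)
  qed
  have st: "subduction_state gens3 ?I ?J (single ?I 1 - single ?J (g0^2 / A))"
    by (rule subduction_state.start[OF tt lt])
  let ?K1 = "exps3 (p^2 - 2 * p) p 1" and ?K2 = "exps3 (p^2) (p + 1) 0" and ?K3 = "exps3 (2 * p^2 - 2 * p) (p - 1) 1"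
    and ?K4 = "exps3 (2 * p^2 - p) ((p - 3) div 2) ((p + 1) div 2)"
  define S where "S = {?K1, ?K2, ?K3, ?K4}"
  \<comment> \<open>The four products differ in their exponents of \<open>x\<close>, which serve to
    look up the coefficient.\<close>
  define d where "d = (\<lambda>K :: nat mono. let i = lookup K 0 in
    if i = p^2 - 2 * p then 2 * A / A else if i = p^2 then - s2 / A else if i = 2 * p^2 - 2 * p then - s3 / A else - s4 / A)"
  have lt4: "p^2 - 2 * p < p^2" "p^2 < 2 * p^2 - 2 * p" "2 * p^2 - 2 * p < 2 * p^2 - p"
    using C.p2 p by linarith+
  have injl: "inj_on (\<lambda>K. lookup K 0) S"
    unfolding S_def using lt4 by (auto simp: inj_on_def lookup_exps3)
  have "(\<Sum>K\<in>S. mconst (d K) * bprod gens3 K) = mconst (d ?K1) * bprod gens3 ?K1 + (mconst (d ?K2) * bprod gens3 ?K2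
      + (mconst (d ?K3) * bprod gens3 ?K3 + mconst (d ?K4) * bprod gens3 ?K4))"
  proof -
    have "?K1 \<noteq> ?K2" "?K1 \<noteq> ?K3" "?K1 \<noteq> ?K4" "?K2 \<noteq> ?K3" "?K2 \<noteq> ?K4" "?K3 \<noteq> ?K4"
      using lt4 by (auto dest!: arg_cong[of _ _ "\<lambda>K. lookup K 0"] simp: lookup_exps3)
    then show ?thesis unfolding S_def by simp
  qed
  also have "\<dots> = - (mconst (1 / A) * tail s2 s3 s4)"
  proof -
    have ne: "p^2 \<noteq> p^2 - 2 * p" "2 * p^2 - 2 * p \<noteq> p^2 - 2 * p" "2 * p^2 - p \<noteq> p^2 - 2 * p"
      "2 * p^2 - 2 * p \<noteq> p^2" "2 * p^2 - p \<noteq> p^2" "2 * p^2 - p \<noteq> 2 * p^2 - 2 * p"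
      using lt4 by linarith+
    have d: "d ?K1 = 2 * A / A" "d ?K2 = - s2 / A" "d ?K3 = - s3 / A" "d ?K4 = - s4 / A"
      unfolding d_def Let_def lookup_exps3 by (simp_all only: ne if_False if_True simp_thms)
    have m: "mconst (u / A) = mconst (1 / A) * mconst u" for u :: 'a
      by (simp flip: mconst_mult)
    show ?thesis
      unfolding d tail_def bprod_gens3 lookup_exps3 A_def[symmetric] m[of "2 * A"] m[of "- s2"] m[of "- s3"] m[of "- s4"] mconst_uminus
      by (simp only: distrib_left mult_minus_right mult_minus_left minus_add_distrib minus_minus mult.assoc add.assoc)
  qed
  finally have sum: "(\<Sum>K\<in>S. mconst (d K) * bprod gens3 K) = - (mconst (1 / A) * tail s2 s3 s4)" .
  have "mconst (1 / A) * (mconst A * C.F1 ^ (p + 2) - mconst (g0^2) * C.F2 ^ p + tail s2 s3 s4) = H"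
    unfolding assms(4)[folded A_def] H_def by (simp only: mult_ac)
  then have "C.F1 ^ (p + 2) - mconst (g0^2 / A) * C.F2 ^ p + mconst (1 / A) * tail s2 s3 s4 = H"
    unfolding distrib_left right_diff_distrib mconst_inverse_cancel[OF A] by (simp add: mult.assoc[symmetric] flip: mconst_mult)
  then have "C.F1 ^ (p + 2) - mconst (g0^2 / A) * C.F2 ^ p = H + - (mconst (1 / A) * tail s2 s3 s4)"
    by (simp only: eq_diff_eq diff_conv_add_uminus[symmetric])
  moreover have "?I \<in> pres_mono gens3" "?J \<in> pres_mono gens3" using tt unfolding tete_a_tete_def by blast+
  ultimately have eq: "pres_map gens3 (single ?I 1 - single ?J (g0^2 / A)) =
      H + (\<Sum>K\<in>S. mconst (d K) * bprod gens3 K)"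
    by (simp only: sum pres_map_diff_single pres_map_single BI BJ mconst_1 mult_1_left)
  have degH: "homog (p^3 + 2 * p^2) H"
  proof -
    have "homog ((2 * p^2 - 2) * 1 + (p^3 + 2)) H"
      unfolding H_def by (intro homog_mult homog_power homog_mvar homog_mconst_mult assms(2))
    moreover have "(2 * p^2 - 2) * 1 + (p^3 + 2) = p^3 + 2 * p^2" using C.p2 p by linarith
    ultimately show ?thesis by (simp only:)
  qed
  have ex: "\<exists>Q. subduction_state gens3 ?I ?J Q \<and> pres_map gens3 Q = H"
  proof (rule subduction_reach[OF _ _ _ nz_gens3 st eq])
    show "finite S" "S \<subseteq> pres_mono gens3" by (auto simp: S_def exps3_pres)
    show "inj_on (\<lambda>K. lead_mono (bprod gens3 K)) S"
      using injl by (auto simp: inj_on_def lead_mono_gens3)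
    fix K s assume K: "K \<in> S" and s: "s \<in> keys H"
    have K0: "lookup K 0 < 2 * p^2 - 2"
      using K lt4 C.p2 p by (auto simp: S_def lookup_exps3)
    have dK: "total_degree (lead_mono (bprod gens3 K)) = p^3 + 2 * p^2"
      using K tail_degrees unfolding S_def lead_mono_deg3 deg3_def by (elim insertE emptyE) (simp_all only: lookup_exps3)
    have "2 * p^2 - 2 \<le> lookup s X"
      using s unfolding H_def by (rule keys_mvar_power_mult)
    moreover have "total_degree s = p^3 + 2 * p^2" using degH s by (simp add: homog_def)
    ultimately show "key3 s < key3 (lead_mono (bprod gens3 K))"
      using K0 dK by (auto simp: key3_def total_degree_xyz lead_mono_gens3)
  qed
  have stuck: "lead_mono H \<noteq> lead_mono (bprod gens3 K)" for K
  proof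
    assume eq: "lead_mono H = lead_mono (bprod gens3 K)"
    have g3: "leads3 g3 (xm 0 (p^3 + 2) 0)" by (rule leads3_Y[OF assms(2,3,1)])
    have "leads3 (x ^ (2 * p^2 - 2)) (xm (2 * p^2 - 2) 0 0)" by (simp add: mvar_power leads_single)
    from leads_mult(1)[OF compat_key3 this, of "mconst (1 / A) * g3" "xm 0 (p^3 + 2) 0"]
    have "lead_mono H = xm (2 * p^2 - 2) (p^3 + 2) 0"
      using g3 A unfolding H_def by (simp add: leads3_iff lead_mono_mconst_mult xm_add)
    then have "p^3 + 2 = p^2 * lookup K 1 + (p^2 + 2 * p) * lookup K 2"
      using eq by (simp add: lead_mono_gens3)
    then have "p * p^2 + 2 = p * (p * lookup K 1 + (p + 2) * lookup K 2)"
      by (simp add: power2_eq_square power3_eq_cube algebra_simps)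
    then have "p dvd 2" by (metis dvd_add_right_iff dvd_triv_left)
    then show False using p by (auto dest: dvd_imp_le)
  qed
  from ex obtain Q where "subduction_state gens3 ?I ?J Q" "H = pres_map gens3 Q" by auto
  with stuck have "subduction_result gens3 ?I ?J H" unfolding subduction_result_def by blast
  then show ?thesis by (simp only: H_def A_def)
qed

text \<open>Uniqueness of the subduction result and of the splitting off of the power of
  \<open>x\<close> evaluate the description that defines \<open>fbar3\<close>: it is
  \<open>g3\<close>, scaled to the prescribed lead coefficient. In the identity for
  \<open>g3\<close> only \<open>F2 ^ p\<close> lies outside \<open>D p\<close>, which gives the last
  statement.\<close>

lemma
  shows leads_fbar3: "leads3 (fbar3 p M) (xm 0 (p^3 + 2) 0)"
    and homog_fbar3: "homog (p^3 + 2) (fbar3 p M)"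
    and fbar3_monic: "\<exists>\<kappa> n. \<kappa> \<noteq> 0 \<and> x ^ n * fbar3 p M - mconst \<kappa> * C.F2 ^ p \<in> D p"
proof -
  let ?a = "gam p M 1 2 3 5" and ?I = "single 1 (p + 2) :: nat mono" and ?J = "single 2 p :: nat mono"
  obtain s2 s3 s4 C3 g3 where g3: "C3 \<noteq> 0" "homog (p^3 + 2) g3" "cg x g3 (mconst C3 * y ^ (p^3 + 2))"
    "mconst (?a ^ p) * C.F1 ^ (p + 2) - mconst (g0^2) * C.F2 ^ p + tail s2 s3 s4 = x ^ (2 * p^2 - 2) * g3"
    by (rule fbar3_unscaled)
  define H where "H = x ^ (2 * p^2 - 2) * (mconst (1 / ?a ^ p) * g3)"
  have res: "subduction_result gens3 ?I ?J H" unfolding H_def by (rule fbar3_subduction[OF g3])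
  have uniq: "h = H" if "subduction_result gens3 ?I ?J h" for h
  proof (rule subduction_result_unique[OF that res nz_gens3 homog_gens3 _ _ inj_gens3])
    show "deg3 ?I = p^3 + 2 * p^2" "deg3 ?J = p^3 + 2 * p^2"
      by (simp_all add: deg3_def lookup_single power2_eq_square power3_eq_cube algebra_simps)
  qed
  have l: "leads3 g3 (xm 0 (p^3 + 2) 0)" "lookup g3 (xm 0 (p^3 + 2) 0) = C3"
    using leads3_Y[OF g3(2,3,1)] by blast+
  have ndvd: "\<not> x dvd mconst c * g3" if "c \<noteq> 0" for c
  proof
    assume "x dvd mconst c * g3"
    then obtain r where "mconst c * g3 = x ^ 1 * r" by auto
    then have "xm 0 (p^3 + 2) 0 \<in> keys (x ^ 1 * r)" using l that g3(1) by (metis in_keys_iff lookup_mconst_mult mult_eq_0_iff)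
    from keys_mvar_power_mult[OF this] show False by simp
  qed
  have lt: "lead_term (mconst c * g3) = single (xm 0 (p^3 + 2) 0) (c * C3)" if "c \<noteq> 0" for c
    using l that by (simp add: lead_term_def leads3_iff lead_mono_mconst_mult)
  have a: "?a ^ p \<noteq> 0" using nz by simp
  define F3 where "F3 = mconst (gam p M 1 3 5 7 / C3) * g3"
  have s0: "gam p M 1 3 5 7 / C3 \<noteq> 0" using nz g3(1) by simp
  have fb: "fbar3 p M = F3"
    unfolding fbar3_def fbar1_eq fbar2_eq gens3_def[symmetric] xm_simps
  proof (rule the_equality)
    show "\<exists>h n g s. subduction_result gens3 ?I ?J h \<and> h = x ^ n * g \<and> \<not> x dvd g \<and> F3 = mconst s * g \<and>
      lead_term F3 = single (xm 0 (p^3 + 2) 0) (gam p M 1 3 5 7)"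
    proof (intro exI conjI)
      show "subduction_result gens3 ?I ?J H" by (rule res)
      show "H = x ^ (2 * p^2 - 2) * (mconst (1 / ?a ^ p) * g3)" by (rule H_def)
      show "\<not> x dvd mconst (1 / ?a ^ p) * g3" using a by (intro ndvd) simp
      show "F3 = mconst (gam p M 1 3 5 7 / C3 * ?a ^ p) * (mconst (1 / ?a ^ p) * g3)"
        unfolding F3_def using a by (simp flip: mult.assoc mconst_mult)
      show "lead_term F3 = single (xm 0 (p^3 + 2) 0) (gam p M 1 3 5 7)"
        unfolding F3_def lt[OF s0] using g3(1) by simp
    qed
    fix f assume "\<exists>h n g s. subduction_result gens3 ?I ?J h \<and> h = x ^ n * g \<and> \<not> x dvd g \<and> f = mconst s * g \<and>
      lead_term f = single (xm 0 (p^3 + 2) 0) (gam p M 1 3 5 7)"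
    then obtain h n g s where f: "subduction_result gens3 ?I ?J h" "h = x ^ n * g" "\<not> x dvd g" "f = mconst s * g"
      "lead_term f = single (xm 0 (p^3 + 2) 0) (gam p M 1 3 5 7)" by blast
    have "x ^ n * g = x ^ (2 * p^2 - 2) * (mconst (1 / ?a ^ p) * g3)"
      using uniq[OF f(1)] f(2) H_def by simp
    from mvar_power_mult_unique[OF this f(3) ndvd] a have g: "g = mconst (1 / ?a ^ p) * g3" by simp
    have feq: "f = mconst (s * (1 / ?a ^ p)) * g3" unfolding f(4) g by (simp only: mconst_mult mult.assoc)
    have "s \<noteq> 0"
    proof
      assume "s = 0"
      then have "lead_term f = 0" by (simp add: f(4) lead_term_eq_0_iff)
      then have "lookup (single (xm 0 (p^3 + 2) 0) (gam p M 1 3 5 7)) (xm 0 (p^3 + 2) 0) = 0"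
        unfolding f(5) by simp
      then show False using nz by simp
    qed
    then have sa: "s * (1 / ?a ^ p) \<noteq> 0" using a by simp
    have "single (xm 0 (p^3 + 2) 0) (s * (1 / ?a ^ p) * C3) = single (xm 0 (p^3 + 2) 0) (gam p M 1 3 5 7)"
      using f(5) unfolding feq lt[OF sa] .
    then have "s * (1 / ?a ^ p) * C3 = gam p M 1 3 5 7" by (metis lookup_single_eq)
    then have "s * (1 / ?a ^ p) = gam p M 1 3 5 7 / C3" using g3(1) by (simp add: field_simps)
    then show "f = F3" unfolding feq F3_def by simp
  qed
  show "leads3 (fbar3 p M) (xm 0 (p^3 + 2) 0)" "homog (p^3 + 2) (fbar3 p M)"
    unfolding fb F3_def using l s0 homog_mconst_mult[OF g3(2)] by (simp_all add: leads3_iff lead_mono_mconst_mult)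
  define \<sigma> where "\<sigma> = gam p M 1 3 5 7 / C3"
  have "x ^ (2 * p^2 - 2) * F3 = mconst \<sigma> * (x ^ (2 * p^2 - 2) * g3)" unfolding F3_def \<sigma>_def by (simp only: mult_ac)
  also have "\<dots> = mconst (\<sigma> * ?a ^ p) * (x ^ 0 * C.F1 ^ (p + 2) * C.F2 ^ 0) + mconst (- \<sigma> * g0^2) * C.F2 ^ p + mconst \<sigma> * tail s2 s3 s4"
    unfolding g3(4)[symmetric] mconst_mult mconst_uminus power_0 mult_1_right mult_1_left
    by (simp only: distrib_left right_diff_distrib mult.assoc mult_minus_left mult_minus_right diff_conv_add_uminus)
  finally have F3: "x ^ (2 * p^2 - 2) * F3 = mconst (\<sigma> * ?a ^ p) * (x ^ 0 * C.F1 ^ (p + 2) * C.F2 ^ 0) + mconst (- \<sigma> * g0^2) * C.F2 ^ p + mconst \<sigma> * tail s2 s3 s4" .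
  have "u + v + w - v = u + w" for u v w :: "(xyz, 'a) mpoly" by simp
  then have "x ^ (2 * p^2 - 2) * F3 - mconst (- \<sigma> * g0^2) * C.F2 ^ p =
      mconst (\<sigma> * ?a ^ p) * (x ^ 0 * C.F1 ^ (p + 2) * C.F2 ^ 0) + mconst \<sigma> * tail s2 s3 s4" unfolding F3 .
  also have "\<dots> \<in> D p" using p by (intro D_add D_mconst D_gen D_tail) simp
  finally have "x ^ (2 * p^2 - 2) * F3 - mconst (- \<sigma> * g0^2) * C.F2 ^ p \<in> D p" .
  moreover have "- \<sigma> * g0^2 \<noteq> 0" using s0 nz by (simp add: \<sigma>_def)
  ultimately show "\<exists>\<kappa> n. \<kappa> \<noteq> 0 \<and> x ^ n * fbar3 p M - mconst \<kappa> * C.F2 ^ p \<in> D p" unfolding fb by blast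
qed

end

subsection \<open>The invariants\<close>

context rank_four
begin

lemma D_0: "0 \<in> D m"
  unfolding D_def by (rule mpoly_vs.span_zero)

lemma D_F1_mult: "f \<in> D m \<Longrightarrow> x ^ i * C.F1 ^ a * f \<in> D m"
  using D_gen[of 0 1 i a] by (intro D_mult[of "x ^ i * C.F1 ^ a" 1 f m m]) simp_all

text \<open>After \<open>x\<close> is inverted, \<open>T\<close> is a polynomial of degree b in
  \<open>fbar2\<close> whose lead coefficient is a unit, namely a scalar times a power of
  \<open>x\<close>. Such a \<open>T\<close> can replace \<open>F2 ^ b\<close> in a spanning
  set.\<close>

definition order_f2 :: "(xyz, 'a) mpoly \<Rightarrow> nat \<Rightarrow> bool"
  where "order_f2 T b \<longleftrightarrow> (\<exists>n m \<kappa>. \<kappa> \<noteq> 0 \<and> x ^ n * T - mconst \<kappa> * (x ^ m * C.F2 ^ b) \<in> D b)"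

lemma order_f2_mult:
  assumes "order_f2 T b" "order_f2 T' b'"
  shows "order_f2 (T * T') (b + b')"
proof -
  obtain n m \<kappa> where 1: "\<kappa> \<noteq> 0" "x ^ n * T - mconst \<kappa> * (x ^ m * C.F2 ^ b) \<in> D b"
    using assms(1) by (auto simp: order_f2_def)
  obtain n' m' \<kappa>' where 2: "\<kappa>' \<noteq> 0" "x ^ n' * T' - mconst \<kappa>' * (x ^ m' * C.F2 ^ b') \<in> D b'"
    using assms(2) by (auto simp: order_f2_def)
  have D: "mconst c * (x ^ k * C.F2 ^ e) \<in> D (e + 1)" for c k e
    using D_gen[of e "e + 1" k 0] by (intro D_mconst) simp
  have "x ^ n' * T' = (x ^ n' * T' - mconst \<kappa>' * (x ^ m' * C.F2 ^ b')) + mconst \<kappa>' * (x ^ m' * C.F2 ^ b')" by simp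
  also have "\<dots> \<in> D (b' + 1)" by (intro D_add D D_mono[OF 2(2)]) simp
  finally have T': "x ^ n' * T' \<in> D (b' + 1)" .
  have alg: "(n1 * T) * (n2 * T') - (k1 * f1) * (k2 * f2) = (n1 * T - k1 * f1) * (n2 * T') + k1 * f1 * (n2 * T' - k2 * f2)"
    for n1 n2 k1 k2 f1 f2 :: "(xyz, 'a) mpoly" by (simp add: algebra_simps)
  have "x ^ (n + n') * (T * T') - mconst (\<kappa> * \<kappa>') * (x ^ (m + m') * C.F2 ^ (b + b')) =
      (x ^ n * T) * (x ^ n' * T') - (mconst \<kappa> * (x ^ m * C.F2 ^ b)) * (mconst \<kappa>' * (x ^ m' * C.F2 ^ b'))"
    unfolding power_add mconst_mult by (simp only: mult_ac)
  also have "\<dots> = (x ^ n * T - mconst \<kappa> * (x ^ m * C.F2 ^ b)) * (x ^ n' * T')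
      + mconst \<kappa> * (x ^ m * C.F2 ^ b) * (x ^ n' * T' - mconst \<kappa>' * (x ^ m' * C.F2 ^ b'))" by (rule alg)
  also have "\<dots> \<in> D (b + b')"
    by (intro D_add D_mult[OF 1(2) T'] D_mult[OF D 2(2)]) simp_all
  finally show ?thesis unfolding order_f2_def using 1(1) 2(1) by (metis mult_eq_0_iff)
qed

lemma order_f2_1: "order_f2 1 0"
  unfolding order_f2_def by (intro exI[of _ 0] exI[of _ 1]) (simp add: D_0)

lemma order_f2_power: "order_f2 T b \<Longrightarrow> order_f2 (T ^ k) (k * b)"
  by (induction k) (simp_all add: order_f2_1 order_f2_mult)

lemma order_f2_gens: "order_f2 C.F2 1" "order_f2 (fbar3 p M) p" "order_f2 (norm_z p M) (p^2)"
proof -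
  show "order_f2 C.F2 1" unfolding order_f2_def by (intro exI[of _ 0] exI[of _ 1]) (simp add: D_0)
  obtain \<kappa> n where "\<kappa> \<noteq> 0" "x ^ n * fbar3 p M - mconst \<kappa> * C.F2 ^ p \<in> D p" using fbar3_monic by blast
  then show "order_f2 (fbar3 p M) p" unfolding order_f2_def by (intro exI[of _ n] exI[of _ 0] exI[of _ \<kappa>]) simp
  show "order_f2 (norm_z p M) (p^2)" unfolding order_f2_def using norm_monic by metis
qed

lemma D_Inv: "D m \<subseteq> Inv"
  unfolding D_def
proof (rule mpoly_vs.span_minimal)
  show "mpoly_vs.subspace Inv"
    by (rule mpoly_vs.subspaceI) (auto simp: Inv_0 mscale_def intro: Inv_add Inv_mult Inv_mconst)
  show "{x ^ i * C.F1 ^ a * C.F2 ^ b |i a b. b < m} \<subseteq> Inv"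
    by clarify (intro Inv_mult Inv_power Inv_x Inv_F1 Inv_F2)
qed

lemma Inv_fbar3: "fbar3 p M \<in> Inv"
proof -
  obtain \<kappa> n where "x ^ n * fbar3 p M - mconst \<kappa> * C.F2 ^ p \<in> D p" using fbar3_monic by blast
  then have "(x ^ n * fbar3 p M - mconst \<kappa> * C.F2 ^ p) + mconst \<kappa> * C.F2 ^ p \<in> Inv"
    using D_Inv by (intro Inv_add Inv_mult Inv_power Inv_F2 Inv_mconst) auto
  then show ?thesis using Inv_cancel[of "x ^ n" "fbar3 p M"] by (simp add: Inv_power Inv_x)
qed

section \<open>Products of the five generators\<close>

definition gens5 :: "(xyz, 'a) mpoly list"
  where "gens5 = [x, C.F1, C.F2, fbar3 p M, norm_z p M]"

definition ydeg :: "nat mono \<Rightarrow> nat"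
  where "ydeg K = p^2 * lookup K 1 + (p^2 + 2 * p) * lookup K 2 + (p^3 + 2) * lookup K 3"

definition deg5 :: "nat mono \<Rightarrow> nat"
  where "deg5 K = lookup K 0 + ydeg K + p^4 * lookup K 4"

lemma bprod_gens5: "bprod gens5 K = x ^ lookup K 0 * C.F1 ^ lookup K 1 * C.F2 ^ lookup K 2 * fbar3 p M ^ lookup K 3 * norm_z p M ^ lookup K 4"
proof -
  have "{..<length gens5} = {0, 1, 2, 3, 4}" by (auto simp: gens5_def)
  then show ?thesis by (simp add: bprod_def gens5_def mult.assoc)
qed

lemma F3_N_nz: "fbar3 p M \<noteq> 0" "norm_z p M \<noteq> 0"
  using leads_fbar3 norm_leads(1) by (auto simp: leads3_iff)

lemma nz_gens5: "0 \<notin> set gens5"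
  using F_nz F3_N_nz by (auto simp: gens5_def)

lemma lead_mono_gens5: "lead_mono (bprod gens5 K) = xm (lookup K 0) (ydeg K) (p^4 * lookup K 4)"
proof -
  have lx: "lead_mono x = xm 1 0 0"
    by (rule leads3_lead_mono) (simp add: mvar_def leads_single)
  have "lead_mono C.F1 = xm 0 (p^2) 0" "lead_mono C.F2 = xm 0 (p^2 + 2 * p) 0"
    "lead_mono (fbar3 p M) = xm 0 (p^3 + 2) 0" "lead_mono (norm_z p M) = xm 0 0 (p^4)"
    using leads_F1(1) leads_F2(1) leads_fbar3 norm_leads(1) by (simp_all only: leads3_iff)
  then show ?thesis
    using F_nz F3_N_nz
    by (simp add: bprod_gens5 lead_mono_mult lead_mono_power[OF lx] lead_mono_power[of _ 0 _ 0] lead_mono_power[of _ 0 0]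
        xm_add ydeg_def mult.commute)
qed

lemma homog_gens5: "homog (deg5 K) (bprod gens5 K)"
proof -
  have "homog (lookup K 0 * 1 + lookup K 1 * p^2 + lookup K 2 * (p^2 + 2 * p) + lookup K 3 * (p^3 + 2) + lookup K 4 * p^4) (bprod gens5 K)"
    unfolding bprod_gens5
    by (intro homog_mult homog_power homog_mvar homog_forms homog_fbar3 norm_leads)
  then show ?thesis by (simp add: deg5_def ydeg_def algebra_simps)
qed

definition normal_exps :: "nat mono set"
  where "normal_exps = {K \<in> pres_mono gens5. lookup K 2 < p \<and> lookup K 3 < p}"

lemma normal_exps_pres: "normal_exps \<subseteq> pres_mono gens5"
  by (auto simp: normal_exps_def)

text \<open>The exponent of \<open>y\<close> is p(pA + 2b) + 2c, where b, c < p are the exponents of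
  \<open>fbar2\<close> and \<open>fbar3\<close>. Applying \<open>odd_split_unique\<close> twice
  recovers c, then b and A, and with A the exponent of \<open>fbar1\<close>. Those of
  \<open>x\<close> and the norm are read off from \<open>x\<close> and \<open>z\<close>.\<close>

lemma inj_gens5: "inj_on (\<lambda>K. lead_mono (bprod gens5 K)) normal_exps"
proof (rule inj_onI)
  fix K K' assume K: "K \<in> normal_exps" "K' \<in> normal_exps" and eq: "lead_mono (bprod gens5 K) = lead_mono (bprod gens5 K')"
  have e: "ydeg K = p * (p * (lookup K 1 + lookup K 2 + p * lookup K 3) + 2 * lookup K 2) + 2 * lookup K 3" for K
    by (simp add: ydeg_def power2_eq_square power3_eq_cube algebra_simps)
  have lt: "lookup K 2 < p" "lookup K 3 < p" "lookup K' 2 < p" "lookup K' 3 < p" using K by (auto simp: normal_exps_def)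
  have "ydeg K = ydeg K'" using eq by (simp add: lead_mono_gens5)
  then have "p * (p * (lookup K 1 + lookup K 2 + p * lookup K 3) + 2 * lookup K 2) + 2 * lookup K 3 =
      p * (p * (lookup K' 1 + lookup K' 2 + p * lookup K' 3) + 2 * lookup K' 2) + 2 * lookup K' 3" unfolding e .
  from odd_split_unique[OF C.p3(2) lt(2,4) this]
  have 3: "lookup K 3 = lookup K' 3" and "p * (lookup K 1 + lookup K 2 + p * lookup K 3) + 2 * lookup K 2 = p * (lookup K' 1 + lookup K' 2 + p * lookup K' 3) + 2 * lookup K' 2"
    by blast+
  from odd_split_unique[OF C.p3(2) lt(1,3) this(2)] 3
  have 12: "lookup K 2 = lookup K' 2" "lookup K 1 = lookup K' 1" by auto
  have 04: "lookup K 0 = lookup K' 0" "lookup K 4 = lookup K' 4" using eq p by (auto simp: lead_mono_gens5)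
  have out: "lookup J i = 0" if "J \<in> normal_exps" "i \<noteq> 0" "i \<noteq> 1" "i \<noteq> 2" "i \<noteq> 3" "i \<noteq> 4" for J i
  proof (rule ccontr)
    assume "lookup J i \<noteq> 0"
    then have "i \<in> keys J" by (simp only: in_keys_iff not_False_eq_True)
    then have "i < length gens5" using that(1) by (auto simp: normal_exps_def pres_mono_def)
    then show False using that(2-) by (auto simp: gens5_def)
  qed
  show "K = K'"
    using out[OF K(1)] out[OF K(2)] 3 12 04 by (intro poly_mapping_eqI) metis
qed

definition exps5 :: "nat \<Rightarrow> nat \<Rightarrow> nat \<Rightarrow> nat \<Rightarrow> nat \<Rightarrow> nat mono"
  where "exps5 i a b c d = single 0 i + single 1 a + single 2 b
    + single 3 c + single 4 d"

lemma lookup_exps5: "lookup (exps5 i a b c d) 0 = i" "lookup (exps5 i a b c d) 1 = a" "lookup (exps5 i a b c d) 2 = b"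
  "lookup (exps5 i a b c d) 3 = c" "lookup (exps5 i a b c d) 4 = d"
  by (simp_all add: exps5_def lookup_add lookup_single)

lemma exps5_pres: "exps5 i a b c d \<in> pres_mono gens5"
proof -
  have "keys (exps5 i a b c d) \<subseteq> {0, 1, 2, 3, 4}"
    by (auto simp: exps5_def in_keys_iff lookup_add lookup_single when_def split: if_splits)
  then show ?thesis by (auto simp: pres_mono_def gens5_def)
qed

lemma exps5_normal_exps: "b < p \<Longrightarrow> c < p \<Longrightarrow> exps5 i a b c d \<in> normal_exps"
  unfolding normal_exps_def by (simp only: mem_Collect_eq exps5_pres lookup_exps5)

definition normal_span :: "(xyz, 'a) mpoly set"
  where "normal_span = mpoly_vs.span (bprod gens5 ` normal_exps)"

lemma normal_span_leads:
  assumes "keys f \<subseteq> S" "S \<subseteq> normal_exps" "f \<noteq> 0"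
  shows "\<exists>K\<in>S. leads3 (pres_map gens5 f) (lead_mono (bprod gens5 K))"
proof -
  have f: "f \<in> carrier (pres_ring gens5)" using assms normal_exps_pres by (auto simp: carrier_pres_ring)
  have "\<exists>K\<in>keys f. leads3 (\<Sum>K\<in>keys f. mconst (d K) * bprod gens5 K) (lead_mono (bprod gens5 K)) \<and>
      (\<forall>J\<in>keys f. key3 (lead_mono (bprod gens5 J)) \<le> key3 (lead_mono (bprod gens5 K)))"
    if "d = lookup f" for d
  proof (rule leads_sum)
    show "inj_on (\<lambda>K. lead_mono (bprod gens5 K)) (keys f)"
      by (rule inj_on_subset[OF inj_gens5]) (use assms in blast)
    show "leads3 (bprod gens5 K) (lead_mono (bprod gens5 K))" for K
      using bprod_nz[OF nz_gens5] by (rule leads3_ex)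
  qed (use assms(3) inj_key3 that in \<open>auto simp: in_keys_iff\<close>)
  then show ?thesis unfolding pres_map_expand[OF f] using assms(1) by blast
qed

text \<open>The lead monomials of the products without \<open>x\<close> are distinct and not divisible by \<open>x\<close>.\<close>

lemma normal_span_cancel: "x * h \<in> normal_span \<Longrightarrow> h \<in> normal_span"
proof -
  assume "x * h \<in> normal_span"
  then obtain f where f: "keys f \<subseteq> normal_exps" "x * h = pres_map gens5 f"
    unfolding normal_span_def pres_span[OF normal_exps_pres] by auto
  have fc: "f \<in> carrier (pres_ring gens5)" using f normal_exps_pres by (auto simp: carrier_pres_ring)
  \<comment> \<open>The exponents of products without \<open>x\<close>. The part of \<open>f\<close>
    outside \<open>S\<close> can be divided by \<open>x\<close> within the normal products; the part
    \<open>f0\<close> is to be shown zero.\<close>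
  define S where "S = {K \<in> normal_exps. lookup K 0 = 0}"
  define f0 where "f0 = (\<Sum>K\<in>keys f \<inter> S. single K (lookup f K))"
  have k0: "keys f0 \<subseteq> S"
    unfolding f0_def using keys_sum[of "\<lambda>K. single K (lookup f K)" "keys f \<inter> S"]
    by (auto split: if_splits)
  have "\<exists>h1\<in>normal_span. pres_map gens5 (f - f0) = x * h1"
  proof -
    have "f - f0 = (\<Sum>K\<in>keys f - S. single K (lookup f K))"
      unfolding f0_def by (subst (1) mpoly_expand[of f]) (simp add: sum.Int_Diff[of "keys f" _ S])
    have "pres_map gens5 (f - f0) = (\<Sum>K\<in>keys f - S. mconst (lookup f K) * bprod gens5 K)"
      unfolding \<open>f - f0 = _\<close> alg_hom_sum[OF alg_hom_pres_map]
      by (intro sum.cong refl pres_map_single) (use f(1) normal_exps_pres in blast)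
    also have "\<dots> = (\<Sum>K\<in>keys f - S. x * (mconst (lookup f K) * bprod gens5 (K - single 0 1)))"
    proof (intro sum.cong refl)
      fix K assume "K \<in> keys f - S"
      then have "lookup K 0 \<noteq> 0" using f(1) by (auto simp: S_def)
      then obtain n where "lookup K 0 = Suc n" using not0_implies_Suc by blast
      then have "bprod gens5 K = x * bprod gens5 (K - single 0 1)"
        unfolding bprod_gens5 by (simp add: lookup_minus lookup_single mult.assoc)
      then show "mconst (lookup f K) * bprod gens5 K = x * (mconst (lookup f K) * bprod gens5 (K - single 0 1))"
        by (simp add: mult_ac)
    qed
    also have "\<dots> = x * (\<Sum>K\<in>keys f - S. mconst (lookup f K) * bprod gens5 (K - single 0 1))"
      by (simp add: sum_distrib_left)
    finally have eq: "pres_map gens5 (f - f0) = \<dots>" .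
    have "K - single 0 1 \<in> normal_exps" if "K \<in> keys f - S" for K
    proof -
      have K: "K \<in> normal_exps" using that f(1) by blast
      have "keys (K - single 0 1) \<subseteq> keys K"
        by (auto simp: in_keys_iff lookup_minus)
      then show ?thesis using K by (auto simp: normal_exps_def pres_mono_def lookup_minus lookup_single)
    qed
    then have "(\<Sum>K\<in>keys f - S. mconst (lookup f K) * bprod gens5 (K - single 0 1)) \<in> normal_span"
      unfolding normal_span_def by (intro mpoly_vs.span_sum span_mconst mpoly_vs.span_base imageI)
    then show ?thesis using eq by blast
  qed
  then obtain h1 where h1: "h1 \<in> normal_span" "pres_map gens5 (f - f0) = x * h1" by blast
  have pm: "pres_map gens5 f0 = x ^ 1 * (h - h1)"
    using h1(2) f(2) by (simp add: alg_hom_diff[OF alg_hom_pres_map] algebra_simps)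
  have "f0 = 0"
  proof (rule ccontr)
    assume "f0 \<noteq> 0"
    from normal_span_leads[OF k0 _ this] obtain K where K: "K \<in> S" "leads3 (pres_map gens5 f0) (lead_mono (bprod gens5 K))"
      by (auto simp: S_def)
    then have "lead_mono (bprod gens5 K) \<in> keys (x ^ 1 * (h - h1))" by (simp only: pm leads_def)
    from keys_mvar_power_mult[OF this] K(1) show False by (simp add: lead_mono_gens5 S_def)
  qed
  then have "h = h1" using pm by (simp add: alg_hom_0[OF alg_hom_pres_map])
  then show ?thesis using h1(1) by simp
qed

lemma normal_span_cancel_power: "x ^ n * h \<in> normal_span \<Longrightarrow> h \<in> normal_span"
  by (induction n) (auto simp: mult.assoc dest: normal_span_cancel)

text \<open>Induction on the bound. The top power of \<open>fbar2\<close> is traded for a product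
  \<open>T\<close> of the same order; the difference has smaller exponents of \<open>fbar2\<close>,
  and the scalar and the power of \<open>x\<close> left in front are removed by
  \<open>mconst_inverse_cancel\<close> and \<open>normal_span_cancel_power\<close>.\<close>

lemma D_normal_span: "f \<in> D m \<Longrightarrow> f \<in> normal_span"
proof (induction m arbitrary: f)
  case 0
  then show ?case by (simp add: D_def normal_span_def mpoly_vs.span_zero)
next
  case (Suc m)
  have "D (Suc m) \<subseteq> normal_span"
    unfolding D_def
  proof (rule mpoly_vs.span_minimal)
    show "mpoly_vs.subspace normal_span" unfolding normal_span_def by (rule mpoly_vs.subspace_span)
    show "{x ^ i * C.F1 ^ a * C.F2 ^ b |i a b. b < Suc m} \<subseteq> normal_span"
    proof clarify
      fix i a b assume "b < Suc m"
      then consider "b < m" | "b = m" by linarith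
      then show "x ^ i * C.F1 ^ a * C.F2 ^ b \<in> normal_span"
      proof cases
        case 1
        then show ?thesis by (intro Suc.IH D_gen)
      next
        case 2
        define r where "r = m mod p"
        define s where "s = (m div p) mod p"
        \<comment> \<open>A quotient and not a digit: the exponent of the norm is
          unrestricted.\<close>
        define t where "t = (m div p) div p"
        have m: "r * 1 + (s * p + t * p^2) = m"
        proof -
          have "m = p * (p * t + s) + r" unfolding r_def s_def t_def by simp
          then show ?thesis by (simp add: power2_eq_square algebra_simps)
        qed
        have rs: "r < p" "s < p" using p by (simp_all add: r_def s_def)
        define T where "T = C.F2 ^ r * (fbar3 p M ^ s * norm_z p M ^ t)"
        have "order_f2 T m" unfolding T_def m[symmetric] by (intro order_f2_mult order_f2_power order_f2_gens)
        then obtain n k \<kappa> where T: "\<kappa> \<noteq> 0" "x ^ n * T - mconst \<kappa> * (x ^ k * C.F2 ^ m) \<in> D m" by (auto simp: order_f2_def)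
        have alg: "u * v * w = v * w * u" for u v w :: "(xyz, 'a) mpoly" by (simp add: mult_ac)
        have "mconst \<kappa> * (x ^ k * (x ^ i * C.F1 ^ a * C.F2 ^ m)) =
            x ^ i * C.F1 ^ a * (x ^ n * T) - x ^ i * C.F1 ^ a * (x ^ n * T - mconst \<kappa> * (x ^ k * C.F2 ^ m))"
          unfolding right_diff_distrib by (simp add: mult_ac)
        also have "x ^ i * C.F1 ^ a * (x ^ n * T) = bprod gens5 (exps5 (i + n) a r s t)"
          unfolding bprod_gens5 lookup_exps5 T_def power_add by (simp only: mult_ac)
        also have "bprod gens5 (exps5 (i + n) a r s t) - x ^ i * C.F1 ^ a * (x ^ n * T - mconst \<kappa> * (x ^ k * C.F2 ^ m)) \<in> normal_span"
        proof -
          have "bprod gens5 (exps5 (i + n) a r s t) \<in> normal_span"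
            unfolding normal_span_def using exps5_normal_exps[OF rs] by (intro mpoly_vs.span_base imageI)
          moreover have "x ^ i * C.F1 ^ a * (x ^ n * T - mconst \<kappa> * (x ^ k * C.F2 ^ m)) \<in> normal_span"
            by (intro Suc.IH D_F1_mult T(2))
          ultimately show ?thesis unfolding normal_span_def by (rule mpoly_vs.span_diff)
        qed
        finally have "mconst (1 / \<kappa>) * (mconst \<kappa> * (x ^ k * (x ^ i * C.F1 ^ a * C.F2 ^ m))) \<in> normal_span"
          unfolding normal_span_def by (rule span_mconst)
        then show ?thesis unfolding mconst_inverse_cancel[OF T(1)] 2 by (rule normal_span_cancel_power)
      qed
    qed
  qed
  then show ?case using Suc.prems by blast
qed

lemma Inv_gens5: "bprod gens5 K \<in> Inv"
  unfolding bprod_gens5 by (intro Inv_mult Inv_power Inv_x Inv_F1 Inv_F2 Inv_fbar3 Inv_norm)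

lemma Inv_normal_span: "Inv = normal_span"
proof
  show "Inv \<subseteq> normal_span"
    using Inv_D D_normal_span normal_span_cancel_power by blast
  show "normal_span \<subseteq> Inv"
    unfolding normal_span_def
  proof (rule mpoly_vs.span_minimal)
    show "mpoly_vs.subspace Inv"
      by (rule mpoly_vs.subspaceI) (auto simp: Inv_0 mscale_def intro: Inv_add Inv_mult Inv_mconst)
    show "bprod gens5 ` normal_exps \<subseteq> Inv"
      using Inv_gens5 by blast
  qed
qed

lemma image_gens5: "pres_map gens5 ` carrier (pres_ring gens5) = Inv"
proof
  show "Inv \<subseteq> pres_map gens5 ` carrier (pres_ring gens5)"
    unfolding Inv_normal_span normal_span_def pres_image_span by (intro mpoly_vs.span_mono image_mono normal_exps_pres)
  show "pres_map gens5 ` carrier (pres_ring gens5) \<subseteq> Inv"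
    unfolding pres_image_span
  proof (rule mpoly_vs.span_minimal)
    show "mpoly_vs.subspace Inv" unfolding Inv_normal_span normal_span_def by (rule mpoly_vs.subspace_span)
    show "bprod gens5 ` pres_mono gens5 \<subseteq> Inv"
      using Inv_gens5 by blast
  qed
qed

lemma lm_complete_gens5: "lm_complete gens5"
  unfolding lm_complete_def
proof (intro conjI ballI impI nz_gens5)
  fix f assume "f \<in> pres_map gens5 ` carrier (pres_ring gens5)" "f \<noteq> 0"
  then obtain g where g: "keys g \<subseteq> normal_exps" "f = pres_map gens5 g"
    unfolding image_gens5 Inv_normal_span normal_span_def pres_span[OF normal_exps_pres] by auto
  have "g \<noteq> 0" using \<open>f \<noteq> 0\<close> g(2) by (auto simp: alg_hom_0[OF alg_hom_pres_map])
  from normal_span_leads[OF g(1) _ this] obtain K where "K \<in> normal_exps" "leads3 f (lead_mono (bprod gens5 K))" using g(2) by auto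
  then show "\<exists>K\<in>pres_mono gens5. lead_mono f = lead_mono (bprod gens5 K)" using normal_exps_pres by (auto simp: leads3_iff)
qed

subsection \<open>The relations\<close>

text \<open>The first factor exceeds the degrees of both relations, so that a monomial of the same degree
  involving \<open>x\<close> is lighter than one which does not; the exponents of \<open>fbar2\<close> and \<open>fbar3\<close> decide
  between the two products of a pair.\<close>

definition wt :: "nat mono \<Rightarrow> nat"
  where "wt K = (p^3 + 2 * p^2 + p^4 + 2 * p) * (ydeg K + p^4 * lookup K 4) + lookup K 2 + lookup K 3"

text \<open>The lead monomial of the pair is a pure power of \<open>y\<close>, the smallest monomial
  of its degree without \<open>x\<close>. So the products subtracted later involve \<open>x\<close>;
  their weight loses at least the constant factor of \<open>wt\<close>, more than their exponents of
  \<open>fbar2\<close> and \<open>fbar3\<close> can restore.\<close>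

lemma relation_leads:
  assumes r: "subduction_relation gens5 I J r" and dg: "deg5 I = d" "deg5 J = d" "d \<le> p^3 + 2 * p^2 + p^4 + 2 * p"
    and I0: "lookup I 0 = 0" "lookup I 4 = 0" "lookup J 0 = 0" and IJ: "lookup J 2 + lookup J 3 < lookup I 2 + lookup I 3"
  shows "leads wt r I" "lookup r I = 1" "r \<in> carrier (pres_ring gens5)" "pres_map gens5 r = 0"
proof -
  show "r \<in> carrier (pres_ring gens5)" using r subduction_state_pres by (auto simp: subduction_relation_def)
  show "pres_map gens5 r = 0" using r by (simp add: subduction_relation_def)
  let ?W = "p^3 + 2 * p^2 + p^4 + 2 * p"
  obtain c R where R: "r = single I 1 - single J c - R"
    "\<And>K. K \<in> keys R \<Longrightarrow> deg5 K = d \<and> key3 (lead_mono (bprod gens5 K)) < key3 (lead_mono (bprod gens5 I))"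
    using subduction_state_form[of gens5 I J r deg5 d, OF _ nz_gens5 homog_gens5 dg(1,2)] r
    unfolding subduction_relation_def by blast
  have wtI: "wt I = ?W * d + lookup I 2 + lookup I 3" and wtJ: "wt J = ?W * d + lookup J 2 + lookup J 3"
    using dg(1,2) I0 by (simp_all add: wt_def deg5_def)
  have J: "wt J < wt I" unfolding wtI wtJ using IJ by simp
  have K: "wt K < wt I" if "K \<in> keys R" for K
  proof -
    have K: "deg5 K = d" "key3 (lead_mono (bprod gens5 K)) < key3 (lead_mono (bprod gens5 I))" using R(2)[OF that] by auto
    have "lookup K 0 \<noteq> 0"
      using K dg(1) I0 by (auto simp: lead_mono_gens5 key3_def deg5_def)
    then have 1: "ydeg K + p^4 * lookup K 4 < d" using K(1) by (simp add: deg5_def)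
    have "1 * lookup K 2 + 1 * lookup K 3 \<le> (p^2 + 2 * p) * lookup K 2 + (p^3 + 2) * lookup K 3"
      using p by (intro add_mono mult_le_mono1) simp_all
    then have "lookup K 2 + lookup K 3 < d" using 1 by (simp add: ydeg_def)
    moreover have "?W * (ydeg K + p^4 * lookup K 4) + ?W \<le> ?W * d"
      using 1 mult_le_mono2[of "Suc (ydeg K + p^4 * lookup K 4)" d ?W] by simp
    ultimately show ?thesis unfolding wtI wt_def[of K] using dg(3) by linarith
  qed
  have "I \<notin> keys R" "I \<noteq> J" using K J by blast+
  then show 1: "lookup r I = 1" by (simp add: R(1) lookup_minus lookup_single in_keys_iff)
  show "leads wt r I" unfolding leads_def
  proof (intro conjI ballI impI)
    show "I \<in> keys r" using 1 by (simp add: in_keys_iff)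
    fix K assume "K \<in> keys r" "K \<noteq> I"
    then have "K = J \<or> K \<in> keys R"
      by (auto simp: R(1) in_keys_iff lookup_minus lookup_single when_def split: if_splits)
    then show "wt K < wt I" using J \<open>K \<in> keys R \<Longrightarrow> wt K < wt I\<close> by blast
  qed
qed

text \<open>Variables 0 to 4 stand for \<open>x\<close>, \<open>fbar1\<close>, \<open>fbar2\<close>,
  \<open>fbar3\<close> and the norm. The powers of \<open>fbar2\<close> and \<open>fbar3\<close>
  come first in their pairs, so that they have coefficient 1 in the relations.\<close>

definition I1 :: "nat mono" where "I1 = single 2 p"
definition J1 :: "nat mono" where "J1 = single 1 (p + 2)"
definition I2 :: "nat mono" where "I2 = single 3 p"
definition J2 :: "nat mono" where "J2 = single 2 1 + single 1 (p^2 - 1)"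

lemma pairs_exps5: "I1 = exps5 0 0 p 0 0" "J1 = exps5 0 (p + 2) 0 0 0" "I2 = exps5 0 0 0 p 0" "J2 = exps5 0 (p^2 - 1) 1 0 0"
  by (simp_all add: I1_def J1_def I2_def J2_def exps5_def add.commute)

lemma pairs_ydeg: "ydeg I1 = p^3 + 2 * p^2" "ydeg J1 = p^3 + 2 * p^2" "ydeg I2 = p^4 + 2 * p" "ydeg J2 = p^4 + 2 * p"
proof -
  show "ydeg I1 = p^3 + 2 * p^2" "ydeg J1 = p^3 + 2 * p^2" "ydeg I2 = p^4 + 2 * p"
    unfolding ydeg_def pairs_exps5 lookup_exps5 by (simp_all add: eval_nat_numeral algebra_simps)
  have "p^2 * (p^2 - 1) + p^2 = p^2 * p^2"
    using p by (simp add: right_diff_distrib')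
  also have "p^2 * p^2 = p^4" by (simp flip: power_add)
  finally show "ydeg J2 = p^4 + 2 * p"
    unfolding ydeg_def pairs_exps5 lookup_exps5 by (simp only: mult_1_right mult_0_right add_0_right)
qed

lemma pairs_deg5: "deg5 I1 = p^3 + 2 * p^2" "deg5 J1 = p^3 + 2 * p^2" "deg5 I2 = p^4 + 2 * p" "deg5 J2 = p^4 + 2 * p"
  unfolding deg5_def pairs_ydeg unfolding pairs_exps5 lookup_exps5 by simp_all

lemma tete_pairs: "tete_a_tete gens5 I1 J1" "tete_a_tete gens5 I2 J2"
  unfolding tete_a_tete_def lead_mono_gens5 pairs_ydeg unfolding pairs_exps5 lookup_exps5
  by (simp_all only: exps5_pres simp_thms)

lemma relations_regular:
  assumes "subduction_relation gens5 I1 J1 r1" "subduction_relation gens5 I2 J2 r2"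
  shows "regular_sequence (pres_ring gens5) [r1, r2] \<and> pres_kernel gens5 = genideal (pres_ring gens5) (set [r1, r2])"
proof (rule presentation_regular[OF _ nz_gens5])
  have lookups: "lookup I1 0 = 0" "lookup I1 4 = 0" "lookup J1 0 = 0" "lookup I2 0 = 0" "lookup I2 4 = 0" "lookup J2 0 = 0"
    "lookup J1 2 + lookup J1 3 < lookup I1 2 + lookup I1 3" "lookup J2 2 + lookup J2 3 < lookup I2 2 + lookup I2 3"
    unfolding pairs_exps5 lookup_exps5 using p by simp_all
  have r1: "leads wt r1 I1" "lookup r1 I1 = 1" "r1 \<in> carrier (pres_ring gens5)" "pres_map gens5 r1 = 0"
    using relation_leads[OF assms(1) pairs_deg5(1,2) _ lookups(1,2,3,7)] by simp_all
  have r2: "leads wt r2 I2" "lookup r2 I2 = 1" "r2 \<in> carrier (pres_ring gens5)" "pres_map gens5 r2 = 0"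
    using relation_leads[OF assms(2) pairs_deg5(3,4) _ lookups(4,5,6,8)] by simp_all
  have len: "length gens5 = 5" by (simp add: gens5_def)
  show "coprime_leads {..<length gens5} wt 2 3 p r1 r2"
  proof
    show "wt (s + t) = wt s + wt t" for s t
      by (simp add: wt_def ydeg_def lookup_add algebra_simps)
    show "leads wt r1 (single 2 p)" "lookup r1 (single 2 p) = 1"
      using r1 unfolding I1_def by blast+
    show "leads wt r2 (single 3 p)" "lookup r2 (single 3 p) = 1"
      using r2 unfolding I2_def by blast+
    show "r1 \<in> carrier (mpoly_ring {..<length gens5})" "r2 \<in> carrier (mpoly_ring {..<length gens5})"
      using r1(3) r2(3) unfolding pres_ring_def by blast+
  qed (use p in \<open>simp_all add: len\<close>)
  show "pres_map gens5 r1 = 0" "pres_map gens5 r2 = 0" by (rule r1 r2)+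
  show "inj_on (\<lambda>K. lead_mono (bprod gens5 K)) {K \<in> pres_mono gens5. lookup K 2 < p \<and> lookup K 3 < p}"
    using inj_gens5 unfolding normal_exps_def .
qed

lemma relations_ex:
  obtains r1 r2 where "subduction_relation gens5 I1 J1 r1" "subduction_relation gens5 I2 J2 r2"
  using subduction_relation_ex[OF lm_complete_gens5 tete_pairs(1)] subduction_relation_ex[OF lm_complete_gens5 tete_pairs(2)] by blast

text \<open>\<open>relations_regular\<close> speaks of arbitrary relations obtained from the two
  pairs, which covers every choice of subduction steps.\<close>

lemma ci_gens5: "ci_by_subduction gens5 [(I1, J1), (I2, J2)]"
  unfolding ci_by_subduction_def
proof (intro conjI allI impI)
  show "\<forall>(I, J)\<in>set [(I1, J1), (I2, J2)]. tete_a_tete gens5 I J \<and> (\<exists>r. subduction_relation gens5 I J r)"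
    using tete_pairs relations_ex by auto
  fix rs assume "list_all2 (\<lambda>(I, J) r. subduction_relation gens5 I J r) [(I1, J1), (I2, J2)] rs"
  then obtain r1 r2 where rs: "rs = [r1, r2]" "subduction_relation gens5 I1 J1 r1" "subduction_relation gens5 I2 J2 r2"
    by (auto simp: list_all2_Cons1)
  show "regular_sequence (pres_ring gens5) rs" "pres_kernel gens5 = genideal (pres_ring gens5) (set rs)"
    using relations_regular[OF rs(2,3)] unfolding rs(1) by blast+
qed

lemma gens5_results:
  "is_sagbi_basis (set gens5) (invariants p M)" "generated_algebra (set gens5) = invariants p M"
  "complete_intersection (invariants p M)"
proof -
  show "is_sagbi_basis (set gens5) (invariants p M)"
    using lm_complete_sagbi[OF lm_complete_gens5] unfolding image_gens5 Inv_invariants .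
  show "generated_algebra (set gens5) = invariants p M"
    unfolding generated_algebra_eq image_gens5 Inv_invariants ..
  obtain r1 r2 where "subduction_relation gens5 I1 J1 r1" "subduction_relation gens5 I2 J2 r2" by (rule relations_ex)
  from relations_regular[OF this] show "complete_intersection (invariants p M)"
    unfolding complete_intersection_def Inv_invariants using image_gens5 by blast
qed

end

theorem theorem3p1:
  fixes p :: nat and M :: "'a::field mat"
  assumes "prime p" and "p > 2" and "CHAR('a) = p"
    and "M \<in> carrier_mat 2 4"
    and "gam p M 1 2 3 4 \<noteq> 0" and "gam p M 1 2 3 5 \<noteq> 0" and "gam p M 1 3 5 7 \<noteq> 0"
  shows "let bs = [mvar X, fbar1 p M, fbar2 p M, fbar3 p M, norm_z p M] in
    is_sagbi_basis (set bs) (invariants p M) \<and>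
    generated_algebra (set bs) = invariants p M \<and>
    complete_intersection (invariants p M) \<and>
    ci_by_subduction bs
      [(Poly_Mapping.single 2 p, Poly_Mapping.single 1 (p + 2)),
       (Poly_Mapping.single 3 p, Poly_Mapping.single 2 1 + Poly_Mapping.single 1 (p^2 - 1))]"
proof -
  interpret rank_four p M by (intro rank_four.intro assms)
  have "[mvar X, fbar1 p M, fbar2 p M, fbar3 p M, norm_z p M] = gens5"
    unfolding gens5_def fbar1_eq fbar2_eq ..
  then show ?thesis
    unfolding Let_def using gens5_results ci_gens5[unfolded I1_def J1_def I2_def J2_def] by (simp only: simp_thms)
qed

end
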